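(* Let $k\ge 2$ be an integer. If $k\ge 3$, then the vertex operator algebra $\widetilde{\mathcal W}$ is generated by the single element $W^3$. If $k=2$, $3$ or $4$, then $W^3$, $W^4$ or $W^5$, respectively, is contained in a maximal ideal of $\widetilde{\mathcal W}$.
   Context: Let $\{h,e,f\}$ be the standard Chevalley basis of $sl_2$, with normalized form $\langle h,h\rangle=2$, $\langle e,f\rangle=1$. $V(k,0)$ is the universal affine vertex operator algebra (Weyl module) of $\widehat{sl}_2=sl_2\otimes\mathbb C[t,t^{-1}]\oplus\mathbb C C$ at level $k$, generated by the vacuum $\mathbf 1$ with $(sl_2\otimes\mathbb C[t])\mathbf 1=0$ and $C=k$; $a(n)$ denotes the action of $a\otimes t^n$. For $v$ in a vertex operator algebra, $v_n$ is the coefficient of $x^{-n-1}$ in $Y(v,x)$. Let $N_0=\{v\in V(k,0) : h(m)v=0 \text{ for all } m\ge 0\}$, the commutant in $V(k,0)$ of the Heisenberg subalgebra generated by $h(-1)\mathbf 1$. It is a vertex operator algebra with conformal vector $$\omega=\tfrac{1}{2k(k+2)}\big(-k\,h(-2)\mathbf 1-h(-1)^2\mathbf 1+2k\,e(-1)f(-1)\mathbf 1\big)$$ of central charge $2(k-1)/(k+2)$. For $i=3,4,5$, $W^i$ denotes a nonzero vector of weight $i$ in $N_0$ with $\omega_1W^i=iW^i$, $\omega_2W^i=\omega_3W^i=0$; it is unique up to a scalar multiple, and $$W^3=k^2h(-3)\mathbf 1+3kh(-2)h(-1)\mathbf 1+2h(-1)^3\mathbf 1-6kh(-1)e(-1)f(-1)\mathbf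 1+3k^2e(-2)f(-1)\mathbf 1-3k^2e(-1)f(-2)\mathbf 1.$$ $\widetilde{\mathcal W}$ is the vertex operator subalgebra of $N_0$ generated by $\omega,W^3,W^4,W^5$. *)

theory Defs
  imports Complex_Main "HOL-Library.Poly_Mapping"
begin

section \<open>Vertex algebras\<close>

text \<open>The field \<open>Y(u,x)\<close> is given by its modes: \<open>Y u n v\<close> is \<open>u\<^sub>n v\<close>, the coefficient of
  \<open>x\<^bsup>-n-1\<^esup>\<close> in \<open>Y(u,x)v\<close>.  The Jacobi identity is stated in its component (Borcherds) form.
  By \<open>truncation\<close> all but finitely many summands on either side vanish, so the identity of the
  formal sums is the identity of all sufficiently long partial sums.\<close>

locale vertex_algebra = vector_space scale
  for scale :: "complex \<Rightarrow> 'v::ab_group_add \<Rightarrow> 'v" (infixr \<open>*s\<close> 75) +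
  fixes Y :: "'v \<Rightarrow> int \<Rightarrow> 'v \<Rightarrow> 'v"
    and vac :: 'v
  assumes Y_add_left: "Y (u + u') n v = Y u n v + Y u' n v"
    and Y_scale_left: "Y (a *s u) n v = a *s Y u n v"
    and Y_add_right: "Y u n (v + v') = Y u n v + Y u n v'"
    and Y_scale_right: "Y u n (a *s v) = a *s Y u n v"
    and truncation: "\<exists>N. \<forall>n\<ge>N. Y u n v = 0"
    and vacuum: "Y vac n v = (if n = -1 then v else 0)"
    and creation: "Y v (-1) vac = v"
    and creation_regular: "n \<ge> 0 \<Longrightarrow> Y v n vac = 0"
    and jacobi:
      "\<forall>\<^sub>F N in sequentially.
         (\<Sum>i<N. (of_int m gchoose i) *s Y (Y u (l + int i) v) (m + n - int i) w) =
         (\<Sum>i<N. ((-1) ^ i * (of_int l gchoose i)) *s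
            (Y u (l + m - int i) (Y v (n + int i) w)
             - ((-1) powi l) *s Y v (l + n - int i) (Y u (m + int i) w)))"
begin

definition vertex_subalgebra :: "'v set \<Rightarrow> bool" where
  "vertex_subalgebra U \<longleftrightarrow>
     subspace U \<and> vac \<in> U \<and> (\<forall>u\<in>U. \<forall>v\<in>U. \<forall>n. Y u n v \<in> U)"

definition generated_subalgebra :: "'v set \<Rightarrow> 'v set" where
  "generated_subalgebra S = \<Inter>{U. vertex_subalgebra U \<and> S \<subseteq> U}"

definition ideal_of :: "'v set \<Rightarrow> 'v set \<Rightarrow> bool" where
  "ideal_of U I \<longleftrightarrow>
     subspace I \<and> I \<subseteq> U \<and> (\<forall>u\<in>U. \<forall>v\<in>I. \<forall>n. Y u n v \<in> I \<and> Y v n u \<in> I)"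

definition maximal_ideal_of :: "'v set \<Rightarrow> 'v set \<Rightarrow> bool" where
  "maximal_ideal_of U I \<longleftrightarrow>
     ideal_of U I \<and> I \<noteq> U \<and> (\<forall>J. ideal_of U J \<and> I \<subseteq> J \<and> J \<noteq> U \<longrightarrow> J = I)"

end

locale vertex_operator_algebra = vertex_algebra scale Y vac
  for scale :: "complex \<Rightarrow> 'v::ab_group_add \<Rightarrow> 'v" (infixr \<open>*s\<close> 75)
    and Y :: "'v \<Rightarrow> int \<Rightarrow> 'v \<Rightarrow> 'v"
    and vac :: 'v +
  fixes conf :: 'v
    and c :: complex
  assumes virasoro:
      "Y conf (m + 1) (Y conf (n + 1) v) - Y conf (n + 1) (Y conf (m + 1) v) =
         of_int (m - n) *s Y conf (m + n + 1) v
         + (if m + n = 0 then (of_int (m ^ 3 - m) / 12 * c) *s v else 0)"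
    and L_minus_one_derivative: "Y (Y conf 0 u) n v = - of_int n *s Y u (n - 1) v"
    and graded: "v \<in> span (\<Union>n::int. {u. Y conf 1 u = of_int n *s u})"
    and graded_finite: "\<exists>B. finite B \<and> {u. Y conf 1 u = of_int (n::int) *s u} \<subseteq> span B"
    and graded_bounded_below: "\<exists>N::int. \<forall>n<N. {u. Y conf 1 u = of_int n *s u} = {0}"
begin

definition has_weight :: "'v \<Rightarrow> int \<Rightarrow> bool" where
  "has_weight v n \<longleftrightarrow> Y conf 1 v = of_int n *s v"

end


section \<open>The Weyl module of affine sl(2)\<close>

datatype sl2 = H | E | F

text \<open>\<open>sl2_bracket a b d\<close> is the coefficient of \<open>d\<close> in \<open>[a,b]\<close>.\<close>

fun sl2_bracket :: "sl2 \<Rightarrow> sl2 \<Rightarrow> sl2 \<Rightarrow> complex" where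
  "sl2_bracket H E d = (if d = E then 2 else 0)"
| "sl2_bracket E H d = (if d = E then -2 else 0)"
| "sl2_bracket H F d = (if d = F then -2 else 0)"
| "sl2_bracket F H d = (if d = F then 2 else 0)"
| "sl2_bracket E F d = (if d = H then 1 else 0)"
| "sl2_bracket F E d = (if d = H then -1 else 0)"
| "sl2_bracket a b d = 0"

fun sl2_form :: "sl2 \<Rightarrow> sl2 \<Rightarrow> complex" where
  "sl2_form H H = 2"
| "sl2_form E F = 1"
| "sl2_form F E = 1"
| "sl2_form a b = 0"

text \<open>The elements of the free associative algebra on the symbols \<open>a(n) = a \<otimes> t\<^sup>n\<close> are finitely
  supported functions on words.  \<open>weyl_relations k\<close> is the sum of the two-sided ideal generated by
  the relations of the affine Lie algebra with \<open>C = k\<close>,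
  \[ [a(m),b(n)] = [a,b](m+n) + m \langle a,b\rangle \delta_{m+n,0} k, \]
  and of the left ideal generated by the \<open>a(n)\<close> with \<open>n \<ge> 0\<close>.  The quotient of the free algebra by
  it is the induced module on which \<open>C\<close> acts as \<open>k\<close>.\<close>

type_synonym mode_word = "(sl2 \<times> int) list"

inductive_set weyl_relations :: "complex \<Rightarrow> (mode_word \<Rightarrow>\<^sub>0 complex) set"
  for k :: complex where
  zero: "0 \<in> weyl_relations k"
| add: "p \<in> weyl_relations k \<Longrightarrow> q \<in> weyl_relations k \<Longrightarrow> p + q \<in> weyl_relations k"
| commutator:
    "Poly_Mapping.single (u @ [(a, m), (b, n)] @ w) s
       - Poly_Mapping.single (u @ [(b, n), (a, m)] @ w) s
       - (\<Sum>d\<in>{H, E, F}. Poly_Mapping.single (u @ [(d, m + n)] @ w) (s * sl2_bracket a b d))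
       - Poly_Mapping.single (u @ w)
           (if m + n = 0 then s * of_int m * sl2_form a b * k else 0)
     \<in> weyl_relations k"
| annihilation:
    "n \<ge> 0 \<Longrightarrow> Poly_Mapping.single (u @ [(a, n)]) s \<in> weyl_relations k"

text \<open>\<open>V(k,0)\<close>: the vector \<open>x a\<close> is \<open>a(-1)\<one>\<close>, so that \<open>a(n)\<close> is the mode \<open>(x a)\<^sub>n\<close>.  The last two
  assumptions say that applying words to the vacuum identifies \<open>V\<close> with the induced module.  The
  conformal vector is the Sugawara vector (\<open>h/2, f, e\<close> is the basis dual to \<open>h, e, f\<close>).\<close>

locale universal_affine_sl2 = vertex_operator_algebra scale Y vac conf c
  for scale :: "complex \<Rightarrow> 'v::ab_group_add \<Rightarrow> 'v" (infixr \<open>*s\<close> 75)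
    and Y :: "'v \<Rightarrow> int \<Rightarrow> 'v \<Rightarrow> 'v"
    and vac conf :: 'v
    and c :: complex +
  fixes k :: complex
    and x :: "sl2 \<Rightarrow> 'v"
  assumes central_charge: "c = 3 * k / (k + 2)"
    and sugawara:
      "conf = (1 / (2 * (k + 2))) *s
         ((1/2) *s Y (x H) (-1) (x H) + Y (x E) (-1) (x F) + Y (x F) (-1) (x E))"
    and weyl_module_onto:
      "\<exists>p. v = (\<Sum>w\<in>Poly_Mapping.keys p.
                  Poly_Mapping.lookup p w *s foldr (\<lambda>(a, n). Y (x a) n) w vac)"
    and weyl_module_kernel:
      "(\<Sum>w\<in>Poly_Mapping.keys p.
          Poly_Mapping.lookup p w *s foldr (\<lambda>(a, n). Y (x a) n) w vac) = 0
       \<longleftrightarrow> p \<in> weyl_relations k"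
begin

abbreviation h :: "int \<Rightarrow> 'v \<Rightarrow> 'v" where "h \<equiv> Y (x H)"
abbreviation e :: "int \<Rightarrow> 'v \<Rightarrow> 'v" where "e \<equiv> Y (x E)"
abbreviation f :: "int \<Rightarrow> 'v \<Rightarrow> 'v" where "f \<equiv> Y (x F)"

definition N0 :: "'v set" where
  "N0 = {v. \<forall>m\<ge>0. h m v = 0}"

definition omega :: 'v where
  "omega = (1 / (2 * k * (k + 2))) *s
     ((- k) *s h (-2) vac - h (-1) (h (-1) vac) + (2 * k) *s e (-1) (f (-1) vac))"

definition W3 :: 'v where
  "W3 = (k\<^sup>2) *s h (-3) vac
      + (3 * k) *s h (-2) (h (-1) vac)
      + 2 *s h (-1) (h (-1) (h (-1) vac))
      - (6 * k) *s h (-1) (e (-1) (f (-1) vac))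
      + (3 * k\<^sup>2) *s e (-2) (f (-1) vac)
      - (3 * k\<^sup>2) *s e (-1) (f (-2) vac)"

definition is_W :: "int \<Rightarrow> 'v \<Rightarrow> bool" where
  "is_W i v \<longleftrightarrow>
     v \<noteq> 0 \<and> v \<in> N0 \<and> has_weight v i \<and>
     Y omega 1 v = of_int i *s v \<and> Y omega 2 v = 0 \<and> Y omega 3 v = 0"

text \<open>The generated subalgebra may be formed in \<open>V(k,0)\<close>, because \<open>N0\<close> is itself a vertex
  subalgebra and contains the generators.\<close>

definition W_tilde :: "'v \<Rightarrow> 'v \<Rightarrow> 'v set" where
  "W_tilde W4 W5 = generated_subalgebra {omega, W3, W4, W5}"

end

end

theory Submission
  imports Defs
begin

text \<open>The Heisenberg lowering operators give \<open>N0 \<inter> (\<Sum>j\<ge>1. h(-j) V) = 0\<close> in charge 0, so a vector of \<open>N0\<close> is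
  determined by its expansion in words \<open>e(-i\<^sub>1) \<dots> f(-j\<^sub>1) \<dots> \<one>\<close> without \<open>h\<close>, up to relations among
  these words; no linear independence (PBW) is needed.  Modulo the images of the \<open>h(-j)\<close> the fields
  of \<open>N0\<close> are those of polynomials in \<open>e\<close> and \<open>f\<close> alone.  Computing \<open>W3\<^sub>3 W3\<close>, \<open>\<omega>\<^sub>-\<^sub>1 \<omega>\<close>, and two further
  modes in weights 4 and 5 this way shows that for \<open>k \<ge> 3\<close> all of \<open>N0\<close> in weights 2 to 5 is generated
  by \<open>W3\<close>; the determinants are, up to powers of \<open>k\<close>, \<open>(3k+4)(k-2)\<close>, \<open>2k+3\<close> and \<open>3k+4\<close>.

  At level \<open>k = 2, 3, 4\<close> the vector \<open>W\<^bsup>k+1\<^esup>\<close> is proportional to \<open>f(0)\<^bsup>k+1\<^esup> e(-1)\<^bsup>k+1\<^esup> \<one>\<close>, which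
  all \<open>a(m)\<close> with \<open>m \<ge> 1\<close> annihilate.  The submodule it generates therefore has weights at least
  \<open>k+1\<close>, does not contain the vacuum, and meets the subalgebra in a proper ideal.\<close>

section \<open>Modes, ideals and weights in vertex algebras\<close>

text \<open>No basis of the Weyl module is ever constructed. Straightening is only proved sound: a
  computation ending in \<open>[]\<close> proves an equation, and nothing is inferred from one that
  does not. Hence the words without \<open>h\<close> are known only to span, while identifying
  \<open>W4\<close> at level 3 and \<open>W5\<close> at level 4 requires comparing coefficients
  modulo the images of the \<open>h(-j)\<close>. The substitute for linear independence is a ladder
  of nonzero vectors: the vacuum, reached from weight 2 by \<open>L(2)\<close>; then
  \<open>W3\<close> in weight 3; then, at level 4, \<open>W4\<close> in weight 4. A relation among
  words is cut down by \<open>L(1)\<close> and \<open>L(2)\<close> to a multiple of such a vector,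
  and a nonzero vector of \<open>N0\<close> cannot lie in \<open>Hspace\<close>. With this, the
  conditions on \<open>W4\<close> and \<open>W5\<close> become homogeneous linear systems whose
  solutions form a line, and the singular vector lies on that line.\<close>

context vertex_algebra
begin

lemma Y_zero_left [simp]: "Y 0 n v = 0"
  using Y_scale_left[of 0 0 n v] by simp

lemma Y_zero_right [simp]: "Y u n 0 = 0"
  using Y_scale_right[of u n 0 0] by simp

lemma Y_minus_left: "Y (- u) n v = - Y u n v"
  using Y_scale_left[of "-1" u n v] by simp

lemma Y_minus_right: "Y u n (- v) = - Y u n v"
  using Y_scale_right[of u n "-1" v] by simp

lemma Y_diff_left: "Y (u - u') n v = Y u n v - Y u' n v"
  using Y_add_left[of u "- u'" n v] by (simp add: Y_minus_left)

lemma Y_diff_right: "Y u n (v - v') = Y u n v - Y u n v'"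
  using Y_add_right[of u n v "- v'"] by (simp add: Y_minus_right)

lemma Y_sum_right: "Y u n (sum g A) = (\<Sum>a\<in>A. Y u n (g a))"
  by (induction A rule: infinite_finite_induct) (auto simp: Y_add_right)

lemmas Y_linear = Y_add_left Y_add_right Y_scale_left Y_scale_right Y_diff_left Y_diff_right
  Y_minus_left Y_minus_right

text \<open>At \<open>l = 0\<close> the binomials leave only \<open>i = 0\<close> on the right of
  the Jacobi identity, and for \<open>m \<ge> 0\<close> those on the left vanish beyond
  \<open>m\<close>. The eventual equality of partial sums thus becomes one exact finite
  identity.\<close>

lemma commutator_formula:
  "Y u (int m) (Y v n w) - Y v n (Y u (int m) w) =
     (\<Sum>i\<le>m. of_nat (m choose i) *s Y (Y u (int i) v) (int m + n - int i) w)"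
proof -
  define p where "p i = Y (Y u (int i) v) (int m + n - int i) w" for i
  have "\<forall>\<^sub>F N in sequentially.
      (\<Sum>i<N. (of_int (int m) gchoose i) *s p i) =
      (\<Sum>i<N. ((-1) ^ i * (of_int 0 gchoose i)) *s
            (Y u (0 + int m - int i) (Y v (n + int i) w)
             - ((-1) powi 0) *s Y v (0 + n - int i) (Y u (int m + int i) w)))"
    using jacobi[of "int m" u 0 v n w] by (simp add: p_def)
  then obtain M where M: "\<And>N. N \<ge> M \<Longrightarrow>
      (\<Sum>i<N. (of_int (int m) gchoose i) *s p i) =
      (\<Sum>i<N. ((-1) ^ i * (of_int 0 gchoose i)) *s
            (Y u (0 + int m - int i) (Y v (n + int i) w)
             - ((-1) powi 0) *s Y v (0 + n - int i) (Y u (int m + int i) w)))"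
    by (auto simp: eventually_sequentially)
  define N where "N = Suc (max M m)"
  have "(\<Sum>i\<le>m. of_nat (m choose i) *s p i) = (\<Sum>i<N. of_nat (m choose i) *s p i)"
    by (rule sum.mono_neutral_left) (auto simp: N_def binomial_eq_0)
  also have "\<dots> = (\<Sum>i<N. (of_int (int m) gchoose i) *s p i)"
    by (simp add: binomial_gbinomial)
  also have "\<dots> = (\<Sum>i<N. ((-1) ^ i * (of_int 0 gchoose i)) *s
            (Y u (0 + int m - int i) (Y v (n + int i) w)
             - ((-1) powi 0) *s Y v (0 + n - int i) (Y u (int m + int i) w)))"
    by (rule M) (simp add: N_def)
  also have "\<dots> = (\<Sum>i\<in>{0::nat}. ((-1) ^ i * (of_int 0 gchoose i)) *s
            (Y u (0 + int m - int i) (Y v (n + int i) w)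
             - ((-1) powi 0) *s Y v (0 + n - int i) (Y u (int m + int i) w)))"
    by (rule sum.mono_neutral_right) (auto simp: N_def gbinomial_0(2) gr0_conv_Suc)
  finally show ?thesis by (simp add: p_def)
qed

text \<open>Here \<open>m = 0\<close>, so the left side of the Jacobi identity collapses to its
  first term. The bound \<open>M\<close> makes the right side an explicit sum that can be
  computed.\<close>

lemma associator_formula:
  assumes "\<And>i. i \<ge> M \<Longrightarrow> Y v (n + int i) w = 0" and "\<And>i. i \<ge> M \<Longrightarrow> Y u (int i) w = 0"
  shows "Y (Y u l v) n w = (\<Sum>i<M. ((-1) ^ i * (of_int l gchoose i)) *s
            (Y u (l - int i) (Y v (n + int i) w)
             - ((-1) powi l) *s Y v (l + n - int i) (Y u (int i) w)))"
proof -
  define q where "q i = ((-1) ^ i * (of_int l gchoose i)) *s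
            (Y u (l - int i) (Y v (n + int i) w)
             - ((-1) powi l) *s Y v (l + n - int i) (Y u (int i) w))" for i
  obtain L where L: "\<And>N. N \<ge> L \<Longrightarrow>
      (\<Sum>i<N. (of_int 0 gchoose i) *s Y (Y u (l + int i) v) (0 + n - int i) w) = (\<Sum>i<N. q i)"
    using jacobi[of 0 u l v n w] by (auto simp: eventually_sequentially q_def)
  define N where "N = Suc (max L M)"
  have "(\<Sum>i<M. q i) = (\<Sum>i<N. q i)"
    by (rule sum.mono_neutral_left) (auto simp: N_def q_def assms)
  also have "\<dots> = (\<Sum>i<N. (of_int 0 gchoose i) *s Y (Y u (l + int i) v) (0 + n - int i) w)"
    by (rule L[symmetric]) (simp add: N_def)
  also have "\<dots> = (\<Sum>i\<in>{0::nat}. (of_int 0 gchoose i) *s Y (Y u (l + int i) v) (0 + n - int i) w)"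
    by (rule sum.mono_neutral_right) (auto simp: N_def gbinomial_0(2) gr0_conv_Suc)
  finally show ?thesis by (simp add: q_def)
qed

lemma associator_in_subspace:
  assumes S: "subspace S"
    and "\<And>i. Y u (l - int i) (Y v (n + int i) w) \<in> S"
    and "\<And>i. Y v (l + n - int i) (Y u (int i) w) \<in> S"
  shows "Y (Y u l v) n w \<in> S"
proof -
  obtain A where A: "\<And>j. j \<ge> A \<Longrightarrow> Y v j w = 0" using truncation by blast
  obtain B where B: "\<And>j. j \<ge> B \<Longrightarrow> Y u j w = 0" using truncation by blast
  define M where "M = nat (max (A - n) B)"
  have "Y (Y u l v) n w = (\<Sum>i<M. ((-1) ^ i * (of_int l gchoose i)) *s
            (Y u (l - int i) (Y v (n + int i) w)
             - ((-1) powi l) *s Y v (l + n - int i) (Y u (int i) w)))"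
    by (rule associator_formula; rule A B; simp add: M_def)
  also have "\<dots> \<in> S"
    using assms by (auto intro!: subspace_sum subspace_scale subspace_diff)
  finally show ?thesis .
qed

text \<open>This covers negative \<open>m\<close>, where the sum has no fixed length; for membership
  in a subspace the length is irrelevant.\<close>

lemma commutator_in_subspace:
  assumes S: "subspace S"
    and i: "\<And>i. Y (Y u (int i) v) (m + n - int i) w \<in> S"
  shows "Y u m (Y v n w) - Y v n (Y u m w) \<in> S"
proof -
  obtain M where M: "\<And>N. N \<ge> M \<Longrightarrow>
      (\<Sum>i<N. (of_int m gchoose i) *s Y (Y u (0 + int i) v) (m + n - int i) w) =
      (\<Sum>i<N. ((-1) ^ i * (of_int 0 gchoose i)) *s
            (Y u (0 + m - int i) (Y v (n + int i) w)
             - ((-1) powi 0) *s Y v (0 + n - int i) (Y u (m + int i) w)))"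
    using jacobi[of m u 0 v n w] by (auto simp: eventually_sequentially)
  have "Y u m (Y v n w) - Y v n (Y u m w) =
      (\<Sum>i\<in>{0::nat}. ((-1) ^ i * (of_int 0 gchoose i)) *s
            (Y u (0 + m - int i) (Y v (n + int i) w)
             - ((-1) powi 0) *s Y v (0 + n - int i) (Y u (m + int i) w)))"
    by simp
  also have "\<dots> = (\<Sum>i<Suc M. ((-1) ^ i * (of_int 0 gchoose i)) *s
            (Y u (0 + m - int i) (Y v (n + int i) w)
             - ((-1) powi 0) *s Y v (0 + n - int i) (Y u (m + int i) w)))"
    by (rule sum.mono_neutral_left) (auto simp: gbinomial_0(2) gr0_conv_Suc)
  also have "\<dots> = (\<Sum>i<Suc M. (of_int m gchoose i) *s Y (Y u (0 + int i) v) (m + n - int i) w)"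
    by (rule M[symmetric]) simp
  also have "\<dots> \<in> S"
    using i by (intro subspace_sum subspace_scale S) simp
  finally show ?thesis .
qed

section \<open>Generated subalgebras and maximal ideals\<close>

lemma generated_subalgebra_is_subalgebra: "vertex_subalgebra (generated_subalgebra S)"
  unfolding generated_subalgebra_def vertex_subalgebra_def
  by (auto simp: subspace_def)

lemma generated_subalgebra_superset: "S \<subseteq> generated_subalgebra S"
  by (auto simp: generated_subalgebra_def)

lemma generated_subalgebra_minimal:
  "vertex_subalgebra U \<Longrightarrow> S \<subseteq> U \<Longrightarrow> generated_subalgebra S \<subseteq> U"
  by (auto simp: generated_subalgebra_def)

lemma ideal_eq_iff_vac:
  assumes "ideal_of U I" "vac \<in> U"
  shows "I = U \<longleftrightarrow> vac \<in> I"
proof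
  assume "vac \<in> I"
  have "U \<subseteq> I"
  proof
    fix u assume "u \<in> U"
    then have "Y u (-1) vac \<in> I" using assms \<open>vac \<in> I\<close> by (auto simp: ideal_of_def)
    then show "u \<in> I" by (simp add: creation)
  qed
  then show "I = U" using assms by (auto simp: ideal_of_def)
qed (use assms in auto)

text \<open>Zorn's lemma for the ideals that miss \<open>vac\<close>: by
  \<open>ideal_eq_iff_vac\<close> these are the proper ones, and missing \<open>vac\<close> survives
  unions of chains.\<close>

lemma exists_maximal_ideal:
  assumes I: "ideal_of U I" and vacU: "vac \<in> U" and vacI: "vac \<notin> I"
  shows "\<exists>J. maximal_ideal_of U J \<and> I \<subseteq> J"
proof -
  define A where "A = {J. ideal_of U J \<and> I \<subseteq> J \<and> vac \<notin> J}"
  have "\<exists>M\<in>A. \<forall>X\<in>A. M \<subseteq> X \<longrightarrow> X = M"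
  proof (rule subset_Zorn_nonempty)
    show "A \<noteq> {}" using assms by (auto simp: A_def)
  next
    fix C assume C: "C \<noteq> {}" "subset.chain A C"
    have CA: "C \<subseteq> A" and ch: "\<And>X Z. X \<in> C \<Longrightarrow> Z \<in> C \<Longrightarrow> X \<subseteq> Z \<or> Z \<subseteq> X"
      using C by (auto simp: subset.chain_def)
    have id: "ideal_of U J" if "J \<in> C" for J using that CA by (auto simp: A_def)
    have sub: "subspace (\<Union>C)"
      unfolding subspace_def
    proof (intro conjI ballI allI)
      show "0 \<in> \<Union>C" using C id by (auto simp: ideal_of_def subspace_def)
    next
      fix u v assume "u \<in> \<Union>C" "v \<in> \<Union>C"
      then obtain X Z where XZ: "X \<in> C" "Z \<in> C" "u \<in> X" "v \<in> Z" by auto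
      then have "\<exists>T\<in>C. u \<in> T \<and> v \<in> T" using ch[of X Z] by auto
      then obtain T where T: "T \<in> C" "u \<in> T" "v \<in> T" by auto
      then have "u + v \<in> T" using id[of T] by (auto simp: ideal_of_def subspace_def)
      then show "u + v \<in> \<Union>C" using T by auto
    next
      fix a u assume "u \<in> \<Union>C"
      then obtain T where T: "T \<in> C" "u \<in> T" by auto
      then have "a *s u \<in> T" using id[of T] by (auto simp: ideal_of_def subspace_def)
      then show "a *s u \<in> \<Union>C" using T by auto
    qed
    have "ideal_of U (\<Union>C)"
      unfolding ideal_of_def
    proof (intro conjI ballI allI)
      show "\<Union>C \<subseteq> U" using id by (auto simp: ideal_of_def)
    next
      fix u v n assume "u \<in> U" "v \<in> \<Union>C"
      then obtain T where "T \<in> C" "v \<in> T" by auto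
      then show "Y u n v \<in> \<Union>C" "Y v n u \<in> \<Union>C"
        using id[of T] \<open>u \<in> U\<close> unfolding ideal_of_def by blast+
    qed (rule sub)
    then show "\<Union>C \<in> A" using C CA by (auto simp: A_def)
  qed
  then obtain M where M: "M \<in> A" "\<And>X. X \<in> A \<Longrightarrow> M \<subseteq> X \<Longrightarrow> X = M" by blast
  then have "maximal_ideal_of U M"
    unfolding maximal_ideal_of_def
    using ideal_eq_iff_vac[OF _ vacU] by (auto simp: A_def)
  then show ?thesis using M by (auto simp: A_def)
qed

text \<open>By induction: \<open>T - \<mu> a\<close> removes the summand at \<open>a\<close> and
  rescales the others, so the hypotheses pass to \<open>(\<nu> - \<mu> a) *s r\<close>. Repeated
  eigenvalues and vanishing summands do no harm.\<close>

lemma eigenvector_sum_eq_0: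
  assumes "finite A"
    and T: "\<And>u v. T (u + v) = T u + T v" "\<And>a v. T (a *s v) = a *s T v"
    and "\<And>w. w \<in> A \<Longrightarrow> T (g w) = \<mu> w *s g w" "\<And>w. w \<in> A \<Longrightarrow> \<mu> w \<noteq> \<nu>"
    and "T r = \<nu> *s r" "r = (\<Sum>w\<in>A. g w)"
  shows "r = 0"
  using assms(1) assms(4-)
proof (induction A arbitrary: g r)
  case empty
  then show ?case by simp
next
  case (insert a A)
  have Tsum: "T (sum f B) = (\<Sum>w\<in>B. T (f w))" if "finite B" for f and B :: "'b set"
    using that
  proof (induction B)
    case empty
    show ?case using T(2)[of 0 0] by simp
  qed (simp add: T)
  have "(\<nu> - \<mu> a) *s r = T r - \<mu> a *s r"
    using insert.prems by (simp add: scale_left_diff_distrib)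
  also have "\<dots> = (\<Sum>w\<in>insert a A. \<mu> w *s g w) - (\<Sum>w\<in>insert a A. \<mu> a *s g w)"
    unfolding insert.prems(4) using insert by (simp only: Tsum finite_insert scale_sum_right) simp
  also have "\<dots> = (\<Sum>w\<in>A. (\<mu> w - \<mu> a) *s g w)"
    using insert by (simp add: scale_left_diff_distrib sum_subtractf)
  finally have eq: "(\<nu> - \<mu> a) *s r = (\<Sum>w\<in>A. (\<mu> w - \<mu> a) *s g w)" .
  have "(\<nu> - \<mu> a) *s r = 0"
  proof (rule insert.IH)
    show "T ((\<nu> - \<mu> a) *s r) = \<nu> *s ((\<nu> - \<mu> a) *s r)"
      using insert.prems by (simp add: T mult.commute)
    show "T ((\<mu> w - \<mu> a) *s g w) = \<mu> w *s ((\<mu> w - \<mu> a) *s g w)" if "w \<in> A" for w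
      using insert.prems that by (simp add: T mult.commute)
  qed (use insert.prems eq in auto)
  then show ?case using insert.prems(2)[of a] by simp
qed

text \<open>Extracts a weight or charge component from a sum over words without knowing the words to
  be independent.\<close>

lemma eigencomponent:
  assumes "finite A"
    and T: "\<And>u v. T (u + v) = T u + T v" "\<And>a v. T (a *s v) = a *s T v"
    and g: "\<And>w. w \<in> A \<Longrightarrow> T (g w) = \<mu> w *s g w"
    and "T r = \<nu> *s r" "r = (\<Sum>w\<in>A. g w)"
  shows "r = (\<Sum>w\<in>{w\<in>A. \<mu> w = \<nu>}. g w)"
proof -
  let ?B = "{w\<in>A. \<mu> w = \<nu>}" and ?C = "{w\<in>A. \<mu> w \<noteq> \<nu>}"
  have Tsum: "T (sum f B) = (\<Sum>w\<in>B. T (f w))" if "finite B" for f and B :: "'b set"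
    using that
  proof (induction B)
    case empty
    show ?case using T(2)[of 0 0] by simp
  qed (simp add: T)
  have split: "r = (\<Sum>w\<in>?B. g w) + (\<Sum>w\<in>?C. g w)"
    unfolding assms(6) using \<open>finite A\<close>
    by (subst sum.union_disjoint[symmetric]) (auto intro: sum.cong)
  have TB: "T (\<Sum>w\<in>?B. g w) = \<nu> *s (\<Sum>w\<in>?B. g w)"
    using \<open>finite A\<close> g by (simp add: Tsum scale_sum_right)
  have "(\<Sum>w\<in>?C. g w) = 0"
  proof (rule eigenvector_sum_eq_0[where T = T and \<mu> = \<mu> and \<nu> = \<nu>])
    show "T (\<Sum>w\<in>?C. g w) = \<nu> *s (\<Sum>w\<in>?C. g w)"
      using split TB assms(5) T(1)[of "\<Sum>w\<in>?B. g w" "\<Sum>w\<in>?C. g w"]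
      by (simp add: scale_right_distrib)
  qed (use assms in auto)
  then show ?thesis using split by simp
qed

end

context vertex_operator_algebra
begin

text \<open>Only the \<open>L(-1)\<close> and \<open>L(0)\<close> terms of the commutator formula
  occur; they contribute \<open>-(n + 1)\<close> and \<open>i\<close>.\<close>

lemma weight_product:
  assumes "has_weight u i" "has_weight v j"
  shows "has_weight (Y u n v) (i + j - n - 1)"
proof -
  have "Y conf 1 (Y u n v) - Y u n (Y conf 1 v) = Y (Y conf 0 u) (1 + n) v + Y (Y conf 1 u) n v"
    using commutator_formula[of conf 1 u n v] by simp
  also have "\<dots> = (of_int i - of_int (n + 1)) *s Y u n v"
    using assms by (simp add: L_minus_one_derivative has_weight_def Y_linear scale_left_diff_distrib
        scale_left_distrib)
  finally have "Y conf 1 (Y u n v) = (of_int i - of_int (n + 1)) *s Y u n v + of_int j *s Y u n v"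
    using assms by (simp add: has_weight_def Y_linear) (metis diff_eq_eq)
  then show ?thesis by (simp add: has_weight_def algebra_simps)
qed

lemma subspace_has_weight: "subspace {v. has_weight v n}"
  by (auto simp: subspace_def has_weight_def Y_linear scale_right_distrib mult.commute)

lemma translation_eq: "Y conf 0 u = Y u (-2) vac"
proof -
  have "Y (Y conf 0 u) (-1) vac = Y u (-2) vac" using L_minus_one_derivative[of u "-1" vac] by simp
  then show ?thesis by (simp add: creation)
qed

text \<open>\<open>conf\<close> itself need not lie in \<open>U\<close>; its mode
  \<open>L(-1)\<close> nevertheless preserves \<open>U\<close>, because it sends \<open>u\<close> to
  a mode of \<open>u\<close> applied to the vacuum.\<close>

lemma subalgebra_translation:
  "vertex_subalgebra U \<Longrightarrow> u \<in> U \<Longrightarrow> Y conf 0 u \<in> U"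
  by (auto simp: translation_eq vertex_subalgebra_def)

end

section \<open>Straightening words of modes\<close>

text \<open>A \<open>kpoly\<close> is a polynomial in the level, lowest coefficient first.  The argument \<open>K\<close> of the
  functions below represents the level itself: \<open>[0, 1]\<close> when it is left generic, \<open>[3]\<close> at level 3.\<close>

type_synonym kpoly = "int list"
type_synonym wvec = "(mode_word \<times> kpoly) list"

text \<open>Trailing zeros are stripped so that a polynomial that cancels becomes \<open>[]\<close>,
  which is what \<open>vins\<close> tests in order to delete a word.\<close>

fun padd :: "kpoly \<Rightarrow> kpoly \<Rightarrow> kpoly" where
  "padd [] q = q"
| "padd (a # p) [] = a # p"
| "padd (a # p) (b # q) =
     (let s = a + b; r = padd p q in if s = 0 \<and> r = [] then [] else s # r)"

fun psmult :: "int \<Rightarrow> kpoly \<Rightarrow> kpoly" where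
  "psmult a [] = []"
| "psmult a (b # q) = (if a = 0 then [] else (a * b) # psmult a q)"

fun pmult :: "kpoly \<Rightarrow> kpoly \<Rightarrow> kpoly" where
  "pmult [] q = []"
| "pmult (a # p) q = padd (psmult a q) (case pmult p q of [] \<Rightarrow> [] | r \<Rightarrow> 0 # r)"

fun vins :: "mode_word \<Rightarrow> kpoly \<Rightarrow> wvec \<Rightarrow> wvec" where
  "vins w c [] = (if c = [] then [] else [(w, c)])"
| "vins w c ((w', c') # v) =
     (if w = w' then (let s = padd c c' in if s = [] then v else (w', s) # v) else (w', c') # vins w c v)"

fun vaddm :: "kpoly \<Rightarrow> wvec \<Rightarrow> wvec \<Rightarrow> wvec" where
  "vaddm c [] v = v"
| "vaddm c ((w, p) # u) v = vins w (pmult c p) (vaddm c u v)"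

text \<open>\<open>H\<close> comes first, so that a sorted word containing any \<open>h\<close>
  begins with one and lies in the image of a creation operator \<open>h(-j)\<close>.\<close>

fun letter_index :: "sl2 \<Rightarrow> int" where
  "letter_index H = 0" | "letter_index E = 1" | "letter_index F = 2"

fun mode_le :: "sl2 \<times> int \<Rightarrow> sl2 \<times> int \<Rightarrow> bool" where
  "mode_le (a, m) (b, n) \<longleftrightarrow> letter_index a < letter_index b \<or> a = b \<and> m \<le> n"

fun bracket_opt :: "sl2 \<Rightarrow> sl2 \<Rightarrow> (int \<times> sl2) option" where
  "bracket_opt H E = Some (2, E)" | "bracket_opt E H = Some (-2, E)"
| "bracket_opt H F = Some (-2, F)" | "bracket_opt F H = Some (2, F)"
| "bracket_opt E F = Some (1, H)" | "bracket_opt F E = Some (-1, H)"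
| "bracket_opt a b = None"

fun form_int :: "sl2 \<Rightarrow> sl2 \<Rightarrow> int" where
  "form_int H H = 2" | "form_int E F = 1" | "form_int F E = 1" | "form_int a b = 0"

text \<open>The first argument only bounds the recursion; once it is exhausted the word is returned
  without straightening, so that the result is correct in any case.\<close>

primrec act1 :: "nat \<Rightarrow> kpoly \<Rightarrow> sl2 \<times> int \<Rightarrow> mode_word \<Rightarrow> wvec" where
  "act1 0 K m w = [(m # w, [1])]"
| "act1 (Suc N) K m w =
    (case w of [] \<Rightarrow> if snd m \<ge> 0 then [] else [([m], [1])]
     | b # w' \<Rightarrow>
       if snd m < 0 \<and> mode_le m b then [(m # w, [1])]
       else foldr (\<lambda>(u, p). vaddm p (act1 N K b u)) (act1 N K m w')
         (case bracket_opt (fst m) (fst b) of None \<Rightarrow>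
            (if snd m + snd b = 0 then vins w' (psmult (snd m * form_int (fst m) (fst b)) K) [] else [])
          | Some (t, d) \<Rightarrow> vaddm [t] (act1 N K (d, snd m + snd b) w')
            (if snd m + snd b = 0 then vins w' (psmult (snd m * form_int (fst m) (fst b)) K) [] else [])))"

definition actv :: "kpoly \<Rightarrow> sl2 \<times> int \<Rightarrow> wvec \<Rightarrow> wvec" where
  "actv K m v = foldr (\<lambda>(u, p). vaddm p (act1 20 K m u)) v []"

text \<open>\<open>L(n)\<close> passes through a word by \<open>[L(n), a(m)] = - m a(m+n)\<close>
  and kills the vacuum for \<open>n \<ge> -1\<close>; the Sugawara vector is never expanded.\<close>

primrec vir1 :: "kpoly \<Rightarrow> int \<Rightarrow> mode_word \<Rightarrow> wvec" where
  "vir1 K n [] = []"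
| "vir1 K n (m # w) =
    vaddm [- snd m] (act1 20 K (fst m, snd m + n) w) (actv K m (vir1 K n w))"

definition virv :: "kpoly \<Rightarrow> int \<Rightarrow> wvec \<Rightarrow> wvec" where
  "virv K n v = foldr (\<lambda>(u, p). vaddm p (vir1 K n u)) v []"

text \<open>The mode \<open>n\<close> of \<open>a(-i) b(-1) \<one>\<close>, with the infinite sum over \<open>j\<close> cut off at \<open>J\<close>.\<close>

definition quadratic_mode :: "kpoly \<Rightarrow> sl2 \<Rightarrow> sl2 \<Rightarrow> nat \<Rightarrow> int \<Rightarrow> nat \<Rightarrow> wvec \<Rightarrow> wvec" where
  "quadratic_mode K a b i n J v = foldr (\<lambda>j r.
      vaddm [int ((i + j - 1) choose j)] (actv K (a, - int i - int j) (actv K (b, n + int j) v))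
      (vaddm [- ((-1) ^ i) * int ((i + j - 1) choose j)]
        (actv K (b, n - int i - int j) (actv K (a, int j) v)) r)) [0..<J] []"

definition word_bound :: "mode_word \<Rightarrow> int" where
  "word_bound w = (\<Sum>m\<leftarrow>w. \<bar>snd m\<bar>)"

primrec pev :: "kpoly \<Rightarrow> complex \<Rightarrow> complex" where
  "pev [] z = 0"
| "pev (a # p) z = of_int a + z * pev p z"

lemma pev_padd [simp]: "pev (padd p q) z = pev p z + pev q z"
proof (induction p q rule: padd.induct)
  case (3 a p b q)
  have "of_int a + of_int b + z * (pev p z + pev q z) = z * pev (padd p q) z + of_int (a + b)"
    using 3[OF refl] by simp
  then show ?case by (auto simp: Let_def algebra_simps simp del: of_int_add)
qed auto

lemma pev_psmult [simp]: "pev (psmult a p) z = of_int a * pev p z"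
  by (induction p) (auto simp: algebra_simps)

lemma pev_pmult [simp]: "pev (pmult p q) z = pev p z * pev q z"
proof (induction p)
  case (Cons a p)
  have "pev (case r of [] \<Rightarrow> [] | r \<Rightarrow> 0 # r) z = z * pev r z" for r
    by (cases r) auto
  then show ?case using Cons by (simp add: algebra_simps)
qed auto

context universal_affine_sl2
begin

section \<open>Words of modes as vectors of the Weyl module\<close>

abbreviation mode_op :: "sl2 \<times> int \<Rightarrow> 'v \<Rightarrow> 'v" where
  "mode_op m \<equiv> Y (x (fst m)) (snd m)"

definition word_vec :: "mode_word \<Rightarrow> 'v" where
  "word_vec w = foldr (\<lambda>(a, n). Y (x a) n) w vac"

lemma word_vec_Nil [simp]: "word_vec [] = vac"
  and word_vec_Cons [simp]: "word_vec (m # w) = mode_op m (word_vec w)"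
  by (auto simp: word_vec_def split: prod.splits)

definition weyl_eval :: "(mode_word \<Rightarrow>\<^sub>0 complex) \<Rightarrow> 'v" where
  "weyl_eval p = (\<Sum>w\<in>Poly_Mapping.keys p. Poly_Mapping.lookup p w *s word_vec w)"

lemma weyl_eval_superset:
  "finite A \<Longrightarrow> Poly_Mapping.keys p \<subseteq> A \<Longrightarrow>
     weyl_eval p = (\<Sum>w\<in>A. Poly_Mapping.lookup p w *s word_vec w)"
  unfolding weyl_eval_def by (rule sum.mono_neutral_left) (auto simp: in_keys_iff)

lemma weyl_eval_add: "weyl_eval (p + q) = weyl_eval p + weyl_eval q"
proof -
  let ?A = "Poly_Mapping.keys p \<union> Poly_Mapping.keys q"
  have "Poly_Mapping.keys (p + q) \<subseteq> ?A" by (rule Poly_Mapping.keys_add)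
  then show ?thesis
    by (subst (1 2 3) weyl_eval_superset[of ?A])
       (auto simp: lookup_add scale_left_distrib sum.distrib)
qed

lemma weyl_eval_single [simp]: "weyl_eval (Poly_Mapping.single w s) = s *s word_vec w"
  by (subst weyl_eval_superset[of "{w}"]) (auto simp: lookup_single)

lemma weyl_eval_diff: "weyl_eval (p - q) = weyl_eval p - weyl_eval q"
  using weyl_eval_add[of "p - q" q] by simp

lemma weyl_eval_relation: "p \<in> weyl_relations k \<Longrightarrow> weyl_eval p = 0"
  using weyl_module_kernel[of p] by (simp add: weyl_eval_def word_vec_def)

lemma in_subspace_if_words:
  assumes "subspace S" "\<And>w. word_vec w \<in> S"
  shows "v \<in> S"
proof -
  obtain p where "v = weyl_eval p"
    using weyl_module_onto[of v] by (auto simp: weyl_eval_def word_vec_def)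
  then show ?thesis using assms by (auto simp: weyl_eval_def intro!: subspace_sum subspace_scale)
qed

definition bracket_term :: "sl2 \<Rightarrow> sl2 \<Rightarrow> int \<Rightarrow> 'v \<Rightarrow> 'v" where
  "bracket_term a b n v =
     (case bracket_opt a b of None \<Rightarrow> 0 | Some (t, d) \<Rightarrow> of_int t *s Y (x d) n v)"

text \<open>The relations are imposed on words only; both sides are linear in \<open>v\<close>, and
  the words applied to the vacuum span.\<close>

lemma mode_commutator:
  "Y (x a) m (Y (x b) n v) = Y (x b) n (Y (x a) m v) + bracket_term a b (m + n) v
     + (if m + n = 0 then (of_int (m * form_int a b) * k) *s v else 0)"
    (is "?P v")
proof -
  have "v \<in> {v. ?P v}"
  proof (rule in_subspace_if_words)
    show "subspace {v. ?P v}"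
      by (auto simp: subspace_def Y_linear bracket_term_def algebra_simps
          split: option.splits prod.splits)
  next
    fix w
    have "weyl_eval (Poly_Mapping.single ([] @ [(a, m), (b, n)] @ w) 1
       - Poly_Mapping.single ([] @ [(b, n), (a, m)] @ w) 1
       - (\<Sum>d\<in>{H, E, F}. Poly_Mapping.single ([] @ [(d, m + n)] @ w) (1 * sl2_bracket a b d))
       - Poly_Mapping.single ([] @ w)
           (if m + n = 0 then 1 * of_int m * sl2_form a b * k else 0)) = 0"
      by (rule weyl_eval_relation, rule commutator)
    then show "word_vec w \<in> {v. ?P v}"
      by (cases a; cases b) (simp_all add: weyl_eval_diff weyl_eval_add bracket_term_def algebra_simps)
  qed
  then show ?thesis by simp
qed

lemma vacuum_annihilated [simp]: "n \<ge> 0 \<Longrightarrow> Y (x a) n vac = 0"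
  by (rule creation_regular)

text \<open>Each commutator adds one index of the word to \<open>n\<close>. By the bound the sum
  stays positive until the vacuum is reached, so no central term appears either.\<close>

lemma mode_vanishes: "n > word_bound w \<Longrightarrow> Y (x a) n (word_vec w) = 0"
proof (induction w arbitrary: a n)
  case (Cons m w)
  have "word_bound w \<ge> 0" by (auto simp: word_bound_def intro!: sum_list_nonneg)
  then have "n > word_bound w" "n + snd m > word_bound w" "n + snd m \<noteq> 0"
    using Cons.prems by (auto simp: word_bound_def)
  then show ?case
    using Cons.IH by (auto simp: mode_commutator[of a n "fst m"] bracket_term_def split: option.splits)
qed (simp add: word_bound_def)

section \<open>Soundness of the straightening functions\<close>

fun lin :: "wvec \<Rightarrow> 'v" where
  "lin [] = 0"
| "lin ((w, p) # v) = pev p k *s word_vec w + lin v"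

lemma lin_vins [simp]: "lin (vins w p v) = pev p k *s word_vec w + lin v"
proof (induction w p v rule: vins.induct)
  case (2 w q w' q' v)
  have "pev q k + pev q' k = 0" if "padd q q' = []"
    using that pev_padd[of q q' k] by simp
  with 2 show ?case
    by (auto simp: Let_def scale_left_distrib simp flip: scale_left_distrib add.assoc)
qed auto

lemma lin_vaddm [simp]: "lin (vaddm q u v) = pev q k *s lin u + lin v"
  by (induction q u v rule: vaddm.induct) (auto simp: scale_right_distrib)

text \<open>The one-way bridge from computation to equality: a difference that straightens to
  \<open>[]\<close> is zero. The converse would be PBW.\<close>

lemma lin_eqI: "vaddm [-1] v u = [] \<Longrightarrow> lin u = lin v"
  using lin_vaddm[of "[-1]" v u] by simp

lemma lin_act1:
  assumes K: "pev K k = k"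
  shows "lin (act1 N K m w) = mode_op m (word_vec w)"
proof (induction N arbitrary: m w)
  case (Suc N)
  show ?case
  proof (cases w)
    case (Cons b w')
    have fold: "lin (foldr (\<lambda>(u, p). vaddm p (act1 N K b u)) v r) = mode_op b (lin v) + lin r" for v r
      by (induction v) (auto simp: Suc.IH Y_linear)
    show ?thesis
      using Cons
      by (auto simp: fold Suc.IH K mode_commutator[of "fst m" "snd m" "fst b" "snd b"] bracket_term_def
          simp del: vins.simps split: option.splits)
  qed auto
qed auto

lemma lin_actv:
  assumes K: "pev K k = k"
  shows "lin (actv K m v) = mode_op m (lin v)"
  unfolding actv_def
  by (induction v) (auto simp: lin_act1[OF K] Y_linear)

lemma mode_vanishes_lin:
  "(\<And>u. u \<in> fst ` set v \<Longrightarrow> word_bound u < n) \<Longrightarrow> Y (x a) n (lin v) = 0"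
  by (induction v) (auto simp: Y_linear mode_vanishes)

text \<open>The associator formula with upper mode \<open>- i\<close>. Negating the top of the
  binomial absorbs the alternating sign and leaves natural numbers, so all coefficients stay
  integral; \<open>J\<close> lies beyond every mode that can act nontrivially.\<close>

lemma lin_quadratic_mode:
  assumes K: "pev K k = k" and i: "i > 0"
    and J: "list_all (\<lambda>(u, p). word_bound u < int J \<and> word_bound u < n + int J) v"
  shows "lin (quadratic_mode K a b i n J v) = Y (Y (x a) (- int i) (x b)) n (lin v)"
proof -
  have bin: "(-1) ^ j * (of_int (- int i) gchoose j) = (of_nat ((i + j - 1) choose j) :: complex)" for j
  proof -
    have "(of_int (- int i) gchoose j :: complex) = (- of_nat i) gchoose j" by simp
    also have "\<dots> = (-1) ^ j * ((of_nat i + of_nat j - 1) gchoose j)" by (rule gbinomial_minus)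
    also have "of_nat i + of_nat j - 1 = (of_nat (i + j - 1) :: complex)" using i by (simp add: of_nat_diff)
    finally show ?thesis by (simp add: binomial_gbinomial flip: power_add mult.assoc)
  qed
  have sgn: "(-1) powi (- int i) = ((-1) ^ i :: complex)"
    by (simp add: power_int_minus flip: power_inverse)
  have "Y (Y (x a) (- int i) (x b)) n (lin v) = (\<Sum>j<J. ((-1) ^ j * (of_int (- int i) gchoose j)) *s
            (Y (x a) (- int i - int j) (Y (x b) (n + int j) (lin v))
             - ((-1) powi (- int i)) *s Y (x b) (- int i + n - int j) (Y (x a) (int j) (lin v))))"
    by (rule associator_formula; rule mode_vanishes_lin; use J in \<open>force simp: list_all_iff\<close>)
  also have "\<dots> = (\<Sum>j<J. of_nat ((i + j - 1) choose j) *s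
            (Y (x a) (- int i - int j) (Y (x b) (n + int j) (lin v))
             - ((-1) ^ i) *s Y (x b) (n - int i - int j) (Y (x a) (int j) (lin v))))"
    by (simp only: bin sgn) (simp add: algebra_simps)
  also have "\<dots> = lin (quadratic_mode K a b i n J v)"
  proof -
    define g where "g j = of_nat ((i + j - 1) choose j) *s
            (Y (x a) (- int i - int j) (Y (x b) (n + int j) (lin v))
             - ((-1) ^ i) *s Y (x b) (n - int i - int j) (Y (x a) (int j) (lin v)))" for j
    have "lin (foldr (\<lambda>j r.
      vaddm [int ((i + j - 1) choose j)] (actv K (a, - int i - int j) (actv K (b, n + int j) v))
      (vaddm [- ((-1) ^ i) * int ((i + j - 1) choose j)]
        (actv K (b, n - int i - int j) (actv K (a, int j) v)) r)) js r0) = sum_list (map g js) + lin r0" for js r0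
      by (induction js) (simp_all add: lin_actv[OF K] g_def scale_right_diff_distrib mult.commute)
    from this[of "[0..<J]" "[]"] show ?thesis
      by (simp add: quadratic_mode_def g_def interv_sum_list_conv_sum_set_nat atLeast0LessThan)
  qed
  finally show ?thesis by simp
qed

end

section \<open>Weights, charges and spanning words\<close>

fun charge_of :: "sl2 \<Rightarrow> int" where
  "charge_of H = 0" | "charge_of E = 2" | "charge_of F = -2"

definition word_weight :: "mode_word \<Rightarrow> int" where
  "word_weight w = - (\<Sum>m\<leftarrow>w. snd m)"

definition word_charge :: "mode_word \<Rightarrow> int" where
  "word_charge w = (\<Sum>m\<leftarrow>w. charge_of (fst m))"

definition negative_word :: "mode_word \<Rightarrow> bool" where
  "negative_word w \<longleftrightarrow> list_all (\<lambda>m. snd m < 0) w"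

definition pbw_word :: "mode_word \<Rightarrow> bool" where
  "pbw_word w \<longleftrightarrow> negative_word w \<and> sorted_wrt mode_le w"

lemma negative_word_simps [simp]:
  "negative_word []" "negative_word (m # w) \<longleftrightarrow> snd m < 0 \<and> negative_word w"
  "negative_word (u @ w) \<longleftrightarrow> negative_word u \<and> negative_word w"
  by (auto simp: negative_word_def)

lemma word_weight_ge_length: "negative_word w \<Longrightarrow> word_weight w \<ge> int (length w)"
  by (induction w) (auto simp: word_weight_def)

fun insert_mode :: "sl2 \<times> int \<Rightarrow> mode_word \<Rightarrow> mode_word" where
  "insert_mode m [] = [m]"
| "insert_mode m (b # w) = (if mode_le m b then m # b # w else b # insert_mode m w)"

lemma mode_le_linear: "mode_le m b \<or> mode_le b m"
  by (cases m; cases b; cases "fst m"; cases "fst b") (simp_all add: linear)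

lemma mode_le_trans: "mode_le m b \<Longrightarrow> mode_le b d \<Longrightarrow> mode_le m d"
  by (cases m; cases b; cases d; cases "fst m"; cases "fst b"; cases "fst d") simp_all

lemma set_insert_mode: "set (insert_mode m w) = insert m (set w)"
  by (induction w) auto

lemma length_insert_mode [simp]: "length (insert_mode m w) = Suc (length w)"
  by (induction w) auto

lemma pbw_insert_mode: "pbw_word w \<Longrightarrow> snd m < 0 \<Longrightarrow> pbw_word (insert_mode m w)"
proof (induction w)
  case (Cons b w)
  then show ?case
    using mode_le_linear[of m b] mode_le_trans[of m b]
    by (auto simp: pbw_word_def set_insert_mode)
qed (auto simp: pbw_word_def)

text \<open>This is \<open>4 (k + 2)\<close> times the mode \<open>n\<close> of \<open>conf\<close>
  on \<open>a(-1) vac\<close>. The cut-off 2 suffices for \<open>n \<ge> 0\<close>, since the word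
  has bound 1.\<close>

definition sugawara_vec :: "int \<Rightarrow> sl2 \<Rightarrow> wvec" where
  "sugawara_vec n a =
     vaddm [1] (quadratic_mode [0,1] H H 1 n 2 [([(a, -1)], [1])])
    (vaddm [2] (quadratic_mode [0,1] E F 1 n 2 [([(a, -1)], [1])])
    (vaddm [2] (quadratic_mode [0,1] F E 1 n 2 [([(a, -1)], [1])]) []))"

locale positive_level = universal_affine_sl2 scale Y vac conf c k x
  for scale :: "complex \<Rightarrow> 'v::ab_group_add \<Rightarrow> 'v" (infixr \<open>*s\<close> 75)
    and Y :: "'v \<Rightarrow> int \<Rightarrow> 'v \<Rightarrow> 'v"
    and vac conf :: 'v
    and c k :: complex
    and x :: "sl2 \<Rightarrow> 'v" +
  fixes l :: nat
  assumes level: "k = of_nat l" "l \<ge> 2"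
    and nontrivial: "vac \<noteq> 0"
begin

section \<open>Modes of the Sugawara vector\<close>

lemma level_nonzero [simp]: "k \<noteq> 0" "k + 2 \<noteq> 0" "k \<noteq> 1"
  using level by (auto simp: complex_eq_iff)

lemma pev_generic [simp]: "pev [0, 1] k = k"
  by simp

lemma conf_eq: "conf = (1 / (4 * (k + 2))) *s
   (Y (x H) (-1) (x H) + 2 *s Y (x E) (-1) (x F) + 2 *s Y (x F) (-1) (x E))"
proof -
  define r where "r = 1 / (4 * (k + 2))"
  have "1 / (2 * (k + 2)) = 2 * r" unfolding r_def by (simp add: divide_simps del: distrib_left_numeral)
  then show ?thesis
    unfolding sugawara r_def[symmetric] by (simp only: scale_right_distrib scale_scale) (simp add: mult.commute)
qed

lemma conf_mode_x:
  assumes "n \<ge> 0"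
  shows "Y conf n (x a) = (1 / (4 * (k + 2))) *s lin (sugawara_vec n a)"
proof -
  have xa: "x a = lin [([(a, -1)], [1])]" by (simp add: creation)
  have "lin (quadratic_mode [0,1] b d 1 n 2 [([(a, -1)], [1])]) = Y (Y (x b) (-1) (x d)) n (x a)" for b d
    unfolding xa using assms by (subst lin_quadratic_mode) (auto simp: word_bound_def)
  then show ?thesis by (simp add: conf_eq Y_linear sugawara_vec_def add.assoc)
qed

lemma conf_1_x: "Y conf 1 (x a) = x a"
proof -
  \<comment> \<open>\<open>[8, 4]\<close> encodes \<open>4 (k + 2)\<close>, which cancels the
    Sugawara normalization.\<close>
  have "sugawara_vec 1 a = [([(a, -1)], [8, 4])]" by (cases a; simp only:; code_simp)
  then have "lin (sugawara_vec 1 a) = (4 * (k + 2)) *s x a" by (simp add: creation algebra_simps)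
  then show ?thesis by (simp add: conf_mode_x del: distrib_left_numeral)
qed

text \<open>From \<open>n = 3\<close> on, each term of the associator formula vanishes by degree. At
  \<open>n = 2\<close> single terms may be multiples of the vacuum that cancel only in the sum, so
  this case is computed.\<close>

lemma conf_ge_2_x:
  assumes "n \<ge> 2"
  shows "Y conf n (x a) = 0"
proof (cases "n = 2")
  case True
  have "sugawara_vec 2 a = []" by (cases a; simp only:; code_simp)
  then show ?thesis by (simp add: conf_mode_x True)
next
  case False
  with assms have n: "n \<ge> 3" by simp
  have v: "Y (x b) m (x a) = 0" if "m \<ge> 2" for b m
    using that mode_vanishes[of "[(a, -1)]" m b] by (simp add: word_bound_def creation)
  have "Y (Y (x b) (-1) (x d)) n (x a) \<in> {0}" for b d
  proof (rule associator_in_subspace)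
    show "Y (x b) (-1 - int i) (Y (x d) (n + int i) (x a)) \<in> {0}" for i
      using n by (simp add: v)
    fix i :: nat
    consider "i = 0" | "i = 1" | "i \<ge> (2::nat)" by linarith
    then show "Y (x d) (-1 + n - int i) (Y (x b) (int i) (x a)) \<in> {0}"
    proof cases
      case 1
      then show ?thesis
        using n by (simp add: mode_commutator[of d "n - 1" b 0] v bracket_term_def split: option.splits)
    next
      case 2
      have "Y (x b) 1 (x a) = Y (x b) 1 (Y (x a) (-1) vac)" by (simp add: creation)
      also have "\<dots> = (of_int (form_int b a) * k) *s vac"
        by (simp add: mode_commutator[of b 1 a "-1"] bracket_term_def split: option.splits)
      finally show ?thesis using 2 n by (simp add: Y_linear)
    qed (simp add: v)
  qed simp
  then show ?thesis by (simp add: conf_eq Y_linear)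
qed

text \<open>Since \<open>x a\<close> is primary of weight 1, only \<open>i = 0\<close> and
  \<open>i = 1\<close> survive in the commutator formula; with \<open>N = n + 1\<close> they give
  \<open>-(N + m) + N = -m\<close>.\<close>

lemma virasoro_mode:
  assumes "n \<ge> -1"
  shows "Y conf (n + 1) (Y (x a) m v) = Y (x a) m (Y conf (n + 1) v) - of_int m *s Y (x a) (m + n) v"
proof -
  define N where "N = nat (n + 1)"
  have N: "int N = n + 1" using assms by (simp add: N_def)
  have "Y conf (int N) (Y (x a) m v) - Y (x a) m (Y conf (int N) v) =
     (\<Sum>i\<le>N. of_nat (N choose i) *s Y (Y conf (int i) (x a)) (int N + m - int i) v)"
    by (rule commutator_formula)
  also have "\<dots> = (\<Sum>i\<in>{0,1}. of_nat (N choose i) *s Y (Y conf (int i) (x a)) (int N + m - int i) v)"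
    by (rule sum.mono_neutral_cong) (auto simp: conf_ge_2_x not_le)
  also have "\<dots> = (- of_int (int N + m)) *s Y (x a) (int N + m - 1) v
      + of_nat N *s Y (x a) (int N + m - 1) v"
    by (simp add: L_minus_one_derivative conf_1_x)
  also have "\<dots> = (- of_int (int N + m) + of_nat N) *s Y (x a) (int N + m - 1) v"
    by (simp only: scale_left_distrib)
  also have "- of_int (int N + m) + of_nat N = (- of_int m :: complex)" by simp
  also have "int N + m - 1 = m + n" using N by simp
  finally have "Y conf (n + 1) (Y (x a) m v) - Y (x a) m (Y conf (n + 1) v)
      = - (of_int m *s Y (x a) (m + n) v)"
    using N by simp
  then show ?thesis by (simp only: diff_eq_eq) simp
qed

lemma lin_virv:
  assumes K: "pev K k = k" and n: "n \<ge> -1"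
  shows "lin (virv K n v) = Y conf (n + 1) (lin v)"
proof -
  have "lin (vir1 K n w) = Y conf (n + 1) (word_vec w)" for w
    using n by (induction w)
      (auto simp: lin_act1[OF K] lin_actv[OF K] virasoro_mode creation_regular)
  then show ?thesis
    unfolding virv_def by (induction v) (auto simp: Y_linear)
qed

lemma weight_mode: "has_weight v d \<Longrightarrow> has_weight (Y (x a) m v) (d - m)"
  using weight_product[of "x a" 1 v d m] by (simp add: has_weight_def conf_1_x)

lemma weight_vac: "has_weight vac 0"
  by (simp add: has_weight_def creation_regular)

lemma weight_word_vec: "has_weight (word_vec w) (word_weight w)"
proof (induction w)
  case (Cons m w)
  have "word_weight (m # w) = word_weight w - snd m" by (simp add: word_weight_def)
  with weight_mode[OF Cons, of "fst m" "snd m"] show ?case by simp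
qed (simp add: word_weight_def weight_vac)

section \<open>Charge, the length filtration and spanning by sorted words\<close>

definition has_charge :: "'v \<Rightarrow> int \<Rightarrow> bool" where
  "has_charge v q \<longleftrightarrow> h 0 v = of_int q *s v"

lemma charge_mode: "has_charge v q \<Longrightarrow> has_charge (Y (x a) m v) (q + charge_of a)"
  by (cases a) (simp_all add: has_charge_def mode_commutator[of H 0 _ m] bracket_term_def Y_linear
      scale_left_distrib scale_left_diff_distrib)

lemma charge_word_vec: "has_charge (word_vec w) (word_charge w)"
proof (induction w)
  case (Cons m w)
  from charge_mode[OF this, of "fst m" "snd m"] show ?case by (simp add: word_charge_def add.commute)
qed (simp add: word_charge_def has_charge_def)

text \<open>The length filtration, in which reordering a word is invisible up to shorter
  words.\<close>

definition words_upto :: "nat \<Rightarrow> 'v set" where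
  "words_upto r = span {word_vec w |w. negative_word w \<and> length w \<le> r}"

lemma words_upto_mono: "r \<le> s \<Longrightarrow> words_upto r \<subseteq> words_upto s"
  unfolding words_upto_def by (rule span_mono) auto

lemma subspace_words_upto [simp]: "subspace (words_upto r)"
  by (simp add: words_upto_def)

lemma word_in_words_upto: "negative_word w \<Longrightarrow> length w \<le> r \<Longrightarrow> word_vec w \<in> words_upto r"
  unfolding words_upto_def by (rule span_base) auto

lemma mode_negative_words_upto:
  assumes "n < 0" "v \<in> words_upto r"
  shows "Y (x a) n v \<in> words_upto (Suc r)"
  using assms(2) unfolding words_upto_def
proof (induction v rule: span_induct_alt)
  case (step q y z)
  then obtain w where w: "y = word_vec w" "negative_word w" "length w \<le> r" by auto
  have "word_vec ((a, n) # w) \<in> words_upto (Suc r)"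
    by (rule word_in_words_upto) (use assms w in auto)
  then show ?case
    using step w by (simp add: Y_linear words_upto_def span_add span_scale)
qed (simp add: span_zero)

lemma mode_nonneg_words_upto:
  assumes "n \<ge> 0" "v \<in> words_upto r"
  shows "Y (x a) n v \<in> words_upto r"
proof -
  have *: "Y (x a) n (word_vec w) \<in> words_upto (length w)"
    if "n \<ge> 0" "negative_word w" for a n w
    using that
  proof (induction w arbitrary: a n)
    case Nil
    then show ?case by (simp add: words_upto_def span_zero)
  next
    case (Cons m w)
    have br: "Y (x d) (n + snd m) (word_vec w) \<in> words_upto (Suc (length w))" for d
    proof (cases "n + snd m \<ge> 0")
      case True
      then show ?thesis using Cons words_upto_mono[of "length w" "Suc (length w)"] by auto
    next
      case False
      then show ?thesis using Cons.prems by (intro mode_negative_words_upto word_in_words_upto) auto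
    qed
    have br0: "Y (x d) 0 (word_vec w) \<in> words_upto (Suc (length w))" if "n + snd m = 0" for d
      using br[of d] that by simp
    have "word_vec w \<in> words_upto (Suc (length w))"
      using Cons.prems by (intro word_in_words_upto) auto
    moreover have "mode_op m (Y (x a) n (word_vec w)) \<in> words_upto (Suc (length w))"
      using Cons by (intro mode_negative_words_upto) auto
    ultimately show ?case
      by (auto simp: mode_commutator[of a n "fst m"] bracket_term_def br br0 split: option.splits
          intro!: subspace_add subspace_scale subspace_0)
  qed
  show ?thesis
    using assms(2) unfolding words_upto_def
  proof (induction v rule: span_induct_alt)
    case (step q y z)
    then obtain w where w: "y = word_vec w" "negative_word w" "length w \<le> r" by auto
    have "Y (x a) n y \<in> words_upto r"
      using *[of n w a] w words_upto_mono[of "length w" r] assms by auto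
    then show ?case
      using step by (simp add: Y_linear words_upto_def span_add span_scale)
  qed (simp add: span_zero)
qed

lemma word_vec_in_words_upto: "word_vec w \<in> words_upto (length w)"
proof (induction w)
  case (Cons m w)
  then show ?case
    using mode_negative_words_upto[of "snd m" "word_vec w" "length w" "fst m"]
      mode_nonneg_words_upto[of "snd m" "word_vec w" "length w" "fst m"]
      words_upto_mono[of "length w" "Suc (length w)"]
    by (cases "snd m < 0") auto
qed (use word_in_words_upto[of "[]" 0] in simp)

text \<open>Moving \<open>m\<close> past a letter costs one bracket, hence a word shorter by one.
  Both indices are negative, so the central term never occurs.\<close>

lemma insert_mode_congruent:
  assumes "snd m < 0" "negative_word w"
  shows "word_vec (m # w) - word_vec (insert_mode m w) \<in> words_upto (length w)"
  using assms(2)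
proof (induction w)
  case Nil
  then show ?case by (simp add: subspace_0)
next
  case (Cons b w)
  show ?case
  proof (cases "mode_le m b")
    case True
    then show ?thesis by (simp add: subspace_0)
  next
    case False
    have "mode_op b (word_vec (m # w) - word_vec (insert_mode m w)) \<in> words_upto (length (b # w))"
      using Cons mode_negative_words_upto by simp
    moreover have "bracket_term (fst m) (fst b) (snd m + snd b) (word_vec w) \<in> words_upto (length (b # w))"
      using assms(1) Cons.prems
      by (auto simp: bracket_term_def split: option.splits
          intro!: subspace_scale subspace_0 mode_negative_words_upto word_in_words_upto)
    moreover have "word_vec (m # b # w) - word_vec (insert_mode m (b # w)) =
        mode_op b (word_vec (m # w) - word_vec (insert_mode m w))
        + bracket_term (fst m) (fst b) (snd m + snd b) (word_vec w)"
      using assms(1) Cons.prems False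
      by (simp add: mode_commutator[of "fst m" "snd m" "fst b" "snd b"] Y_diff_right)
    ultimately show ?thesis
      using subspace_add[OF subspace_words_upto] by metis
  qed
qed

lemma pbw_representative:
  "negative_word w \<Longrightarrow>
     \<exists>w'. pbw_word w' \<and> length w' = length w \<and> word_vec w - word_vec w' \<in> words_upto (length w - 1)"
proof (induction w)
  case Nil
  then show ?case by (auto simp: pbw_word_def subspace_0)
next
  case (Cons m w)
  then obtain w' where w': "pbw_word w'" "length w' = length w"
    "word_vec w - word_vec w' \<in> words_upto (length w - 1)" by auto
  have "word_vec (m # w) - word_vec (m # w') \<in> words_upto (length w)"
  proof (cases "length w = 0")
    case True
    then show ?thesis using w' by (simp add: subspace_0)
  next
    case False
    then show ?thesis
      using Cons.prems w' mode_negative_words_upto[of "snd m" _ "length w - 1" "fst m"]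
      by (simp add: Y_diff_right[symmetric])
  qed
  moreover have "word_vec (m # w') - word_vec (insert_mode m w') \<in> words_upto (length w)"
    using insert_mode_congruent[of m w'] w' Cons.prems by (simp add: pbw_word_def)
  ultimately have "word_vec (m # w) - word_vec (insert_mode m w') \<in> words_upto (length w)"
    using subspace_add[OF subspace_words_upto] by fastforce
  then show ?case
    using w' Cons.prems pbw_insert_mode by (intro exI[of _ "insert_mode m w'"]) auto
qed

text \<open>The spanning half of PBW, by induction on length: a word equals its sorted version up to
  shorter words.\<close>

lemma words_upto_pbw: "words_upto r \<subseteq> span {word_vec w |w. pbw_word w}"
proof (induction r)
  case 0
  show ?case unfolding words_upto_def by (rule span_mono) (auto simp: pbw_word_def intro!: exI[of _ "[]"])
next
  case (Suc r)
  have "word_vec w \<in> span {word_vec w |w. pbw_word w}" if neg: "negative_word w" and len: "length w \<le> Suc r" for w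
  proof -
    obtain w' where w': "pbw_word w'" "word_vec w - word_vec w' \<in> words_upto (length w - 1)"
      using pbw_representative[OF neg] by blast
    then have "word_vec w - word_vec w' \<in> span {word_vec w |w. pbw_word w}"
      using subsetD[OF words_upto_mono[of "length w - 1" r]] len by (intro subsetD[OF Suc]) simp
    moreover have "word_vec w' \<in> span {word_vec w |w. pbw_word w}"
      using w' by (intro span_base) auto
    ultimately show ?thesis using span_add by fastforce
  qed
  then show ?case unfolding words_upto_def by (intro span_minimal) auto
qed

lemma pbw_spanning: "v \<in> span {word_vec w |w. pbw_word w}"
  by (rule in_subspace_if_words) (use word_vec_in_words_upto words_upto_pbw in auto)

lemma weight_space_spanning:
  assumes "has_weight v d"
  shows "v \<in> span {word_vec w |w. pbw_word w \<and> word_weight w = d}"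
proof -
  obtain A r where A: "finite A" "A \<subseteq> {word_vec w |w. pbw_word w}" "v = (\<Sum>a\<in>A. r a *s a)"
    using pbw_spanning[of v] by (auto simp: span_explicit)
  \<comment> \<open>Different words may represent the same vector \<open>a\<close>; one of them is
    chosen so that eigenvalues can be attached to vectors.\<close>
  define wd where "wd a = (SOME w. pbw_word w \<and> a = word_vec w)" for a
  have wd: "pbw_word (wd a) \<and> a = word_vec (wd a)" if "a \<in> A" for a
    unfolding wd_def by (rule someI_ex) (use A that in auto)
  have "v = (\<Sum>a\<in>{a\<in>A. (of_int (word_weight (wd a)) :: complex) = of_int d}. r a *s a)"
  proof (rule eigencomponent[where T = "Y conf 1"])
    show "Y conf 1 (r a *s a) = of_int (word_weight (wd a)) *s (r a *s a)" if "a \<in> A" for a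
      using wd[OF that] weight_word_vec[of "wd a"] by (simp add: has_weight_def Y_linear mult.commute)
  qed (use A assms in \<open>auto simp: Y_linear has_weight_def\<close>)
  also have "\<dots> \<in> span {word_vec w |w. pbw_word w \<and> word_weight w = d}"
  proof (intro span_sum span_scale span_base)
    fix a assume "a \<in> {a\<in>A. (of_int (word_weight (wd a)) :: complex) = of_int d}"
    then show "a \<in> {word_vec w |w. pbw_word w \<and> word_weight w = d}"
      using wd[of a] by (intro CollectI exI[of _ "wd a"]) simp
  qed
  finally show ?thesis .
qed

lemma weight_charge_space_spanning:
  assumes "has_weight v d" "has_charge v q"
  shows "v \<in> span {word_vec w |w. pbw_word w \<and> word_weight w = d \<and> word_charge w = q}"
proof -
  obtain A r where A: "finite A" "A \<subseteq> {word_vec w |w. pbw_word w \<and> word_weight w = d}"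
      "v = (\<Sum>a\<in>A. r a *s a)"
    using weight_space_spanning[OF assms(1)] by (auto simp: span_explicit)
  define wd where "wd a = (SOME w. pbw_word w \<and> word_weight w = d \<and> a = word_vec w)" for a
  have wd: "pbw_word (wd a) \<and> word_weight (wd a) = d \<and> a = word_vec (wd a)" if "a \<in> A" for a
    unfolding wd_def by (rule someI_ex) (use A that in auto)
  have "v = (\<Sum>a\<in>{a\<in>A. (of_int (word_charge (wd a)) :: complex) = of_int q}. r a *s a)"
  proof (rule eigencomponent[where T = "Y (x H) 0"])
    show "h 0 (r a *s a) = of_int (word_charge (wd a)) *s (r a *s a)" if "a \<in> A" for a
      using wd[OF that] charge_word_vec[of "wd a"] by (simp add: has_charge_def Y_linear mult.commute)
  qed (use A assms in \<open>auto simp: Y_linear has_charge_def\<close>)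
  also have "\<dots> \<in> span {word_vec w |w. pbw_word w \<and> word_weight w = d \<and> word_charge w = q}"
  proof (intro span_sum span_scale span_base)
    fix a assume "a \<in> {a\<in>A. (of_int (word_charge (wd a)) :: complex) = of_int q}"
    then show "a \<in> {word_vec w |w. pbw_word w \<and> word_weight w = d \<and> word_charge w = q}"
      using wd[of a] by (intro CollectI exI[of _ "wd a"]) simp
  qed
  finally show ?thesis .
qed

text \<open>The weight of a word with negative modes is at least its length, so the spanning set of
  the weight space is empty.\<close>

lemma negative_weight_eq_0:
  assumes "has_weight v d" "d < 0"
  shows "v = 0"
proof -
  have "word_weight w \<noteq> d" if "pbw_word w" for w
  proof -
    have "int (length w) \<le> word_weight w"
      using that by (intro word_weight_ge_length) (simp add: pbw_word_def)
    with assms(2) show ?thesis by linarith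
  qed
  then have eq: "{word_vec w |w. pbw_word w \<and> word_weight w = d} = {}" by simp
  have "v \<in> span {}" using weight_space_spanning[OF assms(1)] by (simp only: eq)
  then show ?thesis by (simp only: span_empty singleton_iff)
qed

end

section \<open>Reduction modulo the Heisenberg creation operators\<close>

definition drop_H :: "wvec \<Rightarrow> wvec" where
  "drop_H v = filter (\<lambda>(w, p). case w of [] \<Rightarrow> True | m # _ \<Rightarrow> fst m \<noteq> H) v"

definition neutral_of_weight :: "int \<Rightarrow> wvec \<Rightarrow> bool" where
  "neutral_of_weight d v \<longleftrightarrow>
     list_all (\<lambda>(w, p). negative_word w \<and> word_weight w = d \<and> word_charge w = 0) v"

context positive_level
begin

lemma h_commutator:
  "h m (h n v) = h n (h m v) + (if m + n = 0 then (of_int (2 * m) * k) *s v else 0)"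
  by (simp add: mode_commutator[of H m H n] bracket_term_def mult.commute)

lemma has_charge_0: "has_charge v 0 \<longleftrightarrow> h 0 v = 0"
  by (simp add: has_charge_def)

lemma weight_add: "has_weight u d \<Longrightarrow> has_weight v d \<Longrightarrow> has_weight (u + v) d"
  and weight_scale: "has_weight u d \<Longrightarrow> has_weight (a *s u) d"
  and weight_zero: "has_weight 0 d"
  using subspace_has_weight[of d] by (auto simp: subspace_def)

text \<open>The lower bound \<open>n\<close> allows the operators \<open>h(-1)\<close>,
  \<open>h(-2)\<close>, ... to be eliminated one at a time. For \<open>n > d \<ge> 0\<close> the
  space is zero, because \<open>u\<close> would have negative weight.\<close>

definition Hfrom :: "nat \<Rightarrow> int \<Rightarrow> 'v set" where
  "Hfrom n d = span {h (- int j) u |j u. j \<ge> n \<and> has_weight u (d - int j) \<and> has_charge u 0}"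

abbreviation Hspace :: "int \<Rightarrow> 'v set" where
  "Hspace \<equiv> Hfrom 1"

lemma subspace_Hfrom [simp]: "subspace (Hfrom n d)"
  by (simp add: Hfrom_def)

lemma Hfrom_base:
  "j \<ge> n \<Longrightarrow> has_weight u (d - int j) \<Longrightarrow> has_charge u 0 \<Longrightarrow> h (- int j) u \<in> Hfrom n d"
  unfolding Hfrom_def by (intro span_base CollectI exI[of _ j] exI[of _ u]) simp

lemma Hfrom_mapsto:
  assumes L: "\<And>u v. L (u + v) = L u + L v" "\<And>a v. L (a *s v) = a *s L v"
    and S: "subspace S"
    and gen: "\<And>j u. j \<ge> n \<Longrightarrow> has_weight u (d - int j) \<Longrightarrow> has_charge u 0 \<Longrightarrow> L (h (- int j) u) \<in> S"
    and r: "r \<in> Hfrom n d"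
  shows "L r \<in> S"
proof -
  have L0: "L 0 = 0" using L(2)[of 0 0] by simp
  have "Hfrom n d \<subseteq> {v. L v \<in> S}"
    unfolding Hfrom_def
  proof (rule span_minimal)
    show "subspace {v. L v \<in> S}"
      unfolding subspace_def using S by (simp add: L L0 subspace_0 subspace_add subspace_scale)
  qed (use gen in auto)
  then show ?thesis using r by auto
qed

text \<open>On vectors killed by \<open>h(n)\<^sup>N\<close> this is the projection onto the kernel of \<open>h(n)\<close> along the
  image of \<open>h(-n)\<close>.\<close>

definition heis_coeff :: "nat \<Rightarrow> nat \<Rightarrow> complex" where
  "heis_coeff n j = (-1) ^ j / (fact j * (2 * of_nat n * k) ^ j)"

definition heis_proj :: "nat \<Rightarrow> nat \<Rightarrow> 'v \<Rightarrow> 'v" where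
  "heis_proj n N v = (\<Sum>j<N. heis_coeff n j *s (h (- int n) ^^ j) ((h (int n) ^^ j) v))"

lemma h_pow_linear:
  "(h n ^^ j) (u + v) = (h n ^^ j) u + (h n ^^ j) v" "(h n ^^ j) (a *s v) = a *s (h n ^^ j) v"
  "(h n ^^ j) 0 = 0"
  by (induction j) (auto simp: Y_linear)

lemma heis_proj_linear:
  "heis_proj n N (u + v) = heis_proj n N u + heis_proj n N v"
  "heis_proj n N (a *s v) = a *s heis_proj n N v"
  by (simp_all add: heis_proj_def h_pow_linear scale_right_distrib sum.distrib scale_sum_right mult.commute)

lemma weight_h_pow: "has_weight v d \<Longrightarrow> has_weight ((h n ^^ j) v) (d - int j * n)"
proof (induction j)
  case (Suc j)
  then have "has_weight (h n ((h n ^^ j) v)) (d - int j * n - n)" by (intro weight_mode) auto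
  then show ?case by (simp add: algebra_simps)
qed simp

lemma charge_h: "has_charge v 0 \<Longrightarrow> has_charge (h n v) 0"
  using charge_mode[of v 0 H n] by simp

lemma charge_h_pow: "has_charge v 0 \<Longrightarrow> has_charge ((h n ^^ j) v) 0"
  by (induction j) (auto intro: charge_h)

lemma h_pow_commute: "m + n \<noteq> 0 \<Longrightarrow> (h m ^^ j) (h n v) = h n ((h m ^^ j) v)"
  by (induction j) (auto simp: h_commutator[of m n])

lemma h_pow_h_neg:
  "(h (int n) ^^ j) (h (- int n) u) = h (- int n) ((h (int n) ^^ j) u)
     + (of_nat j * (2 * of_nat n * k)) *s (h (int n) ^^ (j - 1)) u"
proof (induction j)
  case (Suc j)
  have "(h (int n) ^^ Suc j) (h (- int n) u) = h (int n) (h (- int n) ((h (int n) ^^ j) u)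
     + (of_nat j * (2 * of_nat n * k)) *s (h (int n) ^^ (j - 1)) u)"
    by (simp only: funpow.simps comp_def Suc)
  also have "\<dots> = h (- int n) ((h (int n) ^^ Suc j) u) + (2 * of_nat n * k) *s (h (int n) ^^ j) u
      + (of_nat j * (2 * of_nat n * k)) *s h (int n) ((h (int n) ^^ (j - 1)) u)"
    by (simp add: Y_linear h_commutator[of "int n" "- int n"])
  also have "(of_nat j * (2 * of_nat n * k)) *s h (int n) ((h (int n) ^^ (j - 1)) u) =
      (of_nat j * (2 * of_nat n * k)) *s (h (int n) ^^ j) u"
    by (cases j) auto
  also have "h (- int n) ((h (int n) ^^ Suc j) u) + (2 * of_nat n * k) *s (h (int n) ^^ j) u
      + (of_nat j * (2 * of_nat n * k)) *s (h (int n) ^^ j) u =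
      h (- int n) ((h (int n) ^^ Suc j) u) + (of_nat (Suc j) * (2 * of_nat n * k)) *s (h (int n) ^^ j) u"
    by (simp only: of_nat_Suc distrib_right scale_left_distrib mult_1_left add.assoc)
  finally show ?case by simp
qed simp

lemma heis_coeff_Suc:
  assumes "n \<ge> 1"
  shows "heis_coeff n (Suc j) * (of_nat (Suc j) * (2 * of_nat n * k)) = - heis_coeff n j"
proof -
  define s :: complex where "s = of_nat (Suc j) * (2 * of_nat n * k)"
  have "s \<noteq> 0" using assms by (simp add: s_def del: of_nat_Suc)
  have eq: "fact (Suc j) * (2 * of_nat n * k) ^ Suc j = s * (fact j * (2 * of_nat n * k) ^ j)"
    by (simp add: s_def algebra_simps)
  show ?thesis
    unfolding heis_coeff_def eq s_def[symmetric] using \<open>s \<noteq> 0\<close> by simp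
qed

text \<open>A telescoping sum: by \<open>heis_coeff_Suc\<close> consecutive terms cancel, and the
  one left over disappears once \<open>h(n)^N u = 0\<close>.\<close>

lemma heis_proj_h_neg:
  assumes "n \<ge> 1"
  shows "heis_proj n (Suc N) (h (- int n) u) =
    heis_coeff n N *s (h (- int n) ^^ Suc N) ((h (int n) ^^ N) u)"
proof (induction N)
  case 0
  then show ?case by (simp add: heis_proj_def)
next
  case (Suc N)
  have pow: "(h (- int n) ^^ Suc N) (h (- int n) v) = (h (- int n) ^^ Suc (Suc N)) v" for v
    by (simp only: funpow_Suc_right comp_def)
  have "heis_proj n (Suc (Suc N)) (h (- int n) u) = heis_proj n (Suc N) (h (- int n) u)
      + heis_coeff n (Suc N) *s (h (- int n) ^^ Suc N) ((h (int n) ^^ Suc N) (h (- int n) u))"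
    by (simp only: heis_proj_def sum.lessThan_Suc)
  also have "(h (- int n) ^^ Suc N) ((h (int n) ^^ Suc N) (h (- int n) u)) =
      (h (- int n) ^^ Suc (Suc N)) ((h (int n) ^^ Suc N) u)
      + (of_nat (Suc N) * (2 * of_nat n * k)) *s (h (- int n) ^^ Suc N) ((h (int n) ^^ N) u)"
    by (simp only: h_pow_h_neg h_pow_linear pow diff_Suc_1)
  also have "heis_coeff n (Suc N) *s \<dots> =
      heis_coeff n (Suc N) *s (h (- int n) ^^ Suc (Suc N)) ((h (int n) ^^ Suc N) u)
      - heis_coeff n N *s (h (- int n) ^^ Suc N) ((h (int n) ^^ N) u)"
    using heis_coeff_Suc[OF assms, of N]
    by (simp only: scale_right_distrib scale_scale) (simp only: scale_minus_left add_uminus_conv_diff)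
  finally show ?case using Suc by simp
qed

text \<open>The projection fixes \<open>r\<close> because \<open>h(n) r = 0\<close>. It kills the
  summands \<open>h(-n) u\<close> and commutes with \<open>h(-j)\<close> for \<open>j > n\<close>,
  so the representation of \<open>r\<close> loses its terms with index \<open>n\<close>.\<close>

lemma N0_Hfrom_Suc:
  assumes "n \<ge> 1" "r \<in> N0" "r \<in> Hfrom n d"
  shows "r \<in> Hfrom (Suc n) d"
proof -
  \<comment> \<open>Large enough for the truncated projection: \<open>h(n)^N u\<close> would have
    weight \<open>d - n - N n < 0\<close>.\<close>
  define N where "N = nat d"
  have "(h (int n) ^^ Suc j) r = 0" for j
    using assms by (induction j) (auto simp: N0_def)
  then have "heis_coeff n j *s (h (- int n) ^^ j) ((h (int n) ^^ j) r) = (if j = 0 then r else 0)" for j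
    by (cases j) (auto simp: heis_coeff_def h_pow_linear simp del: funpow.simps(2))
  then have "heis_proj n (Suc N) r = r"
    by (simp add: heis_proj_def del: sum.lessThan_Suc)
  moreover have "heis_proj n (Suc N) r \<in> Hfrom (Suc n) d"
  proof (rule Hfrom_mapsto[OF heis_proj_linear _ _ assms(3)])
    fix j u assume j: "j \<ge> n" and u: "has_weight u (d - int j)" "has_charge u 0"
    show "heis_proj n (Suc N) (h (- int j) u) \<in> Hfrom (Suc n) d"
    proof (cases "j = n")
      case True
      have "int N * int n \<ge> int N" using assms(1) by (simp add: mult_le_cancel_left1)
      then have "d - int j - int N * int n < 0" using True assms(1) unfolding N_def by linarith
      then have "(h (int n) ^^ N) u = 0"
        using weight_h_pow[OF u(1)] negative_weight_eq_0 by blast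
      then show ?thesis
        using True assms(1) by (simp only: heis_proj_h_neg h_pow_linear scale_zero_right subspace_0 subspace_Hfrom)
    next
      case False
      have "heis_proj n (Suc N) (h (- int j) u) = h (- int j) (heis_proj n (Suc N) u)"
        using False assms(1) j
        by (simp add: heis_proj_def h_pow_commute Y_sum_right Y_linear del: sum.lessThan_Suc)
      moreover have "has_weight (heis_proj n (Suc N) u) (d - int j)"
        unfolding heis_proj_def
      proof (rule subspace_sum[OF subspace_has_weight, unfolded mem_Collect_eq])
        fix i
        show "has_weight (heis_coeff n i *s (h (- int n) ^^ i) ((h (int n) ^^ i) u)) (d - int j)"
          using weight_h_pow[OF weight_h_pow[OF u(1), where n = "int n" and j = i],
              where n = "- int n" and j = i]
          by (intro weight_scale) (simp add: algebra_simps)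
      qed
      moreover have "has_charge (heis_proj n (Suc N) u) 0"
        using charge_h_pow[OF charge_h_pow[OF u(2)]]
        by (simp add: has_charge_0 heis_proj_def Y_sum_right Y_linear del: sum.lessThan_Suc)
      ultimately show ?thesis using False j Hfrom_base[of "Suc n" j] by auto
    qed
  qed auto
  ultimately show ?thesis by simp
qed

text \<open>Raising the lower bound step by step beyond \<open>d\<close> leaves only
  \<open>u\<close> of negative weight, hence nothing.\<close>

lemma N0_Hspace_eq_0:
  assumes "r \<in> N0" "r \<in> Hspace d"
  shows "r = 0"
proof -
  have "r \<in> Hfrom (Suc n) d" for n
    by (induction n) (use assms N0_Hfrom_Suc[OF _ assms(1)] in auto)
  then have "r \<in> Hfrom (Suc (nat d)) d" .
  moreover have "v = 0" if "v \<in> Hfrom (Suc (nat d)) d" for v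
  proof -
    have "id v \<in> {0}"
    proof (rule Hfrom_mapsto[OF _ _ _ _ that])
      fix j u assume "j \<ge> Suc (nat d)" "has_weight u (d - int j)"
      then have "u = 0" by (intro negative_weight_eq_0[of u "d - int j"]) auto
      then show "id (h (- int j) u) \<in> {0}" by simp
    qed auto
    then show ?thesis by simp
  qed
  ultimately show ?thesis by blast
qed

lemma Hspace_nonpos: "v \<in> Hspace 0 \<Longrightarrow> v = 0"
proof -
  assume "v \<in> Hspace 0"
  have "id v \<in> {0}"
  proof (rule Hfrom_mapsto[OF _ _ _ _ \<open>v \<in> Hspace 0\<close>])
    fix j u assume "j \<ge> (1::nat)" "has_weight u (0 - int j)"
    then have "u = 0" by (intro negative_weight_eq_0[of u "0 - int j"]) auto
    then show "id (h (- int j) u) \<in> {0}" by simp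
  qed auto
  then show ?thesis by simp
qed

section \<open>Operators that preserve the images of the \<open>h(-j)\<close>\<close>

lemma weight_conf: "has_weight v d \<Longrightarrow> has_weight (Y conf (n + 1) v) (d - n)"
proof -
  have "has_weight conf 2"
  proof -
    have "has_weight (Y (x a) (-1) (x b)) 2" for a b
      using weight_mode[of "x b" 1 a "-1"] conf_1_x[of b] by (simp add: has_weight_def)
    then have "has_weight ((1 / (4 * (k + 2))) *s
       (Y (x H) (-1) (x H) + 2 *s Y (x E) (-1) (x F) + 2 *s Y (x F) (-1) (x E))) 2"
      by (intro weight_scale weight_add)
    then show ?thesis unfolding conf_eq[symmetric] .
  qed
  moreover assume "has_weight v d"
  ultimately show ?thesis using weight_product[of conf 2 v d "n + 1"] by (simp add: algebra_simps)
qed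

lemma charge_conf: "n \<ge> -1 \<Longrightarrow> has_charge v 0 \<Longrightarrow> has_charge (Y conf (n + 1) v) 0"
  using virasoro_mode[of n H 0 v] by (simp add: has_charge_0)

lemma charge_0_product:
  "has_charge u 0 \<Longrightarrow> has_charge w 0 \<Longrightarrow> has_charge (Y u n w) 0"
  using commutator_formula[of "x H" 0 u n w] by (simp add: has_charge_0)

lemma Hspace_translation:
  assumes "r \<in> Hspace d"
  shows "Y conf 0 r \<in> Hspace (d + 1)"
proof (rule Hfrom_mapsto[OF _ _ _ _ assms])
  fix j u assume *: "j \<ge> (1::nat)" "has_weight u (d - int j)" "has_charge u 0"
  have eq: "Y conf 0 (h (- int j) u) = h (- int j) (Y conf 0 u) + of_nat j *s h (- int (Suc j)) u"
    using virasoro_mode[of "-1" H "- int j" u] by (simp add: add.commute)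
  have "h (- int j) (Y conf 0 u) \<in> Hspace (d + 1)"
    using weight_conf[of u "d - int j" "-1"] charge_conf[of "-1" u] *
    by (intro Hfrom_base) (auto simp: algebra_simps)
  moreover have "h (- int (Suc j)) u \<in> Hspace (d + 1)"
    using * by (intro Hfrom_base) auto
  ultimately show "Y conf 0 (h (- int j) u) \<in> Hspace (d + 1)"
    unfolding eq by (intro subspace_add subspace_scale) auto
qed (auto simp: Y_linear)

text \<open>The commutator lowers \<open>h(-j)\<close> to \<open>h(1-j)\<close>, again a creation
  operator unless \<open>j = 1\<close>; then it is \<open>h(0)\<close>, which vanishes on charge
  0.\<close>

lemma Hspace_L1:
  assumes "r \<in> Hspace d"
  shows "Y conf 2 r \<in> Hspace (d - 1)"
proof (rule Hfrom_mapsto[OF _ _ _ _ assms])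
  fix j u assume *: "j \<ge> (1::nat)" "has_weight u (d - int j)" "has_charge u 0"
  have eq: "Y conf 2 (h (- int j) u) = h (- int j) (Y conf 2 u) + of_nat j *s h (- int (j - 1)) u"
    using virasoro_mode[of 1 H "- int j" u] * by (simp add: of_nat_diff)
  have "h (- int j) (Y conf 2 u) \<in> Hspace (d - 1)"
    using weight_conf[of u "d - int j" 1] charge_conf[of 1 u] *
    by (intro Hfrom_base) (auto simp: algebra_simps)
  moreover have "h (- int (j - 1)) u \<in> Hspace (d - 1)"
  proof (cases "j = 1")
    case True
    then show ?thesis using * by (simp add: has_charge_0 subspace_0)
  next
    case False
    then show ?thesis using * by (intro Hfrom_base) (auto simp: of_nat_diff)
  qed
  ultimately show "Y conf 2 (h (- int j) u) \<in> Hspace (d - 1)"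
    unfolding eq by (intro subspace_add subspace_scale) auto
qed (auto simp: Y_linear)

text \<open>This is \<open>4k\<close> times the mode \<open>L(2)\<close> of \<open>omega\<close>, with the summands \<open>2 h(2-n) h(n)\<close>, \<open>n \<ge> 2\<close>,
  left out: on vectors of charge 0 they vanish or lie in \<open>Hspace\<close>.\<close>

definition coset_L2 :: "'v \<Rightarrow> 'v" where
  "coset_L2 v = (4 * k) *s Y conf 3 v - h 1 (h 1 v)"

lemma coset_L2_linear:
  "coset_L2 (u + v) = coset_L2 u + coset_L2 v" "coset_L2 (a *s v) = a *s coset_L2 v"
  "coset_L2 (u - v) = coset_L2 u - coset_L2 v"
  by (simp_all add: coset_L2_def Y_linear algebra_simps)

text \<open>At \<open>j = 1\<close> both parts of \<open>coset_L2\<close> produce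
  \<open>4 k h(1) u\<close>, and these cancel; this is what fixes their relative factor. At
  \<open>j = 2\<close> the commutator is \<open>h(0) u = 0\<close>, and from \<open>j = 3\<close> on
  it remains a creation operator.\<close>

lemma Hspace_coset_L2:
  assumes "r \<in> Hspace d"
  shows "coset_L2 r \<in> Hspace (d - 2)"
proof (rule Hfrom_mapsto[OF coset_L2_linear(1,2) _ _ assms])
  fix j u assume *: "j \<ge> (1::nat)" "has_weight u (d - int j)" "has_charge u 0"
  have conf: "h (- int j) (Y conf 3 u) \<in> Hspace (d - 2)"
    using weight_conf[of u "d - int j" 2] charge_conf[of 2 u] *
    by (intro Hfrom_base) (auto simp: algebra_simps)
  have hh: "h (- int j) (h 1 (h 1 u)) \<in> Hspace (d - 2)"
    using weight_mode[OF weight_mode[OF *(2)], of H 1 H 1] charge_h[OF charge_h[OF *(3)]] *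
    by (intro Hfrom_base) (auto simp: algebra_simps)
  have low: "coset_L2 (h (- int j) u) = (4 * k) *s h (- int j) (Y conf 3 u) - h (- int j) (h 1 (h 1 u))
      + (if j \<ge> 3 then (4 * k * of_nat j) *s h (- int (j - 2)) u else 0)"
  proof -
    have v: "Y conf 3 (h (- int j) u) = h (- int j) (Y conf 3 u) + of_nat j *s h (2 - int j) u"
      using virasoro_mode[of 2 H "- int j" u] by (simp add: add.commute)
    consider "j = 1" | "j = 2" | "j \<ge> 3" using * by linarith
    then show ?thesis
    proof cases
      case 1
      have "(4 * k) *s h 1 u - ((2 * k) *s h 1 u + (2 * k) *s h 1 u) = 0"
        by (simp flip: scale_left_distrib)
      with 1 show ?thesis unfolding coset_L2_def v
        by (simp add: h_commutator[of 1 "-1"] Y_linear scale_right_distrib algebra_simps)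
    next
      case 2
      with * show ?thesis unfolding coset_L2_def v
        by (simp add: h_commutator[of 1 "-2"] Y_linear has_charge_0)
    next
      case 3
      then have "2 - int j = - int (j - 2)" by (simp add: of_nat_diff)
      with 3 show ?thesis unfolding coset_L2_def v
        by (simp add: h_commutator[of 1 "- int j"] Y_linear scale_right_distrib)
    qed
  qed
  have "h (- int (j - 2)) u \<in> Hspace (d - 2)" if "j \<ge> 3"
    using * that by (intro Hfrom_base) (auto simp: of_nat_diff)
  then show "coset_L2 (h (- int j) u) \<in> Hspace (d - 2)"
    unfolding low using conf hh
    by (auto intro!: subspace_add subspace_diff subspace_scale simp: subspace_0)
qed auto

text \<open>In the associator formula either a creation operator \<open>h(-j-i)\<close> stands in
  front, or some \<open>h(i)\<close> with \<open>i \<ge> 0\<close> hits \<open>w\<close>, which is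
  zero in \<open>N0\<close>. So a left factor acting on \<open>N0\<close> matters only modulo
  \<open>Hspace\<close>.\<close>

lemma Hspace_product:
  assumes "r \<in> Hspace d" "w \<in> N0" "has_weight w d'"
  shows "Y r n w \<in> Hspace (d + d' - n - 1)"
proof (rule Hfrom_mapsto[OF _ _ _ _ assms(1)])
  fix j u assume *: "j \<ge> (1::nat)" "has_weight u (d - int j)" "has_charge u 0"
  show "Y (h (- int j) u) n w \<in> Hspace (d + d' - n - 1)"
  proof (rule associator_in_subspace)
    fix i
    have "has_weight (Y u (n + int i) w) (d + d' - n - 1 - int (j + i))"
      using weight_product[OF *(2) assms(3), of "n + int i"] by (simp add: algebra_simps)
    moreover have "has_charge (Y u (n + int i) w) 0"
      using *(3) assms(2) by (intro charge_0_product) (auto simp: N0_def has_charge_0)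
    moreover have eq: "- int j - int i = - int (j + i)" by simp
    ultimately have "h (- int (j + i)) (Y u (n + int i) w) \<in> Hspace (d + d' - n - 1)"
      using * by (intro Hfrom_base) auto
    then show "h (- int j - int i) (Y u (n + int i) w) \<in> Hspace (d + d' - n - 1)"
      by (simp only: eq)
    show "Y u (- int j + n - int i) (h (int i) w) \<in> Hspace (d + d' - n - 1)"
      using assms(2) by (simp add: N0_def subspace_0)
  qed simp
qed (auto simp: Y_linear)

lemma lin_drop_H:
  "neutral_of_weight d v \<Longrightarrow> lin v - lin (drop_H v) \<in> Hspace d"
proof (induction v rule: lin.induct)
  case (2 w p v)
  have IH: "lin v - lin (drop_H v) \<in> Hspace d"
    using 2 by (simp add: neutral_of_weight_def)
  have w: "negative_word w" "word_weight w = d" "word_charge w = 0"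
    using 2 by (auto simp: neutral_of_weight_def)
  show ?case
  proof (cases "\<exists>n w'. w = (H, n) # w'")
    case True
    then obtain n w' where w': "w = (H, n) # w'" by auto
    have "h (- int (nat (- n))) (word_vec w') \<in> Hspace d"
      using w w' weight_word_vec[of w'] charge_word_vec[of w']
      by (intro Hfrom_base) (auto simp: word_weight_def word_charge_def)
    then have "word_vec w \<in> Hspace d" using w w' by simp
    then show ?thesis
      using IH w' by (simp add: drop_H_def subspace_add subspace_scale flip: add_diff_eq)
  next
    case False
    then have "drop_H ((w, p) # v) = (w, p) # drop_H v"
      by (cases w) (auto simp: drop_H_def)
    then show ?thesis using IH by simp
  qed
qed (simp add: drop_H_def subspace_0)

lemma N0_subalgebra: "vertex_subalgebra N0"
  unfolding vertex_subalgebra_def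
proof (intro conjI ballI allI)
  show "subspace N0" by (auto simp: subspace_def N0_def Y_linear)
  show "vac \<in> N0" by (auto simp: N0_def)
next
  fix u v n assume uv: "u \<in> N0" "v \<in> N0"
  show "Y u n v \<in> N0"
    unfolding N0_def
  proof (intro CollectI allI impI)
    fix m :: int assume "m \<ge> 0"
    then show "h m (Y u n v) = 0"
      using commutator_formula[of "x H" "nat m" u n v] uv by (simp add: N0_def)
  qed
qed

end

section \<open>The subalgebra generated by \<open>W3\<close>\<close>

definition W3_vec :: wvec where
  "W3_vec = [([(H,-3)], [0,0,1]), ([(H,-2),(H,-1)], [0,3]), ([(H,-1),(H,-1),(H,-1)], [2]),
     ([(H,-1),(E,-1),(F,-1)], [0,-6]), ([(E,-2),(F,-1)], [0,0,3]), ([(E,-1),(F,-2)], [0,0,-3])]"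

definition omega_vec :: wvec where
  "omega_vec = [([(H,-2)], [0,-1]), ([(H,-1),(H,-1)], [-1]), ([(E,-1),(F,-1)], [0,2])]"

abbreviation generic_ef :: "nat \<Rightarrow> int \<Rightarrow> wvec \<Rightarrow> wvec" where
  "generic_ef i n v \<equiv> quadratic_mode [0,1] E F i n 5 v"

definition combine :: "(kpoly \<times> wvec) list \<Rightarrow> wvec" where
  "combine cs = foldr (\<lambda>(q, v). vaddm q v) cs []"

lemma pure_pbw_word:
  assumes "pbw_word w" "\<forall>m\<in>set w. fst m \<noteq> H"
  shows "\<exists>es fs. w = map (Pair E) es @ map (Pair F) fs"
  using assms
proof (induction w)
  case (Cons m w)
  then obtain es fs where w: "w = map (Pair E) es @ map (Pair F) fs"
    by (auto simp: pbw_word_def)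
  show ?case
  proof (cases "fst m")
    case E
    then show ?thesis using w by (intro exI[of _ "snd m # es"] exI[of _ fs]) (simp add: prod_eq_iff)
  next
    case F
    have "es = []"
      using Cons.prems(1) w F by (cases es; cases m) (auto simp: pbw_word_def)
    then show ?thesis using w F by (intro exI[of _ "[]"] exI[of _ "snd m # fs"]) (simp add: prod_eq_iff)
  qed (use Cons.prems in auto)
qed simp

lemma pure_word_cases:
  assumes w: "pbw_word w" "word_weight w < 6" "word_weight w > 0" "word_charge w = 0"
    "\<forall>m\<in>set w. fst m \<noteq> H"
  obtains i j where "w = [(E,i), (F,j)]" "i < 0" "j < 0"
    | i j i' j' where "w = [(E,i), (E,j), (F,i'), (F,j')]" "i \<le> j" "i' \<le> j'" "j < 0" "j' < 0"
proof -
  obtain es fs where split: "w = map (Pair E) es @ map (Pair F) fs"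
    using pure_pbw_word w by blast
  have "(\<Sum>m\<leftarrow>map (Pair E) ms. charge_of (fst m)) = 2 * int (length ms)"
    "(\<Sum>m\<leftarrow>map (Pair F) ms. charge_of (fst m)) = -2 * int (length ms)" for ms
    by (induction ms) simp_all
  from this(1)[of es] this(2)[of fs] have len: "length fs = length es"
    using w(4) unfolding split word_charge_def map_append sum_list_append by linarith
  have "int (length w) < 6" using word_weight_ge_length[of w] w by (simp add: pbw_word_def)
  then have "length es < 3" by (simp add: split len)
  then consider "length es = 0" | "length es = 1" | "length es = 2" by linarith
  then show thesis
  proof cases
    case 1
    then show thesis using w(3) split len by (simp add: word_weight_def)
  next
    case 2
    then obtain i j where "es = [i]" "fs = [j]"
      using len by (auto simp: length_Suc_conv)
    then show thesis using that(1)[of i j] w(1) split by (simp add: pbw_word_def)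
  next
    case 3
    then obtain i j i' j' where "es = [i, j]" "fs = [i', j']"
      using len by (auto simp: length_Suc_conv numeral_2_eq_2)
    then show thesis using that(2)[of i j i' j'] w(1) split by (simp add: pbw_word_def)
  qed
qed

lemma pure_word_4:
  assumes "pbw_word w" "word_weight w = 4" "word_charge w = 0" "\<forall>m\<in>set w. fst m \<noteq> H"
  shows "w \<in> {[(E,-3),(F,-1)], [(E,-2),(F,-2)], [(E,-1),(F,-3)], [(E,-1),(E,-1),(F,-1),(F,-1)]}"
proof (rule pure_word_cases[OF assms(1) _ _ assms(3,4)])
  fix i j :: int assume *: "w = [(E,i), (F,j)]" "i < 0" "j < 0"
  then have "j = - 4 - i" using assms(2) by (simp add: word_weight_def)
  moreover have "i = -1 \<or> i = -2 \<or> i = -3" using * calculation by linarith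
  ultimately show ?thesis using * by auto
next
  fix i j i' j' :: int
  assume *: "w = [(E,i), (E,j), (F,i'), (F,j')]" "i \<le> j" "i' \<le> j'" "j < 0" "j' < 0"
  then have "i + j + i' + j' = -4" using assms(2) by (simp add: word_weight_def)
  then have "i = -1" "j = -1" "i' = -1" "j' = -1" using * by linarith+
  then show ?thesis using * by simp
qed (use assms in auto)

lemma pure_word_5:
  assumes "pbw_word w" "word_weight w = 5" "word_charge w = 0" "\<forall>m\<in>set w. fst m \<noteq> H"
  shows "w \<in> {[(E,-4),(F,-1)], [(E,-3),(F,-2)], [(E,-2),(F,-3)], [(E,-1),(F,-4)],
      [(E,-1),(E,-1),(F,-2),(F,-1)], [(E,-2),(E,-1),(F,-1),(F,-1)]}"
proof (rule pure_word_cases[OF assms(1) _ _ assms(3,4)])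
  fix i j :: int assume *: "w = [(E,i), (F,j)]" "i < 0" "j < 0"
  then have "j = - 5 - i" using assms(2) by (simp add: word_weight_def)
  moreover have "i = -1 \<or> i = -2 \<or> i = -3 \<or> i = -4" using * calculation by linarith
  ultimately show ?thesis using * by auto
next
  fix i j i' j' :: int
  assume *: "w = [(E,i), (E,j), (F,i'), (F,j')]" "i \<le> j" "i' \<le> j'" "j < 0" "j' < 0"
  then have "i + j + i' + j' = -5" using assms(2) by (simp add: word_weight_def)
  then have "j = -1" "j' = -1" "i = -1 \<and> i' = -2 \<or> i = -2 \<and> i' = -1" using * by linarith+
  then show ?thesis using * by auto
qed (use assms in auto)

lemma mode_le_letter_index: "mode_le m b \<Longrightarrow> letter_index (fst m) \<le> letter_index (fst b)"
  by (cases m; cases b) auto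

context positive_level
begin

text \<open>The level is a positive natural number, so a polynomial with nonnegative coefficients,
  one of them positive, takes a positive natural value.\<close>

lemma pev_nonzero:
  assumes "list_all (\<lambda>a. 0 \<le> a) D" "list_ex (\<lambda>a. 0 < a) D"
  shows "pev D k \<noteq> 0"
proof -
  have "list_all (\<lambda>a. 0 \<le> a) D \<Longrightarrow>
      \<exists>m::nat. pev D k = of_nat m \<and> (list_ex (\<lambda>a. 0 < a) D \<longrightarrow> m > 0)"
  proof (induction D)
    case (Cons a D)
    then obtain m :: nat where m: "pev D k = of_nat m" "list_ex (\<lambda>a. 0 < a) D \<longrightarrow> m > 0"
      by auto
    have "pev (a # D) k = of_nat (nat a + l * m)" using m Cons.prems level by simp
    moreover have "list_ex (\<lambda>a. 0 < a) (a # D) \<longrightarrow> nat a + l * m > 0"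
      using m level Cons.prems by auto
    ultimately show ?case by blast
  qed auto
  then show ?thesis using assms by auto
qed

section \<open>\<open>W3\<close> and \<open>omega\<close> as computable vectors\<close>

lemma lin_W3_vec: "lin W3_vec = W3"
  by (simp add: W3_vec_def W3_def power2_eq_square algebra_simps)

lemma lin_omega_vec: "lin omega_vec = (2 * k * (k + 2)) *s omega"
proof -
  have "(2 * k * (k + 2)) *s omega =
      (- k) *s h (-2) vac - h (-1) (h (-1) vac) + (2 * k) *s e (-1) (f (-1) vac)"
    unfolding omega_def scale_scale by (simp del: distrib_left_numeral)
  then show ?thesis by (simp add: omega_vec_def algebra_simps)
qed

text \<open>Finitely many modes are checked by straightening; \<open>word_bound\<close> disposes of
  the rest.\<close>

lemma lin_in_N0:
  assumes K: "pev K k = k"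
    and "list_all (\<lambda>(u, p). word_bound u < int M) v"
    and "list_all (\<lambda>m. actv K (H, int m) v = []) [0..<M]"
  shows "lin v \<in> N0"
  unfolding N0_def
proof (intro CollectI allI impI)
  fix m :: int assume "m \<ge> 0"
  show "h m (lin v) = 0"
  proof (cases "m < int M")
    case True
    then have "actv K (H, int (nat m)) v = []"
      using assms(3) \<open>m \<ge> 0\<close> unfolding list_all_iff by (intro bspec[where x = "nat m"]) auto
    then have "actv K (H, m) v = []" using \<open>m \<ge> 0\<close> by simp
    then show ?thesis using lin_actv[OF K, of "(H, m)" v] by simp
  next
    case False
    then show ?thesis using assms(2) by (intro mode_vanishes_lin) (auto simp: list_all_iff)
  qed
qed

lemma W3_in_N0: "W3 \<in> N0"
proof -
  have "lin W3_vec \<in> N0"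
    by (rule lin_in_N0[OF pev_generic, where M = 4]; code_simp)
  then show ?thesis by (simp add: lin_W3_vec)
qed

lemma omega_vec_in_N0: "lin omega_vec \<in> N0"
  by (rule lin_in_N0[OF pev_generic, where M = 3]; code_simp)

lemma weight_lin: "list_all (\<lambda>(w, p). word_weight w = d) v \<Longrightarrow> has_weight (lin v) d"
  by (induction v) (auto simp: weight_zero intro!: weight_add weight_scale weight_word_vec)

lemma weight_W3: "has_weight W3 3"
  unfolding lin_W3_vec[symmetric] by (rule weight_lin) code_simp

definition U3 :: "'v set" where
  "U3 = generated_subalgebra {W3}"

lemma U3_subalgebra: "vertex_subalgebra U3"
  by (simp add: U3_def generated_subalgebra_is_subalgebra)

lemma W3_in_U3: "W3 \<in> U3"
  using generated_subalgebra_superset by (auto simp: U3_def)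

lemma U3_subset_N0: "U3 \<subseteq> N0"
  unfolding U3_def by (rule generated_subalgebra_minimal) (auto simp: N0_subalgebra W3_in_N0)

lemma U3_product: "u \<in> U3 \<Longrightarrow> v \<in> U3 \<Longrightarrow> Y u n v \<in> U3"
  using U3_subalgebra by (simp add: vertex_subalgebra_def)

lemma subspace_U3: "subspace U3"
  using U3_subalgebra by (simp add: vertex_subalgebra_def)

text \<open>Since \<open>N0 \<inter> Hspace d = 0\<close>, a vector of \<open>N0\<close> lying in \<open>reach d\<close> lies in \<open>U3\<close>, whereas
  modulo \<open>Hspace\<close> the field of an element of \<open>N0\<close> depends only on its words without \<open>h\<close>.\<close>

definition reach :: "int \<Rightarrow> 'v set" where
  "reach d = {y. \<exists>g\<in>U3. g - y \<in> Hspace d}"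

lemma reachI: "g \<in> U3 \<Longrightarrow> g - y \<in> Hspace d \<Longrightarrow> y \<in> reach d"
  by (auto simp: reach_def)

lemma subspace_reach: "subspace (reach d)"
  unfolding subspace_def
proof (intro conjI ballI allI)
  show "0 \<in> reach d"
    using subspace_0[OF subspace_U3] by (intro reachI[of 0]) (auto simp: subspace_0)
next
  fix y z assume "y \<in> reach d" "z \<in> reach d"
  then obtain g g' where g: "g \<in> U3" "g - y \<in> Hspace d" "g' \<in> U3" "g' - z \<in> Hspace d"
    by (auto simp: reach_def)
  have "g + g' - (y + z) = (g - y) + (g' - z)" by simp
  also have "\<dots> \<in> Hspace d" using g by (intro subspace_add) auto
  finally show "y + z \<in> reach d"
    using g by (intro reachI[of "g + g'"] subspace_add subspace_U3) auto
next
  fix a y assume "y \<in> reach d"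
  then obtain g where g: "g \<in> U3" "g - y \<in> Hspace d" by (auto simp: reach_def)
  have "a *s g - a *s y = a *s (g - y)" by (simp add: scale_right_diff_distrib)
  also have "\<dots> \<in> Hspace d" using g by (intro subspace_scale) auto
  finally show "a *s y \<in> reach d"
    using g by (intro reachI[of "a *s g"] subspace_scale subspace_U3) auto
qed

lemma U3_subset_reach: "u \<in> U3 \<Longrightarrow> u \<in> reach d"
  by (rule reachI[of u]) (auto simp: subspace_0)

lemma Hspace_subset_reach: "y \<in> Hspace d \<Longrightarrow> y \<in> reach d"
  using subspace_0[OF subspace_U3] by (intro reachI[of 0]) (auto simp: subspace_neg)

lemma N0_reach:
  assumes "v \<in> N0" "v \<in> reach d"
  shows "v \<in> U3"
proof -
  obtain g where g: "g \<in> U3" "g - v \<in> Hspace d" using assms by (auto simp: reach_def)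
  have "g - v \<in> N0"
    using g U3_subset_N0 assms(1) N0_subalgebra
    by (auto simp: vertex_subalgebra_def intro: subspace_diff)
  then have "g = v" using N0_Hspace_eq_0 g by fastforce
  then show ?thesis using g by simp
qed

lemma reach_drop_H:
  assumes "lin v \<in> reach d" "neutral_of_weight d v"
  shows "lin (drop_H v) \<in> reach d"
proof -
  have "lin v - (lin v - lin (drop_H v)) \<in> reach d"
    using assms lin_drop_H Hspace_subset_reach by (blast intro: subspace_diff subspace_reach)
  then show ?thesis by simp
qed

lemma reach_translation:
  assumes "y \<in> reach d"
  shows "Y conf 0 y \<in> reach (d + 1)"
proof -
  obtain g where g: "g \<in> U3" "g - y \<in> Hspace d" using assms by (auto simp: reach_def)
  show ?thesis
    using subalgebra_translation[OF U3_subalgebra g(1)] Hspace_translation[OF g(2)]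
    by (intro reachI[of "Y conf 0 g"]) (auto simp: Y_diff_right)
qed

lemma reach_virv: "lin v \<in> reach d \<Longrightarrow> lin (virv [0, 1] (-1) v) \<in> reach (d + 1)"
  using reach_translation by (simp add: lin_virv)

lemma reach_product:
  assumes "y \<in> reach d" "w \<in> U3" "has_weight w d'"
  shows "Y y n w \<in> reach (d + d' - n - 1)"
proof -
  obtain g where g: "g \<in> U3" "g - y \<in> Hspace d" using assms by (auto simp: reach_def)
  then have "Y g n w - Y y n w \<in> Hspace (d + d' - n - 1)"
    using Hspace_product[of "g - y" d w d' n] assms U3_subset_N0 by (auto simp: Y_diff_left)
  then show ?thesis using U3_product[OF g(1) assms(2)] by (auto simp: reach_def)
qed

lemma lin_generic_ef:
  assumes "i > 0" "list_all (\<lambda>(u, p). word_bound u < 5 \<and> word_bound u < n + 5) v"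
  shows "lin (generic_ef i n v) = Y (word_vec [(E, - int i), (F, -1)]) n (lin v)"
proof -
  have "lin (generic_ef i n v) = Y (Y (x E) (- int i) (x F)) n (lin v)"
    using assms by (intro lin_quadratic_mode) auto
  then show ?thesis by (simp add: creation)
qed

lemma reach_generic_ef:
  assumes "word_vec [(E, - int i), (F, -1)] \<in> reach (int i + 1)" "lin v \<in> U3" "i > 0"
    and "list_all (\<lambda>(w, p). word_weight w = d') v"
    and "list_all (\<lambda>(u, p). word_bound u < 5 \<and> word_bound u < n + 5) v"
    and "neutral_of_weight (int i + d' - n) (generic_ef i n v)"
  shows "lin (drop_H (generic_ef i n v)) \<in> reach (int i + d' - n)"
proof (rule reach_drop_H)
  show "lin (generic_ef i n v) \<in> reach (int i + d' - n)"
    using reach_product[OF assms(1,2) weight_lin[OF assms(4)], of n] lin_generic_ef[OF assms(3,5)]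
    by (simp add: algebra_simps)
qed (use assms in simp)

text \<open>One elimination step: the multipliers in \<open>cs\<close> are chosen so that every word
  except \<open>w\<close> cancels. The surviving coefficient \<open>D\<close> is the determinant
  that must not vanish at the level.\<close>

lemma reach_combine:
  assumes "list_all (\<lambda>(q, v). lin v \<in> reach d) cs" "combine cs = [(w, D)]" "pev D k \<noteq> 0"
  shows "word_vec w \<in> reach d"
proof -
  have "lin (combine cs) \<in> reach d"
    using assms(1) unfolding combine_def
    by (induction cs) (auto intro!: subspace_add subspace_scale subspace_0 subspace_reach)
  then have "pev D k *s word_vec w \<in> reach d" using assms(2) by simp
  from subspace_scale[OF subspace_reach this, of "1 / pev D k"] show ?thesis
    using assms(3) by simp
qed

text \<open>Sorting puts every \<open>H\<close> in front, so a sorted word that contains one is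
  already in \<open>Hspace\<close>; only pure words have to be supplied.\<close>

lemma pure_words_reach:
  assumes "v \<in> N0" "has_weight v d"
    and pure: "\<And>w. pbw_word w \<Longrightarrow> word_weight w = d \<Longrightarrow> word_charge w = 0 \<Longrightarrow>
        \<forall>m\<in>set w. fst m \<noteq> H \<Longrightarrow> word_vec w \<in> S"
    and S: "subspace S" "Hspace d \<subseteq> S"
  shows "v \<in> S"
proof -
  have "has_charge v 0" using assms(1) by (auto simp: N0_def has_charge_0)
  have "word_vec w \<in> S" if w: "pbw_word w" "word_weight w = d" "word_charge w = 0" for w
  proof (cases "\<exists>m\<in>set w. fst m = H")
    case True
    then obtain b w' where w': "w = b # w'" by (cases w) auto
    have "letter_index (fst b) \<le> letter_index (fst m)" if "m \<in> set w" for m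
      using w(1) w' that by (auto simp: pbw_word_def intro: mode_le_letter_index)
    with True have "letter_index (fst b) \<le> 0" by force
    then have "fst b = H" by (cases "fst b") auto
    then have "lin [(w, [1])] - lin (drop_H [(w, [1])]) \<in> Hspace d"
      using w by (intro lin_drop_H) (auto simp: neutral_of_weight_def pbw_word_def)
    moreover have "drop_H [(w, [1])] = []" using w' \<open>fst b = H\<close> by (simp add: drop_H_def)
    ultimately show ?thesis using S by auto
  next
    case False
    then show ?thesis using w by (intro pure) auto
  qed
  then have "span {word_vec w |w. pbw_word w \<and> word_weight w = d \<and> word_charge w = 0} \<subseteq> S"
    using S by (intro span_minimal) auto
  then show ?thesis
    using weight_charge_space_spanning[OF assms(2) \<open>has_charge v 0\<close>] by auto
qed

section \<open>Reaching all pure words of weights 2 to 5 when \<open>l \<ge> 3\<close>\<close>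

context
  assumes l_ge_3: "l \<ge> 3"
begin

text \<open>Mode 3 of \<open>W3\<close> takes \<open>W3\<close> down to weight 2, where there is a
  single pure word. By \<open>reach_product\<close> the left factor may be replaced by its part
  without \<open>h\<close>.\<close>

lemma reach_2: "word_vec [(E,-1),(F,-1)] \<in> reach 2"
proof -
  let ?y = "[([(E,-2),(F,-1)], [0,0,3]), ([(E,-1),(F,-2)], [0,0,-3])]"
  have "drop_H W3_vec = ?y" "neutral_of_weight 3 W3_vec" by code_simp+
  then have y: "lin ?y \<in> reach 3"
    using reach_drop_H[of W3_vec 3] U3_subset_reach[OF W3_in_U3] by (simp add: lin_W3_vec)
  \<comment> \<open>The derivative of \<open>e(-1) f(-1)\<close> is the sum of the two words, so
    their difference is twice the first word minus this derivative. Only products ending in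
    \<open>f(-1)\<close> remain, the shape that \<open>quadratic_mode\<close> evaluates.\<close>
  have "lin ?y = lin (combine [([0,0,6], [([(E,-2),(F,-1)], [1])]),
      ([0,0,-3], virv [0,1] (-1) [([(E,-1),(F,-1)], [1])])])" by (rule lin_eqI) code_simp
  also have "\<dots> = (6 * k\<^sup>2) *s word_vec [(E,-2),(F,-1)]
      + (-3 * k\<^sup>2) *s Y conf 0 (word_vec [(E,-1),(F,-1)])"
    by (simp add: combine_def lin_virv power2_eq_square mult_ac)
  finally have lin_y: "lin ?y = (6 * k\<^sup>2) *s word_vec [(E,-2),(F,-1)]
      + (-3 * k\<^sup>2) *s Y conf 0 (word_vec [(E,-1),(F,-1)])" .
  \<comment> \<open>The 9 is \<open>(-3) * (-3)\<close>: mode 3 of a derivative is \<open>-3\<close>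
    times mode 2.\<close>
  define z where "z = combine [([0,0,6], generic_ef 2 3 W3_vec), ([0,0,9], generic_ef 1 2 W3_vec)]"
  have "Y (lin ?y) 3 W3 \<in> reach 2"
    using reach_product[OF y W3_in_U3 weight_W3, of 3] by simp
  moreover have "Y (lin ?y) 3 W3 = lin z"
  proof -
    have 1: "lin (generic_ef 2 3 W3_vec) = Y (word_vec [(E, - int 2), (F, -1)]) 3 (lin W3_vec)"
      by (rule lin_generic_ef) (simp, code_simp)
    have 2: "lin (generic_ef 1 2 W3_vec) = Y (word_vec [(E, - int 1), (F, -1)]) 2 (lin W3_vec)"
      by (rule lin_generic_ef) (simp, code_simp)
    show ?thesis
      unfolding lin_y z_def combine_def using 1 2
      by (simp add: Y_linear L_minus_one_derivative lin_W3_vec power2_eq_square mult_ac)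
  qed
  ultimately have "lin z \<in> reach 2" by simp
  moreover have "neutral_of_weight 2 z" unfolding z_def by code_simp
  ultimately have "lin (drop_H z) \<in> reach 2" by (rule reach_drop_H)
  moreover have "drop_H z = [([(E,-1),(F,-1)], [0,0,0,-288,-72,108])]"
    unfolding z_def by code_simp
  ultimately have "list_all (\<lambda>(q, v). lin v \<in> reach 2)
      [([1], [([(E,-1),(F,-1)], [0,0,0,-288,-72,108])])]" by simp
  then show ?thesis
  proof (rule reach_combine)
    \<comment> \<open>The factor \<open>k - 2\<close> is where \<open>l \<ge> 3\<close>
      enters.\<close>
    have "pev [0,0,0,-288,-72,108] k = 36 * k ^ 3 * ((3 * k + 4) * (k - 2))"
      by (simp add: algebra_simps power3_eq_cube)
    moreover have "3 * k + 4 \<noteq> 0" using pev_nonzero[of "[4,3]"] by (simp add: algebra_simps)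
    moreover have "k - 2 \<noteq> 0"
      using level l_ge_3 by (simp add: complex_eq_iff)
    ultimately show "pev [0,0,0,-288,-72,108] k \<noteq> 0" by simp
  qed code_simp
qed

lemma omega_vec_in_U3: "lin omega_vec \<in> U3"
proof (rule N0_reach[OF omega_vec_in_N0])
  have "lin omega_vec - lin (drop_H omega_vec) \<in> Hspace 2"
    by (rule lin_drop_H) code_simp
  moreover have "drop_H omega_vec = [([(E,-1),(F,-1)], [0,2])]" by code_simp
  moreover have "(2 * k) *s word_vec [(E,-1),(F,-1)] \<in> reach 2"
    by (intro subspace_scale subspace_reach reach_2)
  ultimately have "lin omega_vec - (2 * k) *s word_vec [(E,-1),(F,-1)] \<in> reach 2"
    by (intro Hspace_subset_reach) (simp add: mult.commute)
  from subspace_add[OF subspace_reach this, of "(2 * k) *s word_vec [(E,-1),(F,-1)]"]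
  show "lin omega_vec \<in> reach 2"
    using \<open>(2 * k) *s word_vec [(E,-1),(F,-1)] \<in> reach 2\<close> by simp
qed

lemma omega_in_U3: "omega \<in> U3"
proof -
  have "(1 / (2 * k * (k + 2))) *s lin omega_vec \<in> U3"
    by (intro subspace_scale subspace_U3 omega_vec_in_U3)
  then show ?thesis by (simp add: lin_omega_vec del: distrib_left_numeral)
qed

lemma reach_word: "word_vec w \<in> reach d \<Longrightarrow> lin [(w, [1])] \<in> reach d"
  by simp

text \<open>Modulo \<open>Hspace\<close>, \<open>W3\<close> supplies the difference of the two words
  and the derivative of \<open>e(-1) f(-1)\<close> their sum.\<close>

lemma reach_3:
  "word_vec [(E,-2),(F,-1)] \<in> reach 3" "word_vec [(E,-1),(F,-2)] \<in> reach 3"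
proof -
  have t: "lin (virv [0,1] (-1) [([(E,-1),(F,-1)], [1])]) \<in> reach 3"
    using reach_virv[OF reach_word[OF reach_2]] by simp
  have "lin W3_vec \<in> reach 3"
    using U3_subset_reach[OF W3_in_U3] by (simp add: lin_W3_vec)
  then have g: "lin (drop_H W3_vec) \<in> reach 3"
    by (rule reach_drop_H) code_simp
  show "word_vec [(E,-2),(F,-1)] \<in> reach 3"
  proof (rule reach_combine)
    show "list_all (\<lambda>(q, v). lin v \<in> reach 3)
        [([0,0,3], virv [0,1] (-1) [([(E,-1),(F,-1)], [1])]), ([1], drop_H W3_vec)]"
      using t g by simp
    show "pev [0,0,6] k \<noteq> 0" by (rule pev_nonzero) simp_all
  qed code_simp
  show "word_vec [(E,-1),(F,-2)] \<in> reach 3"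
  proof (rule reach_combine)
    show "list_all (\<lambda>(q, v). lin v \<in> reach 3)
        [([0,0,3], virv [0,1] (-1) [([(E,-1),(F,-1)], [1])]), ([-1], drop_H W3_vec)]"
      using t g by simp
    show "pev [0,0,6] k \<noteq> 0" by (rule pev_nonzero) simp_all
  qed code_simp
qed

text \<open>Four vectors for four words: two derivatives from weight 3, mode \<open>-1\<close> of
  \<open>e(-1) f(-1)\<close> on \<open>omega\<close>, and mode 1 of \<open>e(-2) f(-1)\<close> on
  \<open>W3\<close>. Isolating the first word costs the determinant with factor
  \<open>2 k + 3\<close>; the others follow by back substitution.\<close>

lemma reach_4:
  "word_vec [(E,-3),(F,-1)] \<in> reach 4" "word_vec [(E,-2),(F,-2)] \<in> reach 4"
  "word_vec [(E,-1),(F,-3)] \<in> reach 4" "word_vec [(E,-1),(E,-1),(F,-1),(F,-1)] \<in> reach 4"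
proof -
  have t1: "lin (virv [0,1] (-1) [([(E,-2),(F,-1)], [1])]) \<in> reach 4"
    using reach_virv[OF reach_word[OF reach_3(1)]] by simp
  have t2: "lin (virv [0,1] (-1) [([(E,-1),(F,-2)], [1])]) \<in> reach 4"
    using reach_virv[OF reach_word[OF reach_3(2)]] by simp
  have "lin (drop_H (generic_ef 1 (-1) omega_vec)) \<in> reach (int 1 + 2 - (-1))"
    by (rule reach_generic_ef) (use reach_2 omega_vec_in_U3 in simp, use omega_vec_in_U3 in simp, simp, code_simp+)
  then have g1: "lin (drop_H (generic_ef 1 (-1) omega_vec)) \<in> reach 4" by simp
  have "lin (drop_H (generic_ef 2 1 W3_vec)) \<in> reach (int 2 + 3 - 1)"
    by (rule reach_generic_ef) (use reach_3 in simp, use W3_in_U3 in \<open>simp add: lin_W3_vec\<close>, simp, code_simp+)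
  then have g2: "lin (drop_H (generic_ef 2 1 W3_vec)) \<in> reach 4" by simp
  show a: "word_vec [(E,-3),(F,-1)] \<in> reach 4"
  proof (rule reach_combine)
    show "list_all (\<lambda>(q, v). lin v \<in> reach 4)
        [([6], drop_H (generic_ef 1 (-1) omega_vec)), ([1], drop_H (generic_ef 2 1 W3_vec)),
         ([0,0,-12,-9], virv [0,1] (-1) [([(E,-1),(F,-2)], [1])]),
         ([0,0,30,18], virv [0,1] (-1) [([(E,-2),(F,-1)], [1])])]"
      using t1 t2 g1 g2 by simp
    show "pev [0,0,72,48] k \<noteq> 0" by (rule pev_nonzero) simp_all
  qed code_simp
  show b: "word_vec [(E,-2),(F,-2)] \<in> reach 4"
  proof (rule reach_combine)
    show "list_all (\<lambda>(q, v). lin v \<in> reach 4)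
        [([1], virv [0,1] (-1) [([(E,-2),(F,-1)], [1])]), ([-2], [([(E,-3),(F,-1)], [1])])]"
      using t1 a by simp
    show "pev [1] k \<noteq> 0" by simp
  qed code_simp
  show d: "word_vec [(E,-1),(F,-3)] \<in> reach 4"
  proof (rule reach_combine)
    show "list_all (\<lambda>(q, v). lin v \<in> reach 4)
        [([1], virv [0,1] (-1) [([(E,-1),(F,-2)], [1])]), ([-1], [([(E,-2),(F,-2)], [1])])]"
      using t2 b by simp
    show "pev [2] k \<noteq> 0" by simp
  qed code_simp
  show "word_vec [(E,-1),(E,-1),(F,-1),(F,-1)] \<in> reach 4"
  proof (rule reach_combine)
    show "list_all (\<lambda>(q, v). lin v \<in> reach 4)
        [([1], drop_H (generic_ef 1 (-1) omega_vec)), ([0,-12,-2], [([(E,-3),(F,-1)], [1])]),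
         ([0,4], [([(E,-2),(F,-2)], [1])]), ([0,-4,-2], [([(E,-1),(F,-3)], [1])])]"
      using g1 a b d by simp
    show "pev [0,2] k \<noteq> 0" by (rule pev_nonzero) simp_all
  qed code_simp
qed

text \<open>Six vectors for six words: the derivatives of the four words of weight 4, mode
  \<open>-1\<close> of \<open>e(-1) f(-1)\<close> and mode 1 of \<open>e(-3) f(-1)\<close>, both on
  \<open>W3\<close>. The first elimination gives the factor \<open>3 k + 4\<close>.\<close>

lemma reach_5:
  "word_vec [(E,-4),(F,-1)] \<in> reach 5" "word_vec [(E,-3),(F,-2)] \<in> reach 5"
  "word_vec [(E,-2),(F,-3)] \<in> reach 5" "word_vec [(E,-1),(F,-4)] \<in> reach 5"
  "word_vec [(E,-1),(E,-1),(F,-2),(F,-1)] \<in> reach 5"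
  "word_vec [(E,-2),(E,-1),(F,-1),(F,-1)] \<in> reach 5"
proof -
  have t1: "lin (virv [0,1] (-1) [([(E,-3),(F,-1)], [1])]) \<in> reach 5"
    using reach_virv[OF reach_word[OF reach_4(1)]] by simp
  have t2: "lin (virv [0,1] (-1) [([(E,-2),(F,-2)], [1])]) \<in> reach 5"
    using reach_virv[OF reach_word[OF reach_4(2)]] by simp
  have t3: "lin (virv [0,1] (-1) [([(E,-1),(F,-3)], [1])]) \<in> reach 5"
    using reach_virv[OF reach_word[OF reach_4(3)]] by simp
  have t4: "lin (virv [0,1] (-1) [([(E,-1),(E,-1),(F,-1),(F,-1)], [1])]) \<in> reach 5"
    using reach_virv[OF reach_word[OF reach_4(4)]] by simp
  have "lin (drop_H (generic_ef 1 (-1) W3_vec)) \<in> reach (int 1 + 3 - (-1))"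
    by (rule reach_generic_ef) (use reach_2 in simp, use W3_in_U3 in \<open>simp add: lin_W3_vec\<close>, simp, code_simp+)
  then have g1: "lin (drop_H (generic_ef 1 (-1) W3_vec)) \<in> reach 5" by simp
  have "lin (drop_H (generic_ef 3 1 W3_vec)) \<in> reach (int 3 + 3 - 1)"
    by (rule reach_generic_ef) (use reach_4 in simp, use W3_in_U3 in \<open>simp add: lin_W3_vec\<close>, simp, code_simp+)
  then have g2: "lin (drop_H (generic_ef 3 1 W3_vec)) \<in> reach 5" by simp
  show a: "word_vec [(E,-4),(F,-1)] \<in> reach 5"
  proof (rule reach_combine)
    show "list_all (\<lambda>(q, v). lin v \<in> reach 5)
        [([4], drop_H (generic_ef 1 (-1) W3_vec)), ([0,2], drop_H (generic_ef 3 1 W3_vec)),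
         ([0,0,-6], virv [0,1] (-1) [([(E,-1),(E,-1),(F,-1),(F,-1)], [1])]),
         ([0,0,-32,8,24], virv [0,1] (-1) [([(E,-1),(F,-3)], [1])]),
         ([0,0,16,-28,-21], virv [0,1] (-1) [([(E,-2),(F,-2)], [1])]),
         ([0,0,-8,80,48], virv [0,1] (-1) [([(E,-3),(F,-1)], [1])])]"
      using t1 t2 t3 t4 g1 g2 by simp
    show "pev [0,0,0,240,180] k \<noteq> 0" by (rule pev_nonzero) simp_all
  qed code_simp
  show b: "word_vec [(E,-3),(F,-2)] \<in> reach 5"
  proof (rule reach_combine)
    show "list_all (\<lambda>(q, v). lin v \<in> reach 5)
        [([1], virv [0,1] (-1) [([(E,-3),(F,-1)], [1])]), ([-3], [([(E,-4),(F,-1)], [1])])]"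
      using t1 a by simp
    show "pev [1] k \<noteq> 0" by simp
  qed code_simp
  show d: "word_vec [(E,-2),(F,-3)] \<in> reach 5"
  proof (rule reach_combine)
    show "list_all (\<lambda>(q, v). lin v \<in> reach 5)
        [([1], virv [0,1] (-1) [([(E,-2),(F,-2)], [1])]), ([-2], [([(E,-3),(F,-2)], [1])])]"
      using t2 b by simp
    show "pev [2] k \<noteq> 0" by simp
  qed code_simp
  show g: "word_vec [(E,-1),(F,-4)] \<in> reach 5"
  proof (rule reach_combine)
    show "list_all (\<lambda>(q, v). lin v \<in> reach 5)
        [([1], virv [0,1] (-1) [([(E,-1),(F,-3)], [1])]), ([-1], [([(E,-2),(F,-3)], [1])])]"
      using t3 d by simp
    show "pev [3] k \<noteq> 0" by simp
  qed code_simp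
  show i: "word_vec [(E,-1),(E,-1),(F,-2),(F,-1)] \<in> reach 5"
  proof (rule reach_combine)
    show "list_all (\<lambda>(q, v). lin v \<in> reach 5)
        [([1], drop_H (generic_ef 3 1 W3_vec)), ([0,24,12,-18], [([(E,-4),(F,-1)], [1])]),
         ([0,-24,6,3], [([(E,-3),(F,-2)], [1])]), ([0,24,-18,-9], [([(E,-2),(F,-3)], [1])]),
         ([0,-72,0,36], [([(E,-1),(F,-4)], [1])])]"
      using g2 a b d g by simp
    show "pev [0,12] k \<noteq> 0" by (rule pev_nonzero) simp_all
  qed code_simp
  show "word_vec [(E,-2),(E,-1),(F,-1),(F,-1)] \<in> reach 5"
  proof (rule reach_combine)
    show "list_all (\<lambda>(q, v). lin v \<in> reach 5)
        [([1], virv [0,1] (-1) [([(E,-1),(E,-1),(F,-1),(F,-1)], [1])]),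
         ([-2], [([(E,-1),(E,-1),(F,-2),(F,-1)], [1])])]"
      using t4 i by simp
    show "pev [2] k \<noteq> 0" by simp
  qed code_simp
qed

lemma N0_4_subset_U3:
  assumes "v \<in> N0" "has_weight v 4"
  shows "v \<in> U3"
proof (rule N0_reach[OF assms(1)], rule pure_words_reach[OF assms])
  fix w assume "pbw_word w" "word_weight w = 4" "word_charge w = 0" "\<forall>m\<in>set w. fst m \<noteq> H"
  from pure_word_4[OF this] reach_4 show "word_vec w \<in> reach 4" by blast
qed (use subspace_reach Hspace_subset_reach in auto)

lemma N0_5_subset_U3:
  assumes "v \<in> N0" "has_weight v 5"
  shows "v \<in> U3"
proof (rule N0_reach[OF assms(1)], rule pure_words_reach[OF assms])
  fix w assume "pbw_word w" "word_weight w = 5" "word_charge w = 0" "\<forall>m\<in>set w. fst m \<noteq> H"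
  from pure_word_5[OF this] reach_5 show "word_vec w \<in> reach 5" by blast
qed (use subspace_reach Hspace_subset_reach in auto)

lemma W3_generates:
  assumes "is_W 4 W4" "is_W 5 W5"
  shows "generated_subalgebra {W3} = W_tilde W4 W5"
proof
  show "generated_subalgebra {W3} \<subseteq> W_tilde W4 W5"
    unfolding W_tilde_def
    by (rule generated_subalgebra_minimal)
       (use generated_subalgebra_superset[of "{omega, W3, W4, W5}"] in
         \<open>auto intro: generated_subalgebra_is_subalgebra\<close>)
  show "W_tilde W4 W5 \<subseteq> generated_subalgebra {W3}"
    unfolding W_tilde_def U3_def[symmetric]
    by (rule generated_subalgebra_minimal)
       (use assms in \<open>auto simp: is_W_def U3_subalgebra omega_in_U3 W3_in_U3 N0_4_subset_U3 N0_5_subset_U3\<close>)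
qed

end

end

section \<open>Maximal ideals at levels 2, 3 and 4\<close>

text \<open>\<open>singular_4\<close> and \<open>singular_5\<close> are \<open>f(0)\<^sup>4 e(-1)\<^sup>4 \<one> / 24\<close> at level 3 and
  \<open>f(0)\<^sup>5 e(-1)\<^sup>5 \<one> / 120\<close> at level 4.\<close>

definition singular_4 :: wvec where
  "singular_4 = [([(E,-2),(F,-2)], [24]), ([(E,-1),(E,-1),(F,-1),(F,-1)], [6]),
     ([(E,-1),(F,-3)], [-24]), ([(H,-4)], [6]), ([(H,-3),(H,-1)], [8]),
     ([(H,-2),(E,-1),(F,-1)], [-12]), ([(H,-2),(H,-2)], [3]), ([(H,-2),(H,-1),(H,-1)], [6]),
     ([(H,-1),(E,-2),(F,-1)], [24]), ([(H,-1),(E,-1),(F,-2)], [-24]),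
     ([(H,-1),(H,-1),(E,-1),(F,-1)], [-12]), ([(H,-1),(H,-1),(H,-1),(H,-1)], [1])]"

definition singular_5 :: wvec where
  "singular_5 = [([(E,-2),(E,-1),(F,-1),(F,-1)], [60]), ([(E,-2),(F,-3)], [-120]),
     ([(E,-1),(E,-1),(F,-2),(F,-1)], [-60]), ([(E,-1),(F,-4)], [120]),
     ([(H,-5)], [-24]), ([(H,-4),(H,-1)], [-30]), ([(H,-3),(E,-1),(F,-1)], [40]),
     ([(H,-3),(H,-2)], [-20]), ([(H,-3),(H,-1),(H,-1)], [-20]),
     ([(H,-2),(E,-2),(F,-1)], [-60]), ([(H,-2),(E,-1),(F,-2)], [60]),
     ([(H,-2),(H,-2),(H,-1)], [-15]), ([(H,-2),(H,-1),(E,-1),(F,-1)], [60]),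
     ([(H,-2),(H,-1),(H,-1),(H,-1)], [-10]), ([(H,-1),(E,-2),(F,-2)], [-120]),
     ([(H,-1),(E,-1),(E,-1),(F,-1),(F,-1)], [-30]), ([(H,-1),(E,-1),(F,-3)], [120]),
     ([(H,-1),(H,-1),(E,-2),(F,-1)], [-60]), ([(H,-1),(H,-1),(E,-1),(F,-2)], [60]),
     ([(H,-1),(H,-1),(H,-1),(E,-1),(F,-1)], [20]),
     ([(H,-1),(H,-1),(H,-1),(H,-1),(H,-1)], [-1])]"

definition coset_L2_vec :: "kpoly \<Rightarrow> wvec \<Rightarrow> wvec" where
  "coset_L2_vec K v =
     combine [(psmult 4 K, virv K 2 v), ([-1], actv K (H, 1) (actv K (H, 1) v))]"

context positive_level
begin

section \<open>Submodules generated by singular vectors\<close>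

definition lowest :: "int \<Rightarrow> 'v set" where
  "lowest d = {v. has_weight v d \<and> (\<forall>a. \<forall>m\<ge>1. Y (x a) m v = 0)}"

text \<open>All singular vectors of weight \<open>d\<close> are taken together: the zero modes
  preserve this set, so creation words alone already give a submodule.\<close>

definition lowest_module :: "int \<Rightarrow> 'v set" where
  "lowest_module d = span {foldr mode_op w s |w s. negative_word w \<and> s \<in> lowest d}"

lemma subspace_lowest_module: "subspace (lowest_module d)"
  by (simp add: lowest_module_def)

lemma lowest_in_module: "s \<in> lowest d \<Longrightarrow> s \<in> lowest_module d"
  unfolding lowest_module_def by (intro span_base CollectI exI[of _ "[]"] exI[of _ s]) simp

lemma lowest_zero_mode: "s \<in> lowest d \<Longrightarrow> Y (x a) 0 s \<in> lowest d"
  using weight_mode[of s d a 0]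
  by (auto simp: lowest_def mode_commutator[of _ _ a 0] bracket_term_def split: option.splits)

lemma lowest_module_negative_mode:
  assumes "v \<in> lowest_module d" "n < 0"
  shows "Y (x a) n v \<in> lowest_module d"
proof -
  have "lowest_module d \<subseteq> {v. Y (x a) n v \<in> lowest_module d}"
    unfolding lowest_module_def
  proof (rule span_minimal)
    show "subspace {v. Y (x a) n v \<in> span {foldr mode_op w s |w s. negative_word w \<and> s \<in> lowest d}}"
      by (auto simp: subspace_def Y_linear span_zero span_add span_scale)
    show "{foldr mode_op w s |w s. negative_word w \<and> s \<in> lowest d} \<subseteq>
        {v. Y (x a) n v \<in> span {foldr mode_op w s |w s. negative_word w \<and> s \<in> lowest d}}"
    proof clarify
      fix w s assume "negative_word w" "s \<in> lowest d"
      then show "Y (x a) n (foldr mode_op w s) \<in>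
          span {foldr mode_op w s |w s. negative_word w \<and> s \<in> lowest d}"
        using assms(2) by (intro span_base CollectI exI[of _ "(a, n) # w"] exI[of _ s]) simp
    qed
  qed
  then show ?thesis using assms(1) by auto
qed

lemma lowest_module_mode:
  assumes "v \<in> lowest_module d"
  shows "Y (x a) n v \<in> lowest_module d"
proof -
  have gen: "Y (x a) n (foldr mode_op w s) \<in> lowest_module d"
    if s: "s \<in> lowest d" and "negative_word w" for a n w s
    using that(2)
  proof (induction w arbitrary: a n)
    case Nil
    consider "n < 0" | "n = 0" | "n \<ge> 1" by linarith
    then show ?case
    proof cases
      case 1
      then show ?thesis using lowest_module_negative_mode[OF lowest_in_module[OF s]] by simp
    next
      case 2
      then show ?thesis using lowest_in_module[OF lowest_zero_mode[OF s]] by simp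
    next
      case 3
      then show ?thesis using s subspace_0[OF subspace_lowest_module] by (simp add: lowest_def)
    qed
  next
    case (Cons m w)
    have IH: "Y (x b) j (foldr mode_op w s) \<in> lowest_module d" for b j
      using Cons by simp
    have "foldr mode_op w s \<in> lowest_module d"
      unfolding lowest_module_def using Cons.prems s by (intro span_base) auto
    moreover have "mode_op m (Y (x a) n (foldr mode_op w s)) \<in> lowest_module d"
      using Cons.prems by (intro lowest_module_negative_mode IH) simp
    moreover have "bracket_term a (fst m) (n + snd m) (foldr mode_op w s) \<in> lowest_module d"
      using IH by (auto simp: bracket_term_def subspace_0 subspace_scale subspace_lowest_module
          split: option.splits)
    ultimately show ?case
      unfolding foldr.simps comp_def mode_commutator[of a n "fst m"]
      by (intro subspace_add subspace_lowest_module)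
        (auto simp: subspace_0 subspace_scale subspace_lowest_module)
  qed
  have "lowest_module d \<subseteq> {v. Y (x a) n v \<in> lowest_module d}"
    unfolding lowest_module_def
  proof (rule span_minimal)
    show "subspace {v. Y (x a) n v \<in> span {foldr mode_op w s |w s. negative_word w \<and> s \<in> lowest d}}"
      by (auto simp: subspace_def Y_linear span_zero span_add span_scale)
  qed (use gen in \<open>auto simp: lowest_module_def\<close>)
  then show ?thesis using assms by auto
qed

text \<open>Closure under the modes of the \<open>x a\<close> extends to every field by applying the
  associator formula along a word.\<close>

lemma lowest_module_left:
  assumes "v \<in> lowest_module d"
  shows "Y u n v \<in> lowest_module d"
proof -
  have "u \<in> {u. \<forall>v\<in>lowest_module d. \<forall>n. Y u n v \<in> lowest_module d}"
  proof (rule in_subspace_if_words)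
    show "subspace {u. \<forall>v\<in>lowest_module d. \<forall>n. Y u n v \<in> lowest_module d}"
      by (auto simp: subspace_def Y_linear lowest_module_def span_zero span_add span_scale)
  next
    fix w
    have "Y (word_vec w) n v \<in> lowest_module d" if "v \<in> lowest_module d" for v n
      using that
    proof (induction w arbitrary: v n)
      case Nil
      then show ?case by (simp add: vacuum subspace_0 subspace_lowest_module)
    next
      case (Cons m w)
      show ?case
        unfolding word_vec_Cons
        by (rule associator_in_subspace[OF subspace_lowest_module])
          (intro lowest_module_mode Cons.IH Cons.prems)+
    qed
    then show "word_vec w \<in> {u. \<forall>v\<in>lowest_module d. \<forall>n. Y u n v \<in> lowest_module d}" by simp
  qed
  then show ?thesis using assms by simp
qed

text \<open>Induction over the word for \<open>u\<close>: on the vacuum, \<open>Y v (-1-j)\<close>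
  is a multiple of the \<open>j\<close>-fold derivative of \<open>v\<close>; each further letter is
  exchanged with \<open>Y v n\<close>, and its commutators are again modes of elements of the
  submodule.\<close>

lemma lowest_module_right:
  assumes "v \<in> lowest_module d"
  shows "Y v n u \<in> lowest_module d"
proof -
  have vac: "Y v n vac \<in> lowest_module d" if v: "v \<in> lowest_module d" for v n
  proof (cases "n \<ge> 0")
    case True
    then show ?thesis by (simp add: creation_regular subspace_0 subspace_lowest_module)
  next
    case False
    have "Y v (- 1 - int j) vac \<in> lowest_module d" for j
      using v
    proof (induction j arbitrary: v)
      case 0
      then show ?case by (simp add: creation)
    next
      case (Suc j)
      have "Y (Y conf 0 v) (- 1 - int j) vac \<in> lowest_module d"
        by (rule Suc.IH) (rule lowest_module_left[OF Suc.prems])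
      moreover have "Y (Y conf 0 v) (- 1 - int j) vac = of_nat (Suc j) *s Y v (- 1 - int (Suc j)) vac"
        by (simp add: L_minus_one_derivative algebra_simps)
      ultimately have "of_nat (Suc j) *s Y v (- 1 - int (Suc j)) vac \<in> lowest_module d" by simp
      from subspace_scale[OF subspace_lowest_module this, of "1 / of_nat (Suc j)"]
      show ?case by (simp del: of_nat_Suc)
    qed
    from this[of "nat (- 1 - n)"] show ?thesis using False by simp
  qed
  have "u \<in> {u. \<forall>v\<in>lowest_module d. \<forall>n. Y v n u \<in> lowest_module d}"
  proof (rule in_subspace_if_words)
    show "subspace {u. \<forall>v\<in>lowest_module d. \<forall>n. Y v n u \<in> lowest_module d}"
      by (auto simp: subspace_def Y_linear lowest_module_def span_zero span_add span_scale)
  next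
    fix w
    have "Y v n (word_vec w) \<in> lowest_module d" if "v \<in> lowest_module d" for v n
      using that
    proof (induction w arbitrary: v n)
      case Nil
      then show ?case using vac by simp
    next
      case (Cons m w)
      have "mode_op m (Y v n (word_vec w)) - Y v n (mode_op m (word_vec w)) \<in> lowest_module d"
        by (intro commutator_in_subspace subspace_lowest_module Cons.IH lowest_module_mode Cons.prems)
      moreover have "mode_op m (Y v n (word_vec w)) \<in> lowest_module d"
        by (intro lowest_module_mode Cons.IH Cons.prems)
      ultimately show ?case
        using subspace_diff[OF subspace_lowest_module] by fastforce
    qed
    then show "word_vec w \<in> {u. \<forall>v\<in>lowest_module d. \<forall>n. Y v n u \<in> lowest_module d}" by simp
  qed
  then show ?thesis using assms by simp
qed

lemma weight_foldr_mode:
  "has_weight s d \<Longrightarrow> has_weight (foldr mode_op w s) (d + word_weight w)"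
proof (induction w)
  case (Cons m w)
  have eq: "d + word_weight (m # w) = d + word_weight w - snd m" by (simp add: word_weight_def)
  show ?case
    unfolding eq foldr.simps comp_def by (rule weight_mode[OF Cons.IH[OF Cons.prems]])
qed (simp add: word_weight_def)

text \<open>Generators have weight at least \<open>d > 0\<close>, and a sum of such eigenvectors
  cannot be a nonzero vector of weight 0.\<close>

lemma vac_not_in_lowest_module:
  assumes "d > 0"
  shows "vac \<notin> lowest_module d"
proof
  assume "vac \<in> lowest_module d"
  then obtain A r where A: "finite A" "A \<subseteq> {foldr mode_op w s |w s. negative_word w \<and> s \<in> lowest d}"
      "vac = (\<Sum>a\<in>A. r a *s a)"
    by (auto simp: lowest_module_def span_explicit)
  have "\<exists>i>0. has_weight a i" if aA: "a \<in> A" for a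
  proof -
    obtain w s where w: "a = foldr mode_op w s" "negative_word w" "s \<in> lowest d"
      using subsetD[OF A(2) aA] by auto
    have "has_weight a (d + word_weight w)" using w by (auto simp: lowest_def intro: weight_foldr_mode)
    moreover have "word_weight w \<ge> 0" using word_weight_ge_length[OF w(2)] by simp
    ultimately show ?thesis using assms by (intro exI[of _ "d + word_weight w"]) auto
  qed
  then obtain i where i: "\<And>a. a \<in> A \<Longrightarrow> i a > 0 \<and> has_weight a (i a)" by metis
  have "vac = 0"
  proof (rule eigenvector_sum_eq_0[OF A(1), where T = "Y conf 1" and g = "\<lambda>a. r a *s a" and \<nu> = 0])
    show "Y conf 1 (r a *s a) = of_int (i a) *s (r a *s a)" if "a \<in> A" for a
      using i[OF that] by (simp add: has_weight_def Y_linear mult.commute)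
    show "(of_int (i a) :: complex) \<noteq> 0" if "a \<in> A" for a
      using i[OF that] by simp
    show "Y conf 1 vac = 0 *s vac" by (simp add: creation_regular)
  qed (use A in \<open>auto simp: Y_linear\<close>)
  then show False using nontrivial by simp
qed

lemma lowest_in_maximal_ideal:
  assumes "vertex_subalgebra U" "s \<in> U" "s \<in> lowest d" "d > 0"
  shows "\<exists>I. maximal_ideal_of U I \<and> s \<in> I"
proof -
  have "ideal_of U (U \<inter> lowest_module d)"
    using assms(1) lowest_module_left lowest_module_right
    by (auto simp: ideal_of_def vertex_subalgebra_def intro: subspace_inter subspace_lowest_module)
  then obtain I where "maximal_ideal_of U I" "U \<inter> lowest_module d \<subseteq> I"
    using exists_maximal_ideal[of U "U \<inter> lowest_module d"] assms vac_not_in_lowest_module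
    by (auto simp: vertex_subalgebra_def)
  then show ?thesis using assms lowest_in_module by blast
qed

section \<open>Singular vectors at levels 2, 3 and 4\<close>

lemma lin_lowest:
  assumes K: "pev K k = k"
    and "list_all (\<lambda>(w, p). word_weight w = d) v"
    and "list_all (\<lambda>(u, p). word_bound u < int M) v"
    and "list_all (\<lambda>m. list_all (\<lambda>a. actv K (a, int m) v = []) [H, E, F]) [1..<M]"
  shows "lin v \<in> lowest d"
  unfolding lowest_def
proof (intro CollectI conjI allI impI)
  fix a and m :: int assume m: "m \<ge> 1"
  show "Y (x a) m (lin v) = 0"
  proof (cases "m < int M")
    case True
    then have "list_all (\<lambda>a. actv K (a, int (nat m)) v = []) [H, E, F]"
      using assms(4) m unfolding list_all_iff[of _ "[1..<M]"] by (intro bspec[where x = "nat m"]) auto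
    then have "actv K (a, m) v = []" using m by (cases a) auto
    then show ?thesis using lin_actv[OF K, of "(a, m)" v] by simp
  next
    case False
    then show ?thesis using assms(3) by (intro mode_vanishes_lin) (auto simp: list_all_iff)
  qed
qed (rule weight_lin[OF assms(2)])

lemma W3_lowest:
  assumes "l = 2"
  shows "W3 \<in> lowest 3"
proof -
  \<comment> \<open>\<open>W3_vec\<close> with \<open>k = 2\<close> inserted; its positive modes
    vanish at this level, not for generic \<open>k\<close>.\<close>
  let ?v = "[([(H,-3)], [4]), ([(H,-2),(H,-1)], [6]), ([(H,-1),(H,-1),(H,-1)], [2]),
     ([(H,-1),(E,-1),(F,-1)], [-12]), ([(E,-2),(F,-1)], [12]), ([(E,-1),(F,-2)], [-12])]"
  have low: "lin ?v \<in> lowest 3"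
    by (rule lin_lowest[where K = "[2]" and M = 4]) (use level assms in simp, code_simp+)
  have "pev [4] k = pev [0,0,1] k" "pev [6] k = pev [0,3] k" "pev [-12] k = pev [0,-6] k"
      "pev [12] k = pev [0,0,3] k" "pev [-12] k = pev [0,0,-3] k"
    using level assms by simp_all
  then have "lin ?v = W3"
    unfolding lin_W3_vec[symmetric] W3_vec_def lin.simps by metis
  with low show ?thesis by simp
qed

lemma singular_4_lowest: "l = 3 \<Longrightarrow> lin singular_4 \<in> lowest 4"
  by (rule lin_lowest[where K = "[3]" and M = 5]) (use level in simp, code_simp+)

lemma singular_4_in_N0: "l = 3 \<Longrightarrow> lin singular_4 \<in> N0"
  by (rule lin_in_N0[where K = "[3]" and M = 5]) (use level in simp, code_simp+)

lemma singular_5_lowest: "l = 4 \<Longrightarrow> lin singular_5 \<in> lowest 5"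
  by (rule lin_lowest[where K = "[4]" and M = 6]) (use level in simp, code_simp+)

lemma singular_5_in_N0: "l = 4 \<Longrightarrow> lin singular_5 \<in> N0"
  by (rule lin_in_N0[where K = "[4]" and M = 6]) (use level in simp, code_simp+)

text \<open>\<open>conf - omega\<close> is the Heisenberg conformal vector
  \<open>h(-1)^2 vac / (4 k)\<close>. Every term of its modes \<open>n \<ge> 0\<close> contains some
  \<open>h(m)\<close> with \<open>m \<ge> 0\<close> that can act first on \<open>u\<close>.\<close>

lemma conf_omega_on_N0:
  assumes "u \<in> N0" "n \<ge> 0"
  shows "Y conf n u = Y omega n u"
proof -
  have word: "Y (x a) (-1) (x b) = word_vec [(a, -1), (b, -1)]" for a b by (simp add: creation)
  have FE: "lin (actv [0,1] (F, -1) [([(E,-1)], [1])]) = word_vec [(F,-1), (E,-1)]"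
    by (simp add: lin_actv)
  have conf4: "(4 * (k + 2)) *s conf = word_vec [(H,-1),(H,-1)] + 2 *s word_vec [(E,-1),(F,-1)]
      + 2 *s word_vec [(F,-1),(E,-1)]"
    unfolding conf_eq scale_scale word by (simp del: distrib_left_numeral word_vec_Cons)
  have "lin (combine [([0,1], [([(H,-1),(H,-1)], [1])]), ([0,2], [([(E,-1),(F,-1)], [1])]),
      ([0,2], actv [0,1] (F, -1) [([(E,-1)], [1])]), ([-2], omega_vec)])
    = lin [([(H,-1),(H,-1)], [2, 1])]"
    by (rule lin_eqI) code_simp
  then have "k *s word_vec [(H,-1),(H,-1)] + (k * 2) *s word_vec [(E,-1),(F,-1)]
      + (k * 2) *s word_vec [(F,-1),(E,-1)] - 2 *s lin omega_vec = (k + 2) *s word_vec [(H,-1),(H,-1)]"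
    by (simp add: combine_def FE add.assoc add.commute[of 2] del: word_vec_Cons flip: add_diff_eq)
  then have "k *s ((4 * (k + 2)) *s conf) - 2 *s lin omega_vec = (k + 2) *s word_vec [(H,-1),(H,-1)]"
    unfolding conf4 by (simp add: scale_right_distrib del: word_vec_Cons)
  then have "(4 * k * (k + 2)) *s (conf - omega) = (k + 2) *s Y (x H) (-1) (x H)"
    by (simp add: lin_omega_vec word scale_right_diff_distrib mult_ac del: word_vec_Cons distrib_left_numeral)
  then have "(4 * k * (k + 2)) *s (Y conf n u - Y omega n u) = (k + 2) *s Y (Y (x H) (-1) (x H)) n u"
    by (metis Y_diff_left Y_scale_left)
  moreover have "Y (Y (x H) (-1) (x H)) n u \<in> {0}"
    by (rule associator_in_subspace) (use assms in \<open>auto simp: N0_def\<close>)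
  ultimately show ?thesis by (simp del: distrib_left_numeral)
qed

lemma is_W_conf:
  assumes "is_W i v"
  shows "Y conf 2 v = 0" "coset_L2 v = 0"
  using assms conf_omega_on_N0[of v] by (auto simp: is_W_def coset_L2_def N0_def)

text \<open>Only existence of the coefficients is asserted; what determines them is
  \<open>independent_2\<close>, \<open>independent_3\<close> and
  \<open>independent_4\<close>.\<close>

lemma pure_expansion:
  assumes "v \<in> N0" "has_weight v d"
    and pure: "\<And>w. pbw_word w \<Longrightarrow> word_weight w = d \<Longrightarrow> word_charge w = 0 \<Longrightarrow>
        \<forall>m\<in>set w. fst m \<noteq> H \<Longrightarrow> w \<in> set ws"
  obtains q where "v - (\<Sum>w\<in>set ws. q w *s word_vec w) \<in> Hspace d"
proof -
  define S where "S = {y. \<exists>q. y - (\<Sum>w\<in>set ws. q w *s word_vec w) \<in> Hspace d}"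
  have SI: "y \<in> S" if "y - (\<Sum>w\<in>set ws. q w *s word_vec w) \<in> Hspace d" for y q
    using that by (auto simp: S_def)
  have "v \<in> S"
  proof (rule pure_words_reach[OF assms(1,2)])
    fix w assume "pbw_word w" "word_weight w = d" "word_charge w = 0" "\<forall>m\<in>set w. fst m \<noteq> H"
    then have "w \<in> set ws" by (rule pure)
    then show "word_vec w \<in> S"
      by (intro SI[of _ "\<lambda>u. if u = w then 1 else 0"])
        (simp add: if_distrib[of "\<lambda>q. q *s _"] subspace_0 cong: if_cong)
  next
    show "Hspace d \<subseteq> S" by (auto intro!: SI[of _ "\<lambda>_. 0"])
    show "subspace S"
      unfolding subspace_def
    proof (intro conjI ballI allI)
      show "0 \<in> S" by (auto intro!: SI[of _ "\<lambda>_. 0"] simp: subspace_0)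
    next
      fix y z assume "y \<in> S" "z \<in> S"
      then obtain q q' where "y - (\<Sum>w\<in>set ws. q w *s word_vec w) \<in> Hspace d"
        "z - (\<Sum>w\<in>set ws. q' w *s word_vec w) \<in> Hspace d" by (auto simp: S_def)
      from subspace_add[OF subspace_Hfrom this] show "y + z \<in> S"
        by (intro SI[of _ "\<lambda>w. q w + q' w"]) (simp add: scale_left_distrib sum.distrib algebra_simps)
    next
      fix a y assume "y \<in> S"
      then obtain q where "y - (\<Sum>w\<in>set ws. q w *s word_vec w) \<in> Hspace d" by (auto simp: S_def)
      from subspace_scale[OF subspace_Hfrom this, of a] show "a *s y \<in> S"
        by (intro SI[of _ "\<lambda>w. a * q w"]) (simp add: scale_right_diff_distrib scale_sum_right)
    qed
  qed
  then show thesis using that by (auto simp: S_def)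
qed

text \<open>Turns a condition \<open>L y = 0\<close> into a relation among pure words of lower
  weight: \<open>L\<close> respects \<open>Hspace\<close>, so it may be applied to the expansion of
  \<open>y\<close> and the words beginning with \<open>H\<close> discarded again.\<close>

lemma operator_relation:
  assumes L: "\<And>u v. L (u + v) = L u + L v" "\<And>a v. L (a *s v) = a *s L v"
    and HL: "\<And>r. r \<in> Hspace d \<Longrightarrow> L r \<in> Hspace d'"
    and lin: "\<And>w. lin (lv w) = L (word_vec w)"
    and neutral: "list_all (\<lambda>w. neutral_of_weight d' (lv w)) ws"
    and y: "y - (\<Sum>w\<in>set ws. q w *s word_vec w) \<in> Hspace d" "L y = 0"
  shows "(\<Sum>w\<in>set ws. q w *s lin (drop_H (lv w))) \<in> Hspace d'"
proof -
  have L0: "L 0 = 0" using L(2)[of 0 0] by simp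
  have Lsum: "L (sum g A) = (\<Sum>a\<in>A. L (g a))" for g and A :: "mode_word set"
    by (induction A rule: infinite_finite_induct) (auto simp: L L0)
  let ?s = "\<Sum>w\<in>set ws. q w *s word_vec w"
  have "L (y - ?s) + L ?s = 0" using L(1)[of "y - ?s" ?s] y(2) by simp
  then have "(\<Sum>w\<in>set ws. q w *s lin (lv w)) = - L (y - ?s)"
    by (simp add: Lsum L lin eq_neg_iff_add_eq_0 add.commute)
  also have "\<dots> \<in> Hspace d'" using HL[OF y(1)] by (intro subspace_neg) auto
  finally have "(\<Sum>w\<in>set ws. q w *s lin (lv w)) \<in> Hspace d'" .
  moreover have "(\<Sum>w\<in>set ws. q w *s (lin (lv w) - lin (drop_H (lv w)))) \<in> Hspace d'"
    using neutral by (intro subspace_sum subspace_scale lin_drop_H) (auto simp: list_all_iff)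
  ultimately have "(\<Sum>w\<in>set ws. q w *s lin (lv w))
      - (\<Sum>w\<in>set ws. q w *s (lin (lv w) - lin (drop_H (lv w)))) \<in> Hspace d'"
    by (intro subspace_diff) auto
  then show ?thesis by (simp add: scale_right_diff_distrib sum_subtractf)
qed

lemma L1_relation:
  assumes K: "pev K k = k"
    and "list_all (\<lambda>w. neutral_of_weight (d - 1) (virv K 1 [(w, [1])])) ws"
    and "y - (\<Sum>w\<in>set ws. q w *s word_vec w) \<in> Hspace d" "Y conf 2 y = 0"
  shows "(\<Sum>w\<in>set ws. q w *s lin (drop_H (virv K 1 [(w, [1])]))) \<in> Hspace (d - 1)"
  by (rule operator_relation[where L = "Y conf 2" and d = d and y = y])
     (use assms Hspace_L1 in \<open>auto simp: Y_linear lin_virv[OF K]\<close>)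

lemma lin_coset_L2_vec: "pev K k = k \<Longrightarrow> lin (coset_L2_vec K v) = coset_L2 (lin v)"
  by (simp add: coset_L2_vec_def combine_def coset_L2_def lin_virv lin_actv)

lemma coset_L2_relation:
  assumes K: "pev K k = k"
    and "list_all (\<lambda>w. neutral_of_weight (d - 2) (coset_L2_vec K [(w, [1])])) ws"
    and "y - (\<Sum>w\<in>set ws. q w *s word_vec w) \<in> Hspace d" "coset_L2 y = 0"
  shows "(\<Sum>w\<in>set ws. q w *s lin (drop_H (coset_L2_vec K [(w, [1])]))) \<in> Hspace (d - 2)"
  by (rule operator_relation[where L = coset_L2 and d = d and y = y])
     (use assms Hspace_coset_L2 in \<open>auto simp: coset_L2_linear lin_coset_L2_vec[OF K]\<close>)

text \<open>\<open>coset_L2\<close> sends the word to \<open>4 k (k - 1)\<close> times the vacuum,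
  whereas \<open>Hspace\<close> in weight 0 is zero.\<close>

lemma independent_2:
  assumes "a *s word_vec [(E,-1),(F,-1)] \<in> Hspace 2"
  shows "a = 0"
proof -
  have "lin (coset_L2_vec [0,1] [([(E,-1),(F,-1)], [1])]) = lin [([], [0,-4,4])]"
    by (rule lin_eqI) code_simp
  then have "coset_L2 (word_vec [(E,-1),(F,-1)]) = (4 * k * (k - 1)) *s vac"
    by (simp add: lin_coset_L2_vec algebra_simps)
  then have "(a * (4 * k * (k - 1))) *s vac \<in> Hspace (2 - 2)"
    using Hspace_coset_L2[OF assms] by (simp add: coset_L2_linear del: word_vec_Cons)
  then have "(a * (4 * k * (k - 1))) *s vac = 0" by (intro Hspace_nonpos) simp
  then show ?thesis using nontrivial by simp
qed


text \<open>Detected by \<open>e(2) f(1)\<close>, which sends \<open>W3\<close> to a multiple of the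
  vacuum; the factor \<open>k - 2\<close> of that multiple matches \<open>W3\<close> being singular
  at level 2.\<close>

lemma W3_nonzero:
  assumes "l \<ge> 3"
  shows "W3 \<noteq> 0"
proof
  assume "W3 = 0"
  have "lin (actv [0,1] (E, 2) (actv [0,1] (F, 1) W3_vec)) = lin [([], [0,-16,12,10,-6])]"
    by (rule lin_eqI) code_simp
  then have "pev [0,-16,12,10,-6] k *s vac = e 2 (f 1 W3)" by (simp add: lin_actv lin_W3_vec)
  then have "pev [0,-16,12,10,-6] k *s vac = 0" using \<open>W3 = 0\<close> by (simp only: Y_zero_right)
  moreover have "pev [0,-16,12,10,-6] k = - 2 * k * ((3 * k + 4) * ((k - 1) * (k - 2)))"
    by (simp add: algebra_simps)
  moreover have "3 * k + 4 \<noteq> 0" using pev_nonzero[of "[4,3]"] by (simp add: algebra_simps)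
  moreover have "k \<noteq> 2" using level assms by (simp add: complex_eq_iff)
  ultimately show False using nontrivial by simp
qed

text \<open>\<open>L(1)\<close> with \<open>independent_2\<close> gives \<open>b = - a\<close>. What
  remains is \<open>a\<close> times the difference of the words, which modulo \<open>Hspace\<close>
  is \<open>W3\<close> up to \<open>3 k^2\<close>; so \<open>a *s W3\<close> lies in both
  \<open>N0\<close> and \<open>Hspace\<close>.\<close>

lemma independent_3:
  assumes l: "l \<ge> 3"
    and ab: "a *s word_vec [(E,-2),(F,-1)] + b *s word_vec [(E,-1),(F,-2)] \<in> Hspace 3"
  shows "a = 0 \<and> b = 0"
proof -
  let ?u = "word_vec [(E,-2),(F,-1)]" and ?v = "word_vec [(E,-1),(F,-2)]"
  define y where "y = a *s ?u + b *s ?v"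
  have u: "Y conf 2 ?u = 2 *s word_vec [(E,-1),(F,-1)]"
  proof -
    have "lin (virv [0,1] 1 [([(E,-2),(F,-1)], [1])]) = lin [([(E,-1),(F,-1)], [2])]"
      by (rule lin_eqI) code_simp
    then show ?thesis by (simp add: lin_virv)
  qed
  have v: "Y conf 2 ?v - 2 *s word_vec [(E,-1),(F,-1)] \<in> Hspace 2"
  proof -
    let ?w = "virv [0,1] 1 [([(E,-1),(F,-2)], [1])]"
    have "lin ?w - lin (drop_H ?w) \<in> Hspace 2" by (rule lin_drop_H) code_simp
    moreover have "drop_H ?w = [([(E,-1),(F,-1)], [2])]" by code_simp
    ultimately show ?thesis by (simp add: lin_virv)
  qed
  have "Y conf 2 y - b *s (Y conf 2 ?v - 2 *s word_vec [(E,-1),(F,-1)]) \<in> Hspace 2"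
    using Hspace_L1[OF ab] by (intro subspace_diff subspace_scale v) (simp_all add: y_def)
  also have "Y conf 2 y - b *s (Y conf 2 ?v - 2 *s word_vec [(E,-1),(F,-1)]) =
      (2 * a + 2 * b) *s word_vec [(E,-1),(F,-1)]"
    unfolding y_def Y_linear u
    by (simp add: scale_right_diff_distrib scale_left_distrib mult.commute del: word_vec_Cons)
  finally have "2 * a + 2 * b = 0" by (rule independent_2)
  then have b: "b = - a" by algebra
  have "lin W3_vec - lin (drop_H W3_vec) \<in> Hspace 3" by (rule lin_drop_H) code_simp
  moreover have "drop_H W3_vec = [([(E,-2),(F,-1)], [0,0,3]), ([(E,-1),(F,-2)], [0,0,-3])]" by code_simp
  ultimately have W: "W3 - ((3 * k\<^sup>2) *s ?u - (3 * k\<^sup>2) *s ?v) \<in> Hspace 3"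
    by (simp add: lin_W3_vec power2_eq_square mult_ac del: word_vec_Cons)
  have "a *s (W3 - ((3 * k\<^sup>2) *s ?u - (3 * k\<^sup>2) *s ?v)) + (3 * k\<^sup>2) *s (a *s ?u + b *s ?v) \<in> Hspace 3"
    by (rule subspace_add[OF subspace_Hfrom subspace_scale[OF subspace_Hfrom W]
        subspace_scale[OF subspace_Hfrom ab]])
  also have "a *s (W3 - ((3 * k\<^sup>2) *s ?u - (3 * k\<^sup>2) *s ?v)) + (3 * k\<^sup>2) *s (a *s ?u + b *s ?v) = a *s W3"
    by (simp add: b scale_right_diff_distrib mult_ac del: word_vec_Cons)
  finally have "a *s W3 \<in> Hspace 3" .
  moreover have "a *s W3 \<in> N0"
    using W3_in_N0 N0_subalgebra by (auto simp: vertex_subalgebra_def intro: subspace_scale)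
  ultimately have "a *s W3 = 0" by (intro N0_Hspace_eq_0)
  then show ?thesis using W3_nonzero[OF l] b by simp
qed

section \<open>Linear systems for the coefficients in weights 4 and 5\<close>

abbreviation pure_4 :: "mode_word list" where
  "pure_4 \<equiv> [[(E,-3),(F,-1)], [(E,-2),(F,-2)], [(E,-1),(F,-3)], [(E,-1),(E,-1),(F,-1),(F,-1)]]"

abbreviation pure_5 :: "mode_word list" where
  "pure_5 \<equiv> [[(E,-4),(F,-1)], [(E,-3),(F,-2)], [(E,-2),(F,-3)], [(E,-1),(F,-4)],
      [(E,-1),(E,-1),(F,-2),(F,-1)], [(E,-2),(E,-1),(F,-1),(F,-1)]]"

lemma L1_pure_4:
  assumes "y - (\<Sum>w\<in>set pure_4. q w *s word_vec w) \<in> Hspace 4" "Y conf 2 y = 0"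
  shows "(3 * q [(E,-3),(F,-1)] + 2 * q [(E,-2),(F,-2)] - 8 * q [(E,-1),(E,-1),(F,-1),(F,-1)])
        *s word_vec [(E,-2),(F,-1)]
      + (2 * q [(E,-2),(F,-2)] + 3 * q [(E,-1),(F,-3)] + 4 * q [(E,-1),(E,-1),(F,-1),(F,-1)])
        *s word_vec [(E,-1),(F,-2)] \<in> Hspace 3"
proof -
  let ?L = "\<lambda>w. lin (drop_H (virv [0,1] 1 [(w, [1])]))"
  have table:
    "?L [(E,-3),(F,-1)] = lin [([(E,-2),(F,-1)], [3])]"
    "?L [(E,-2),(F,-2)] = lin [([(E,-2),(F,-1)], [2]), ([(E,-1),(F,-2)], [2])]"
    "?L [(E,-1),(F,-3)] = lin [([(E,-1),(F,-2)], [3])]"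
    "?L [(E,-1),(E,-1),(F,-1),(F,-1)] = lin [([(E,-2),(F,-1)], [-8]), ([(E,-1),(F,-2)], [4])]"
    by (rule lin_eqI, code_simp)+
  have "list_all (\<lambda>w. neutral_of_weight (4 - 1) (virv [0,1] 1 [(w, [1])])) pure_4" by code_simp
  from L1_relation[OF pev_generic this assms]
  have "(\<Sum>w\<in>set pure_4. q w *s ?L w) \<in> Hspace 3" by simp
  also have "(\<Sum>w\<in>set pure_4. q w *s ?L w) =
      q [(E,-3),(F,-1)] *s ?L [(E,-3),(F,-1)] + q [(E,-2),(F,-2)] *s ?L [(E,-2),(F,-2)]
      + q [(E,-1),(F,-3)] *s ?L [(E,-1),(F,-3)]
      + q [(E,-1),(E,-1),(F,-1),(F,-1)] *s ?L [(E,-1),(E,-1),(F,-1),(F,-1)]"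
    by (simp add: add.assoc)
  finally show ?thesis
    unfolding table by (simp add: algebra_simps del: word_vec_Cons)
qed

lemma coset_L2_pure_4:
  assumes "y - (\<Sum>w\<in>set pure_4. q w *s word_vec w) \<in> Hspace 4" "coset_L2 y = 0"
  shows "(12 * k - 4) * q [(E,-3),(F,-1)] + 8 * q [(E,-2),(F,-2)] + (12 * k - 4) * q [(E,-1),(F,-3)]
      + (48 - 32 * k + 16 * k\<^sup>2) * q [(E,-1),(E,-1),(F,-1),(F,-1)] = 0"
proof (rule independent_2)
  let ?L = "\<lambda>w. lin (drop_H (coset_L2_vec [0,1] [(w, [1])]))"
  have table:
    "?L [(E,-3),(F,-1)] = lin [([(E,-1),(F,-1)], [-4,12])]"
    "?L [(E,-2),(F,-2)] = lin [([(E,-1),(F,-1)], [8])]"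
    "?L [(E,-1),(F,-3)] = lin [([(E,-1),(F,-1)], [-4,12])]"
    "?L [(E,-1),(E,-1),(F,-1),(F,-1)] = lin [([(E,-1),(F,-1)], [48,-32,16])]"
    by (rule lin_eqI, code_simp)+
  have "list_all (\<lambda>w. neutral_of_weight (4 - 2) (coset_L2_vec [0,1] [(w, [1])])) pure_4" by code_simp
  from coset_L2_relation[OF pev_generic this assms]
  have "(\<Sum>w\<in>set pure_4. q w *s ?L w) \<in> Hspace 2" by simp
  also have "(\<Sum>w\<in>set pure_4. q w *s ?L w) =
      q [(E,-3),(F,-1)] *s ?L [(E,-3),(F,-1)] + q [(E,-2),(F,-2)] *s ?L [(E,-2),(F,-2)]
      + q [(E,-1),(F,-3)] *s ?L [(E,-1),(F,-3)]
      + q [(E,-1),(E,-1),(F,-1),(F,-1)] *s ?L [(E,-1),(E,-1),(F,-1),(F,-1)]"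
    by (simp add: add.assoc)
  finally show "((12 * k - 4) * q [(E,-3),(F,-1)] + 8 * q [(E,-2),(F,-2)] + (12 * k - 4) * q [(E,-1),(F,-3)]
      + (48 - 32 * k + 16 * k\<^sup>2) * q [(E,-1),(E,-1),(F,-1),(F,-1)]) *s word_vec [(E,-1),(F,-1)] \<in> Hspace 2"
    unfolding table by (simp add: algebra_simps power2_eq_square del: word_vec_Cons)
qed

text \<open>Independence in weights 3 and 2 splits the relations into scalar equations. Three
  equations for four unknowns leave a line of solutions at levels 3 and 4.\<close>

lemma pure_4_equations:
  assumes "l \<ge> 3" "y - (\<Sum>w\<in>set pure_4. q w *s word_vec w) \<in> Hspace 4"
    "Y conf 2 y = 0" "coset_L2 y = 0"
  shows "3 * q [(E,-3),(F,-1)] + 2 * q [(E,-2),(F,-2)] - 8 * q [(E,-1),(E,-1),(F,-1),(F,-1)] = 0"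
    "2 * q [(E,-2),(F,-2)] + 3 * q [(E,-1),(F,-3)] + 4 * q [(E,-1),(E,-1),(F,-1),(F,-1)] = 0"
    "(12 * k - 4) * q [(E,-3),(F,-1)] + 8 * q [(E,-2),(F,-2)] + (12 * k - 4) * q [(E,-1),(F,-3)]
      + (48 - 32 * k + 16 * k\<^sup>2) * q [(E,-1),(E,-1),(F,-1),(F,-1)] = 0"
  using independent_3[OF assms(1) L1_pure_4[OF assms(2,3)]] coset_L2_pure_4[OF assms(2,4)] by blast+

lemma sum_pure_4:
  "(\<Sum>w\<in>set pure_4. q w *s word_vec w) =
     q [(E,-3),(F,-1)] *s word_vec [(E,-3),(F,-1)] + q [(E,-2),(F,-2)] *s word_vec [(E,-2),(F,-2)]
     + q [(E,-1),(F,-3)] *s word_vec [(E,-1),(F,-3)]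
     + q [(E,-1),(E,-1),(F,-1),(F,-1)] *s word_vec [(E,-1),(E,-1),(F,-1),(F,-1)]"
  by (simp add: add.assoc del: word_vec_Cons)

lemma sum_pure_5:
  "(\<Sum>w\<in>set pure_5. q w *s word_vec w) =
     q [(E,-4),(F,-1)] *s word_vec [(E,-4),(F,-1)] + q [(E,-3),(F,-2)] *s word_vec [(E,-3),(F,-2)]
     + q [(E,-2),(F,-3)] *s word_vec [(E,-2),(F,-3)] + q [(E,-1),(F,-4)] *s word_vec [(E,-1),(F,-4)]
     + q [(E,-1),(E,-1),(F,-2),(F,-1)] *s word_vec [(E,-1),(E,-1),(F,-2),(F,-1)]
     + q [(E,-2),(E,-1),(F,-1),(F,-1)] *s word_vec [(E,-2),(E,-1),(F,-1),(F,-1)]"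
  by (simp add: add.assoc del: word_vec_Cons)

lemma lowest_scale: "s \<in> lowest d \<Longrightarrow> a *s s \<in> lowest d"
  by (auto simp: lowest_def weight_scale Y_linear)

lemma N0_congruent_eq:
  assumes "v \<in> N0" "s \<in> N0" "v - a *s s \<in> Hspace d"
  shows "v = a *s s"
proof -
  have "v - a *s s \<in> N0"
    using assms(1,2) N0_subalgebra
    by (auto simp: vertex_subalgebra_def intro: subspace_diff subspace_scale)
  from N0_Hspace_eq_0[OF this assms(3)] show ?thesis by simp
qed

text \<open>The solution line at level 3 is that of the pure part of \<open>singular_4\<close>;
  vectors of \<open>N0\<close> with equal pure part coincide.\<close>

lemma W4_lowest:
  assumes l: "l = 3" and W: "is_W 4 v"
  shows "v \<in> lowest 4"
proof -
  have v: "v \<in> N0" "has_weight v 4" using W by (auto simp: is_W_def)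
  obtain q where q: "v - (\<Sum>w\<in>set pure_4. q w *s word_vec w) \<in> Hspace 4"
    by (rule pure_expansion[OF v, of pure_4]) (use pure_word_4 in auto)
  define t where "t = q [(E,-1),(E,-1),(F,-1),(F,-1)]"
  have k: "k = 3" using l level by simp
  note eqs = pure_4_equations[OF _ q is_W_conf[OF W], folded t_def, unfolded power2_eq_square]
  have eq1: "3 * q [(E,-3),(F,-1)] + 2 * q [(E,-2),(F,-2)] - 8 * t = 0"
    and eq2: "2 * q [(E,-2),(F,-2)] + 3 * q [(E,-1),(F,-3)] + 4 * t = 0"
    using eqs l by simp_all
  have "(12 * k - 4) * q [(E,-3),(F,-1)] + 8 * q [(E,-2),(F,-2)] + (12 * k - 4) * q [(E,-1),(F,-3)]
      + (48 - 32 * k + 16 * (k * k)) * t = 0"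
    using eqs(3) l by simp
  then have eq3: "32 * q [(E,-3),(F,-1)] + 8 * q [(E,-2),(F,-2)] + 32 * q [(E,-1),(F,-3)] + 96 * t = 0"
    unfolding k by simp
  have sol: "q [(E,-2),(F,-2)] = 4 * t" "q [(E,-3),(F,-1)] = 0" "q [(E,-1),(F,-3)] = -4 * t"
    using eq1 eq2 eq3 by algebra+
  have "lin singular_4 - lin (drop_H singular_4) \<in> Hspace 4" by (rule lin_drop_H) code_simp
  \<comment> \<open>The pure part of \<open>singular_4\<close> has coefficient 6 at the quartic
    word, that of \<open>v\<close> has \<open>t\<close>.\<close>
  from subspace_diff[OF subspace_Hfrom q subspace_scale[OF subspace_Hfrom this, of "t / 6"]]
  have "v - (\<Sum>w\<in>set pure_4. q w *s word_vec w) - (t / 6) *s (lin singular_4 - lin (drop_H singular_4))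
    \<in> Hspace 4" .
  also have "lin (drop_H singular_4) = lin [([(E,-2),(F,-2)], [24]),
      ([(E,-1),(E,-1),(F,-1),(F,-1)], [6]), ([(E,-1),(F,-3)], [-24])]"
    by (rule lin_eqI) code_simp
  also have "v - (\<Sum>w\<in>set pure_4. q w *s word_vec w) - (t / 6) *s (lin singular_4 - lin
      [([(E,-2),(F,-2)], [24]), ([(E,-1),(E,-1),(F,-1),(F,-1)], [6]), ([(E,-1),(F,-3)], [-24])])
      = v - (t / 6) *s lin singular_4"
    unfolding sum_pure_4 t_def[symmetric] sol
    by (simp add: scale_right_diff_distrib scale_right_distrib mult.commute del: word_vec_Cons)
  finally have "v = (t / 6) *s lin singular_4"
    by (rule N0_congruent_eq[OF v(1) singular_4_in_N0[OF l]])
  then show ?thesis using singular_4_lowest[OF l] lowest_scale by simp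
qed

text \<open>A relation is an expansion of the zero vector, so its coefficients solve the same system
  as those of \<open>v\<close>. The solutions form a line, hence \<open>d *s v\<close> is in
  \<open>Hspace\<close>, and \<open>v \<noteq> 0\<close> forces \<open>d = 0\<close>.\<close>

lemma independent_4:
  assumes l: "l = 4" and W: "is_W 4 v"
    and z: "a *s word_vec [(E,-3),(F,-1)] + b *s word_vec [(E,-2),(F,-2)]
      + g *s word_vec [(E,-1),(F,-3)] + d *s word_vec [(E,-1),(E,-1),(F,-1),(F,-1)] \<in> Hspace 4"
      (is "?z \<in> _")
  shows "a = 0 \<and> b = 0 \<and> g = 0 \<and> d = 0"
proof -
  have k: "k = 4" using l level by simp
  have solve: "19 * q [(E,-3),(F,-1)] = -8 * t \<and> 19 * q [(E,-2),(F,-2)] = 88 * t \<and>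
      19 * q [(E,-1),(F,-3)] = -84 * t"
    if y: "y - (\<Sum>w\<in>set pure_4. q w *s word_vec w) \<in> Hspace 4" "Y conf 2 y = 0" "coset_L2 y = 0"
      and t: "t = q [(E,-1),(E,-1),(F,-1),(F,-1)]" for y q t
  proof -
    note eqs = pure_4_equations[OF _ y, folded t, unfolded power2_eq_square]
    have eq1: "3 * q [(E,-3),(F,-1)] + 2 * q [(E,-2),(F,-2)] - 8 * t = 0"
      and eq2: "2 * q [(E,-2),(F,-2)] + 3 * q [(E,-1),(F,-3)] + 4 * t = 0"
      using eqs l by simp_all
    have "(12 * k - 4) * q [(E,-3),(F,-1)] + 8 * q [(E,-2),(F,-2)] + (12 * k - 4) * q [(E,-1),(F,-3)]
        + (48 - 32 * k + 16 * (k * k)) * t = 0"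
      using eqs(3) l by simp
    then have eq3: "44 * q [(E,-3),(F,-1)] + 8 * q [(E,-2),(F,-2)] + 44 * q [(E,-1),(F,-3)] + 176 * t = 0"
      unfolding k by simp
    show ?thesis using eq1 eq2 eq3 by (intro conjI) algebra+
  qed
  have v: "v \<in> N0" "has_weight v 4" "v \<noteq> 0" using W by (auto simp: is_W_def)
  obtain q where q: "v - (\<Sum>w\<in>set pure_4. q w *s word_vec w) \<in> Hspace 4"
    by (rule pure_expansion[OF v(1,2), of pure_4]) (use pure_word_4 in auto)
  define p :: "mode_word \<Rightarrow> complex" where "p w = (if w = [(E,-3),(F,-1)] then a else if w = [(E,-2),(F,-2)] then b
      else if w = [(E,-1),(F,-3)] then g else d)" for w
  have p: "p [(E,-3),(F,-1)] = a" "p [(E,-2),(F,-2)] = b" "p [(E,-1),(F,-3)] = g"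
    "p [(E,-1),(E,-1),(F,-1),(F,-1)] = d"
    by (simp_all add: p_def)
  have z0: "0 - (\<Sum>w\<in>set pure_4. p w *s word_vec w) \<in> Hspace 4"
    unfolding sum_pure_4 p using subspace_neg[OF subspace_Hfrom z] by simp
  have "coset_L2 0 = 0" by (simp add: coset_L2_def)
  note solve[OF z0 Y_zero_right this p(4)[symmetric], unfolded p]
  then have s1: "19 * a = -8 * d" "19 * b = 88 * d" "19 * g = -84 * d" by auto
  define t where "t = q [(E,-1),(E,-1),(F,-1),(F,-1)]"
  have s2: "19 * q [(E,-3),(F,-1)] = -8 * t" "19 * q [(E,-2),(F,-2)] = 88 * t"
    "19 * q [(E,-1),(F,-3)] = -84 * t"
    using solve[OF q is_W_conf[OF W] t_def] by auto
  \<comment> \<open>Two points of the solution line, cross-multiplied by their last coordinates;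
    this avoids dividing by \<open>t\<close>.\<close>
  have s3: "d * q [(E,-3),(F,-1)] = t * a" "d * q [(E,-2),(F,-2)] = t * b" "d * q [(E,-1),(F,-3)] = t * g"
    using s1 s2 by algebra+
  have "d *s (\<Sum>w\<in>set pure_4. q w *s word_vec w) = t *s ?z"
    unfolding sum_pure_4 t_def[symmetric]
    by (simp add: scale_right_distrib s3 mult.commute[of d t] del: word_vec_Cons)
  then have "d *s v = d *s (v - (\<Sum>w\<in>set pure_4. q w *s word_vec w)) + t *s ?z"
    by (simp add: scale_right_diff_distrib)
  also have "\<dots> \<in> Hspace 4"
    by (rule subspace_add[OF subspace_Hfrom subspace_scale[OF subspace_Hfrom q]
        subspace_scale[OF subspace_Hfrom z]])
  finally have "d *s v \<in> Hspace 4" .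
  moreover have "d *s v \<in> N0"
    using v N0_subalgebra by (auto simp: vertex_subalgebra_def intro: subspace_scale)
  ultimately have "d *s v = 0" by (intro N0_Hspace_eq_0)
  then have "d = 0" using v(3) by simp
  then show ?thesis using s1 by simp
qed

lemma L1_pure_5:
  assumes "y - (\<Sum>w\<in>set pure_5. q w *s word_vec w) \<in> Hspace 5" "Y conf 2 y = 0"
    and "c1 = q [(E,-4),(F,-1)]" "c2 = q [(E,-3),(F,-2)]" "c3 = q [(E,-2),(F,-3)]"
    "c4 = q [(E,-1),(F,-4)]" "c5 = q [(E,-1),(E,-1),(F,-2),(F,-1)]"
    "c6 = q [(E,-2),(E,-1),(F,-1),(F,-1)]"
  shows "(4 * c1 + 2 * c2 - 4 * c5 - 4 * c6) *s word_vec [(E,-3),(F,-1)]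
      + (3 * c2 + 3 * c3 - 4 * c5 + 2 * c6) *s word_vec [(E,-2),(F,-2)]
      + (2 * c3 + 4 * c4 + 4 * c5) *s word_vec [(E,-1),(F,-3)]
      + (2 * c5 + 2 * c6) *s word_vec [(E,-1),(E,-1),(F,-1),(F,-1)] \<in> Hspace 4"
proof -
  let ?L = "\<lambda>w. lin (drop_H (virv [0,1] 1 [(w, [1])]))"
  have table:
    "?L [(E,-4),(F,-1)] = lin [([(E,-3),(F,-1)], [4])]"
    "?L [(E,-3),(F,-2)] = lin [([(E,-3),(F,-1)], [2]), ([(E,-2),(F,-2)], [3])]"
    "?L [(E,-2),(F,-3)] = lin [([(E,-2),(F,-2)], [3]), ([(E,-1),(F,-3)], [2])]"
    "?L [(E,-1),(F,-4)] = lin [([(E,-1),(F,-3)], [4])]"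
    "?L [(E,-1),(E,-1),(F,-2),(F,-1)] = lin [([(E,-3),(F,-1)], [-4]), ([(E,-2),(F,-2)], [-4]),
        ([(E,-1),(F,-3)], [4]), ([(E,-1),(E,-1),(F,-1),(F,-1)], [2])]"
    "?L [(E,-2),(E,-1),(F,-1),(F,-1)] = lin [([(E,-3),(F,-1)], [-4]), ([(E,-2),(F,-2)], [2]),
        ([(E,-1),(E,-1),(F,-1),(F,-1)], [2])]"
    by (rule lin_eqI, code_simp)+
  have "list_all (\<lambda>w. neutral_of_weight (5 - 1) (virv [0,1] 1 [(w, [1])])) pure_5" by code_simp
  from L1_relation[OF pev_generic this assms(1,2)]
  have "(\<Sum>w\<in>set pure_5. q w *s ?L w) \<in> Hspace 4" by simp
  also have "(\<Sum>w\<in>set pure_5. q w *s ?L w) =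
      c1 *s ?L [(E,-4),(F,-1)] + c2 *s ?L [(E,-3),(F,-2)] + c3 *s ?L [(E,-2),(F,-3)]
      + c4 *s ?L [(E,-1),(F,-4)] + c5 *s ?L [(E,-1),(E,-1),(F,-2),(F,-1)]
      + c6 *s ?L [(E,-2),(E,-1),(F,-1),(F,-1)]"
    by (simp add: add.assoc assms)
  finally show ?thesis
    unfolding table by (simp add: algebra_simps del: word_vec_Cons)
qed

lemma coset_L2_pure_5:
  assumes "y - (\<Sum>w\<in>set pure_5. q w *s word_vec w) \<in> Hspace 5" "coset_L2 y = 0"
    and "c1 = q [(E,-4),(F,-1)]" "c2 = q [(E,-3),(F,-2)]" "c3 = q [(E,-2),(F,-3)]"
    "c4 = q [(E,-1),(F,-4)]" "c5 = q [(E,-1),(E,-1),(F,-2),(F,-1)]"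
    "c6 = q [(E,-2),(E,-1),(F,-1),(F,-1)]"
  shows "((16 * k - 4) * c1 + 8 * c2 + (12 * k - 4) * c3 - (32 + 16 * k) * c5
        + (56 - 48 * k + 8 * k\<^sup>2) * c6) *s word_vec [(E,-2),(F,-1)]
      + ((12 * k - 4) * c2 + 8 * c3 + (16 * k - 4) * c4 + (48 - 8 * k + 8 * k\<^sup>2) * c5
        + (16 * k - 24) * c6) *s word_vec [(E,-1),(F,-2)] \<in> Hspace 3"
proof -
  let ?L = "\<lambda>w. lin (drop_H (coset_L2_vec [0,1] [(w, [1])]))"
  have table:
    "?L [(E,-4),(F,-1)] = lin [([(E,-2),(F,-1)], [-4,16])]"
    "?L [(E,-3),(F,-2)] = lin [([(E,-2),(F,-1)], [8]), ([(E,-1),(F,-2)], [-4,12])]"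
    "?L [(E,-2),(F,-3)] = lin [([(E,-2),(F,-1)], [-4,12]), ([(E,-1),(F,-2)], [8])]"
    "?L [(E,-1),(F,-4)] = lin [([(E,-1),(F,-2)], [-4,16])]"
    "?L [(E,-1),(E,-1),(F,-2),(F,-1)] = lin [([(E,-2),(F,-1)], [-32,-16]), ([(E,-1),(F,-2)], [48,-8,8])]"
    "?L [(E,-2),(E,-1),(F,-1),(F,-1)] = lin [([(E,-2),(F,-1)], [56,-48,8]), ([(E,-1),(F,-2)], [-24,16])]"
    by (rule lin_eqI, code_simp)+
  have "list_all (\<lambda>w. neutral_of_weight (5 - 2) (coset_L2_vec [0,1] [(w, [1])])) pure_5" by code_simp
  from coset_L2_relation[OF pev_generic this assms(1,2)]
  have "(\<Sum>w\<in>set pure_5. q w *s ?L w) \<in> Hspace 3" by simp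
  also have "(\<Sum>w\<in>set pure_5. q w *s ?L w) =
      c1 *s ?L [(E,-4),(F,-1)] + c2 *s ?L [(E,-3),(F,-2)] + c3 *s ?L [(E,-2),(F,-3)]
      + c4 *s ?L [(E,-1),(F,-4)] + c5 *s ?L [(E,-1),(E,-1),(F,-2),(F,-1)]
      + c6 *s ?L [(E,-2),(E,-1),(F,-1),(F,-1)]"
    by (simp add: add.assoc assms)
  finally show ?thesis
    unfolding table by (simp add: algebra_simps power2_eq_square del: word_vec_Cons)
qed

text \<open>The vector \<open>u\<close> enters through \<open>independent_4\<close>: its being
  nonzero makes the four coefficients of the \<open>L(1)\<close> relation vanish separately.\<close>

lemma W5_lowest:
  assumes l: "l = 4" and W4: "is_W 4 u" and W: "is_W 5 v"
  shows "v \<in> lowest 5"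
proof -
  have k: "k = 4" using l level by simp
  have v: "v \<in> N0" "has_weight v 5" using W by (auto simp: is_W_def)
  obtain q where q: "v - (\<Sum>w\<in>set pure_5. q w *s word_vec w) \<in> Hspace 5"
    by (rule pure_expansion[OF v, of pure_5]) (use pure_word_5 in auto)
  define c1 where "c1 = q [(E,-4),(F,-1)]"
  define c2 where "c2 = q [(E,-3),(F,-2)]"
  define c3 where "c3 = q [(E,-2),(F,-3)]"
  define c4 where "c4 = q [(E,-1),(F,-4)]"
  define c5 where "c5 = q [(E,-1),(E,-1),(F,-2),(F,-1)]"
  define c6 where "c6 = q [(E,-2),(E,-1),(F,-1),(F,-1)]"
  note c = c1_def c2_def c3_def c4_def c5_def c6_def
  have eqs: "4 * c1 + 2 * c2 - 4 * c5 - 4 * c6 = 0" "3 * c2 + 3 * c3 - 4 * c5 + 2 * c6 = 0"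
    "2 * c3 + 4 * c4 + 4 * c5 = 0" "2 * c5 + 2 * c6 = 0"
    using independent_4[OF l W4 L1_pure_5[OF q is_W_conf(1)[OF W] c]] by blast+
  \<comment> \<open>This one of the two equations from \<open>coset_L2\<close> already cuts the six
    unknowns down to a line.\<close>
  have "(16 * k - 4) * c1 + 8 * c2 + (12 * k - 4) * c3 - (32 + 16 * k) * c5
        + (56 - 48 * k + 8 * k\<^sup>2) * c6 = 0"
    using independent_3[OF _ coset_L2_pure_5[OF q is_W_conf(2)[OF W] c]] l by simp
  then have eq: "60 * c1 + 8 * c2 + 44 * c3 - 96 * c5 - 8 * c6 = 0"
    unfolding k by simp
  have sol: "c1 = 0" "c2 = 0" "c3 = 2 * c5" "c4 = -2 * c5" "c6 = - c5"
    using eqs eq by algebra+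
  have "lin singular_5 - lin (drop_H singular_5) \<in> Hspace 5" by (rule lin_drop_H) code_simp
  \<comment> \<open>\<open>singular_5\<close> has coefficient \<open>-60\<close> at the word
    belonging to \<open>c5\<close>.\<close>
  from subspace_diff[OF subspace_Hfrom q subspace_scale[OF subspace_Hfrom this, of "- c5 / 60"]]
  have "v - (\<Sum>w\<in>set pure_5. q w *s word_vec w) - (- c5 / 60) *s (lin singular_5 - lin (drop_H singular_5))
    \<in> Hspace 5" .
  also have "lin (drop_H singular_5) = lin [([(E,-2),(E,-1),(F,-1),(F,-1)], [60]),
      ([(E,-2),(F,-3)], [-120]), ([(E,-1),(E,-1),(F,-2),(F,-1)], [-60]), ([(E,-1),(F,-4)], [120])]"
    by (rule lin_eqI) code_simp
  also have "v - (\<Sum>w\<in>set pure_5. q w *s word_vec w) - (- c5 / 60) *s (lin singular_5 -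
      lin [([(E,-2),(E,-1),(F,-1),(F,-1)], [60]), ([(E,-2),(F,-3)], [-120]),
        ([(E,-1),(E,-1),(F,-2),(F,-1)], [-60]), ([(E,-1),(F,-4)], [120])])
      = v - (- c5 / 60) *s lin singular_5"
    unfolding sum_pure_5 c[symmetric] sol
    by (simp add: scale_right_diff_distrib scale_right_distrib mult.commute del: word_vec_Cons)
  finally have "v = (- c5 / 60) *s lin singular_5"
    by (rule N0_congruent_eq[OF v(1) singular_5_in_N0[OF l]])
  then show ?thesis using singular_5_lowest[OF l] lowest_scale by metis
qed

end

theorem mainTheorem4:
  fixes scale :: "complex \<Rightarrow> 'v::ab_group_add \<Rightarrow> 'v"
    and Y :: "'v \<Rightarrow> int \<Rightarrow> 'v \<Rightarrow> 'v"
    and vac conf W3 W4 W5 :: 'v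
    and c :: complex
    and k :: nat
    and x :: "sl2 \<Rightarrow> 'v"
    and W_tilde :: "'v set"
  assumes "k \<ge> 2"
    and "universal_affine_sl2 scale Y vac conf c (of_nat k) x"
    and "W3 = universal_affine_sl2.W3 scale Y vac (of_nat k) x"
    and "universal_affine_sl2.is_W scale Y vac conf (of_nat k) x 4 W4"
    and "universal_affine_sl2.is_W scale Y vac conf (of_nat k) x 5 W5"
    and "W_tilde = universal_affine_sl2.W_tilde scale Y vac (of_nat k) x W4 W5"
  shows "(k \<ge> 3 \<longrightarrow> vertex_algebra.generated_subalgebra scale Y vac {W3} = W_tilde) \<and>
         (k = 2 \<longrightarrow> (\<exists>I. vertex_algebra.maximal_ideal_of scale Y W_tilde I \<and> W3 \<in> I)) \<and>
         (k = 3 \<longrightarrow> (\<exists>I. vertex_algebra.maximal_ideal_of scale Y W_tilde I \<and> W4 \<in> I)) \<and>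
         (k = 4 \<longrightarrow> (\<exists>I. vertex_algebra.maximal_ideal_of scale Y W_tilde I \<and> W5 \<in> I))"
proof -
  interpret A: universal_affine_sl2 scale Y vac conf c "of_nat k" x by (rule assms(2))
  have W4: "A.is_W 4 W4" and W5: "A.is_W 5 W5" by (rule assms)+
  \<comment> \<open>A zero vacuum would make the whole space zero by creation, against
    \<open>W4\<close> being nonzero.\<close>
  have "vac \<noteq> 0"
  proof
    assume "vac = 0"
    then have "W4 = 0" using A.creation[of W4] by simp
    then show False using W4 by (simp add: A.is_W_def)
  qed
  then interpret A: positive_level scale Y vac conf c "of_nat k" x k
    using assms(1) by unfold_locales auto
  have sub: "A.vertex_subalgebra W_tilde"
    unfolding assms(6) A.W_tilde_def by (rule A.generated_subalgebra_is_subalgebra)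
  have mem: "W3 \<in> W_tilde" "W4 \<in> W_tilde" "W5 \<in> W_tilde"
    using A.generated_subalgebra_superset[of "{A.omega, A.W3, W4, W5}"]
    unfolding assms(3,6) A.W_tilde_def by auto
  show ?thesis
  proof (intro conjI impI)
    assume "k \<ge> 3"
    then show "A.generated_subalgebra {W3} = W_tilde"
      unfolding assms(3,6) by (rule A.W3_generates[OF _ W4 W5])
  next
    assume "k = 2"
    then have "W3 \<in> A.lowest 3" unfolding assms(3) by (rule A.W3_lowest)
    then show "\<exists>I. A.maximal_ideal_of W_tilde I \<and> W3 \<in> I"
      by (rule A.lowest_in_maximal_ideal[OF sub mem(1)]) simp
  next
    assume "k = 3"
    then have "W4 \<in> A.lowest 4" by (rule A.W4_lowest[OF _ W4])
    then show "\<exists>I. A.maximal_ideal_of W_tilde I \<and> W4 \<in> I"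
      by (rule A.lowest_in_maximal_ideal[OF sub mem(2)]) simp
  next
    assume "k = 4"
    then have "W5 \<in> A.lowest 5" by (rule A.W5_lowest[OF _ W4 W5])
    then show "\<exists>I. A.maximal_ideal_of W_tilde I \<and> W5 \<in> I"
      by (rule A.lowest_in_maximal_ideal[OF sub mem(3)]) simp
  qed
qed

end
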